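(* There exists a polynomial-time algorithm for Subtour Partition Cover that is $(2,0)$-light for every singleton instance $\mathcal{I}$ with $B=\emptyset$.
   Context: Edge sets are multisets. For $S\subseteq V$: $\delta^+(S),\delta^-(S)$ edges leaving/entering $S$, $\delta(S)$ their union, $\delta^+_F(S)=\delta^+(S)\cap F$ (with multiplicity); $V(F)$ is the set of vertices incident to $F$. $F$ is Eulerian if in- and out-degrees in $F$ agree at every vertex; a subtour is an Eulerian $F$ with $(V(F),F)$ connected ($\emptyset$ is a subtour); for Eulerian $F$, the subtours in $F$ are the connected components of $(V(F),F)$; a collection of subtours means an Eulerian multiset. A subtour $T$ intersects $B$ if $V(T)\cap V(B)\ne\emptyset$. An instance is $\mathcal{I}=(G,\mathcal{L},x,y)$: $G=(V,E)$ strongly connected digraph, $\mathcal{L}$ a laminar family of subsets of $V$, $x\in\mathbb{R}^E$ with $x_e>0$ for all $e$, $x(\delta^+(v))=x(\delta^-(v))$ for all $v$, $x(\delta(S))\ge2$ for all $\emptyset\ne S\subsetneq V$, every $S\in\mathcal{L}$ tight ($x(\delta^+(S))=x(\delta^-(S))=1$), and $y:\mathcal{L}\to\mathbb{R}_{\ge0}$. Induced weight: $w_{\mathcal{I}}(e)=\sum_{S\in\mathcal{L}:e\in\delta(S)}y_S$. A singleton instance is one where every set in $\mathcal{L}$ is a singleton. Let $y_v=y_{\{v\}}$ if $\{v\}\in\mathcal{L}$ and $y_v=0$ otherwise; $\mathrm{lb}(v)=2y_v$, $\mathrm{lb}(U)=\sum_{v\in U}\mathrm{lb}(v)$, $\mathrm{lb}(F)=\mathrm{lb}(V(F))$.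 Subtour Partition Cover: given an instance $\mathcal{I}$, a subtour $B$ in $G$, and a partition $(V_1,\dots,V_k)$ of $V\setminus V(B)$ such that each $G[V_i]$ is strongly connected, find a collection $F$ of subtours with $|\delta^+_F(V_i)|\ge1$ for all $i$. An algorithm for it is $(\alpha,\beta)$-light for $\mathcal{I}$ and $B$ if for every such partition its output $F$ satisfies: $w_{\mathcal{I}}(T)\le\alpha\,\mathrm{lb}(T)$ for every subtour $T$ in $F$ with $V(T)\cap V(B)=\emptyset$, and $w_{\mathcal{I}}(F_B)\le\beta$ where $F_B$ is the collection of subtours in $F$ intersecting $B$.
   Formalization: The trivial partition with a part V_i = V (possible only for B = ∅ and k = 1) is excluded, because no edge leaves V and Subtour Partition Cover then has no solution. *)

theory Defs
  imports
    Complex_Main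
    "HOL-Library.Multiset"
    "HOL-Library.Disjoint_Sets"
    "HOL-Computational_Algebra.Polynomial"
    "Graph_Theory.Digraph_Component"
begin

section \<open>Cuts, Eulerian multisets and subtours\<close>

text \<open>
  Directed graphs are the (finite multi-)digraphs of the library. Parallel arcs have
  different names, and an edge multiset is a multiset of arc names.
\<close>

definition out_cut :: "('a, 'b) pre_digraph \<Rightarrow> 'a set \<Rightarrow> 'b set" where
  "out_cut G S = {e \<in> arcs G. tail G e \<in> S \<and> head G e \<notin> S}"

definition in_cut :: "('a, 'b) pre_digraph \<Rightarrow> 'a set \<Rightarrow> 'b set" where
  "in_cut G S = {e \<in> arcs G. tail G e \<notin> S \<and> head G e \<in> S}"

definition cut :: "('a, 'b) pre_digraph \<Rightarrow> 'a set \<Rightarrow> 'b set" where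
  "cut G S = out_cut G S \<union> in_cut G S"

definition out_cut_in :: "('a, 'b) pre_digraph \<Rightarrow> 'b multiset \<Rightarrow> 'a set \<Rightarrow> 'b multiset" where
  "out_cut_in G F S = {#e \<in># F. e \<in> out_cut G S#}"

definition edge_verts :: "('a, 'b) pre_digraph \<Rightarrow> 'b multiset \<Rightarrow> 'a set" where
  "edge_verts G F = tail G ` set_mset F \<union> head G ` set_mset F"

definition edge_graph :: "('a, 'b) pre_digraph \<Rightarrow> 'b multiset \<Rightarrow> ('a, 'b) pre_digraph" where
  "edge_graph G F = \<lparr> verts = edge_verts G F, arcs = set_mset F, tail = tail G, head = head G \<rparr>"

definition eulerian :: "('a, 'b) pre_digraph \<Rightarrow> 'b multiset \<Rightarrow> bool" where
  "eulerian G F \<longleftrightarrow> set_mset F \<subseteq> arcs G \<and>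
     (\<forall>v \<in> verts G. size {#e \<in># F. tail G e = v#} = size {#e \<in># F. head G e = v#})"

text \<open>The qualified name is needed because of the topological notion \<open>connected\<close>.
  The library's \<open>connected\<close> is false for the null graph.\<close>

definition is_subtour :: "('a, 'b) pre_digraph \<Rightarrow> 'b multiset \<Rightarrow> bool" where
  "is_subtour G F \<longleftrightarrow> eulerian G F \<and> (F = {#} \<or> Digraph_Component.connected (edge_graph G F))"

definition subtours_in :: "('a, 'b) pre_digraph \<Rightarrow> 'b multiset \<Rightarrow> 'b multiset set" where
  "subtours_in G F = {{#e \<in># F. e \<in> arcs H#} | H.
     pre_digraph.max_subgraph (edge_graph G F) Digraph_Component.connected H}"

definition intersects :: "('a, 'b) pre_digraph \<Rightarrow> 'b multiset \<Rightarrow> 'b multiset \<Rightarrow> bool" where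
  "intersects G T B \<longleftrightarrow> edge_verts G T \<inter> edge_verts G B \<noteq> {}"

text \<open>The collection \<open>F\<^sub>B\<close> of the subtours in \<open>F\<close> that intersect \<open>B\<close>.\<close>

definition subtours_meeting ::
    "('a, 'b) pre_digraph \<Rightarrow> 'b multiset \<Rightarrow> 'b multiset \<Rightarrow> 'b multiset" where
  "subtours_meeting G F B = {#e \<in># F. \<exists>T \<in> subtours_in G F. intersects G T B \<and> e \<in># T#}"


section \<open>Instances\<close>

definition laminar :: "'a set set \<Rightarrow> bool" where
  "laminar L \<longleftrightarrow> (\<forall>S \<in> L. \<forall>T \<in> L. S \<subseteq> T \<or> T \<subseteq> S \<or> S \<inter> T = {})"

locale atsp_instance = fin_digraph G for G :: "('a, 'b) pre_digraph" +
  fixes L :: "'a set set" and x :: "'b \<Rightarrow> real" and y :: "'a set \<Rightarrow> real"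
  assumes strongly_connected: "strongly_connected G"
    and L_subsets: "\<And>S. S \<in> L \<Longrightarrow> S \<subseteq> verts G"
    and L_laminar: "laminar L"
    and x_pos: "\<And>e. e \<in> arcs G \<Longrightarrow> x e > 0"
    and x_circulation: "\<And>v. v \<in> verts G \<Longrightarrow> sum x (out_cut G {v}) = sum x (in_cut G {v})"
    and x_cut: "\<And>S. S \<noteq> {} \<Longrightarrow> S \<subset> verts G \<Longrightarrow> sum x (cut G S) \<ge> 2"
    and L_tight: "\<And>S. S \<in> L \<Longrightarrow> sum x (out_cut G S) = 1 \<and> sum x (in_cut G S) = 1"
    and y_nonneg: "\<And>S. S \<in> L \<Longrightarrow> y S \<ge> 0"

definition singleton_family :: "'a set set \<Rightarrow> bool" where
  "singleton_family L \<longleftrightarrow> (\<forall>S \<in> L. \<exists>v. S = {v})"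

definition weight ::
    "('a, 'b) pre_digraph \<Rightarrow> 'a set set \<Rightarrow> ('a set \<Rightarrow> real) \<Rightarrow> 'b \<Rightarrow> real" where
  "weight G L y e = (\<Sum>S \<in> {S \<in> L. e \<in> cut G S}. y S)"

definition total_weight ::
    "('a, 'b) pre_digraph \<Rightarrow> 'a set set \<Rightarrow> ('a set \<Rightarrow> real) \<Rightarrow> 'b multiset \<Rightarrow> real" where
  "total_weight G L y F = (\<Sum>e \<in># F. weight G L y e)"

definition lb_vert :: "'a set set \<Rightarrow> ('a set \<Rightarrow> real) \<Rightarrow> 'a \<Rightarrow> real" where
  "lb_vert L y v = 2 * (if {v} \<in> L then y {v} else 0)"

definition lb ::
    "('a, 'b) pre_digraph \<Rightarrow> 'a set set \<Rightarrow> ('a set \<Rightarrow> real) \<Rightarrow> 'b multiset \<Rightarrow> real" where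
  "lb G L y F = (\<Sum>v \<in> edge_verts G F. lb_vert L y v)"


section \<open>Subtour Partition Cover\<close>

text \<open>
  The parts have to be different from the whole vertex set: for \<open>B = \<emptyset>\<close> and the trivial
  partition \<open>(V)\<close> no edge leaves \<open>V\<close>, so that there is no solution. This is the only case
  which the last condition excludes.
\<close>

definition spc_input :: "('a, 'b) pre_digraph \<Rightarrow> 'a set set \<Rightarrow> ('b \<Rightarrow> real) \<Rightarrow> ('a set \<Rightarrow> real)
    \<Rightarrow> 'b multiset \<Rightarrow> 'a set list \<Rightarrow> bool" where
  "spc_input G L x y B Vs \<longleftrightarrow>
     atsp_instance G L x y \<and> is_subtour G B \<and>
     distinct Vs \<and> partition_on (verts G - edge_verts G B) (set Vs) \<and>
     (\<forall>U \<in> set Vs. strongly_connected (G \<restriction> U)) \<and>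
     verts G \<notin> set Vs"

definition spc_solution :: "('a, 'b) pre_digraph \<Rightarrow> 'a set list \<Rightarrow> 'b multiset \<Rightarrow> bool" where
  "spc_solution G Vs F \<longleftrightarrow> eulerian G F \<and> (\<forall>U \<in> set Vs. size (out_cut_in G F U) \<ge> 1)"


section \<open>Programs and their running time\<close>

text \<open>
  The model of computation is the language of WHILE programs over binary trees (Jones,
  Computability and Complexity from a Programming Perspective). Each evaluation of an
  expression is charged for the full size of all values it computes, so no step is
  cheaper, up to a polynomial, than its execution by a Turing machine.
\<close>

datatype data = Leaf | Node data data

datatype expr =
    Var nat
  | LeafE
  | NodeE expr expr
  | LeftE expr
  | RightE expr
  | EqE expr expr

datatype com =
    Skip
  | Assign nat expr
  | Seq com com
  | IfNode expr com com
  | WhileNode expr com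

type_synonym store = "nat \<Rightarrow> data"

fun left :: "data \<Rightarrow> data" where
  "left Leaf = Leaf"
| "left (Node a b) = a"

fun right :: "data \<Rightarrow> data" where
  "right Leaf = Leaf"
| "right (Node a b) = b"

fun enc_bool :: "bool \<Rightarrow> data" where
  "enc_bool False = Leaf"
| "enc_bool True = Node Leaf Leaf"

primrec aval :: "expr \<Rightarrow> store \<Rightarrow> data" where
  "aval (Var i) s = s i"
| "aval LeafE s = Leaf"
| "aval (NodeE a b) s = Node (aval a s) (aval b s)"
| "aval (LeftE a) s = left (aval a s)"
| "aval (RightE a) s = right (aval a s)"
| "aval (EqE a b) s = enc_bool (aval a s = aval b s)"

text \<open>\<open>size\<close> counts the inner nodes of a tree.\<close>

primrec cost :: "expr \<Rightarrow> store \<Rightarrow> nat" where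
  "cost (Var i) s = 1 + size (s i)"
| "cost LeafE s = 1"
| "cost (NodeE a b) s = cost a s + cost b s + 1 + size (aval (NodeE a b) s)"
| "cost (LeftE a) s = cost a s + 1 + size (aval (LeftE a) s)"
| "cost (RightE a) s = cost a s + 1 + size (aval (RightE a) s)"
| "cost (EqE a b) s = cost a s + cost b s + 1 + size (aval (EqE a b) s)"

text \<open>\<open>exec c s t s'\<close>: started in store \<open>s\<close>, program \<open>c\<close> halts after time \<open>t\<close> in store \<open>s'\<close>.\<close>

inductive exec :: "com \<Rightarrow> store \<Rightarrow> nat \<Rightarrow> store \<Rightarrow> bool" where
  Skip: "exec Skip s 1 s"
| Assign: "exec (Assign i e) s (cost e s) (s(i := aval e s))"
| Seq: "exec c1 s t1 s1 \<Longrightarrow> exec c2 s1 t2 s2 \<Longrightarrow> exec (Seq c1 c2) s (t1 + t2) s2"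
| IfTrue: "aval e s \<noteq> Leaf \<Longrightarrow> exec c1 s t s1 \<Longrightarrow> exec (IfNode e c1 c2) s (cost e s + t) s1"
| IfFalse: "aval e s = Leaf \<Longrightarrow> exec c2 s t s1 \<Longrightarrow> exec (IfNode e c1 c2) s (cost e s + t) s1"
| WhileFalse: "aval e s = Leaf \<Longrightarrow> exec (WhileNode e c) s (cost e s) s"
| WhileTrue: "aval e s \<noteq> Leaf \<Longrightarrow> exec c s t1 s1 \<Longrightarrow> exec (WhileNode e c) s1 t2 s2 \<Longrightarrow>
    exec (WhileNode e c) s (cost e s + t1 + t2) s2"

definition computes :: "com \<Rightarrow> data \<Rightarrow> nat \<Rightarrow> data \<Rightarrow> bool" where
  "computes c d t r \<longleftrightarrow> (\<exists>s. exec c ((\<lambda>_. Leaf)(0 := d)) t s \<and> s 0 = r)"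

lemma exec_determ:
  "exec c s t s1 \<Longrightarrow> exec c s t' s1' \<Longrightarrow> t' = t \<and> s1' = s1"
proof (induction arbitrary: t' s1' rule: exec.induct)
  case (Seq c1 s t1 s1 c2 t2 s2)
  from Seq.prems show ?case by cases (use Seq.IH in blast)
next
  case (WhileTrue e s c t1 s1 t2 s2)
  from WhileTrue.prems show ?case
    by cases (use WhileTrue.IH WhileTrue.hyps in blast)+
qed (erule exec.cases; auto)+


section \<open>Encoding of inputs and outputs\<close>

fun nat_bits :: "nat \<Rightarrow> bool list" where
  "nat_bits n = (if n = 0 then [] else odd n # nat_bits (n div 2))"

declare nat_bits.simps [simp del]

definition enc_list :: "('c \<Rightarrow> data) \<Rightarrow> 'c list \<Rightarrow> data" where
  "enc_list f xs = foldr (\<lambda>z d. Node (f z) d) xs Leaf"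

definition enc_nat :: "nat \<Rightarrow> data" where
  "enc_nat n = enc_list enc_bool (nat_bits n)"

definition enc_int :: "int \<Rightarrow> data" where
  "enc_int i = Node (enc_bool (i < 0)) (enc_nat (nat \<bar>i\<bar>))"

definition enc_rat :: "rat \<Rightarrow> data" where
  "enc_rat q = Node (enc_int (fst (quotient_of q))) (enc_int (snd (quotient_of q)))"

text \<open>
  A rational number is given by numerator and denominator in binary. An irrational
  number has no finite description; the program only sees a placeholder for it.
\<close>

definition enc_real :: "real \<Rightarrow> data" where
  "enc_real r = (if r \<in> \<rat> then enc_rat (THE q. of_rat q = r) else Leaf)"

text \<open>
  Vertices and arcs are named by natural numbers (in binary), and sets and multisets are
  listed in an arbitrary order, so that one input has several codes.
\<close>

definition spc_code :: "data \<Rightarrow> (nat, nat) pre_digraph \<Rightarrow> nat set set \<Rightarrow> (nat \<Rightarrow> real) \<Rightarrow>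
    (nat set \<Rightarrow> real) \<Rightarrow> nat multiset \<Rightarrow> nat set list \<Rightarrow> bool" where
  "spc_code d G L x y B Vs \<longleftrightarrow> (\<exists>vs es Ls bs Ps.
     distinct vs \<and> set vs = verts G \<and>
     distinct es \<and> set es = arcs G \<and>
     (\<forall>l \<in> set Ls. distinct l) \<and> distinct (map set Ls) \<and> set (map set Ls) = L \<and>
     mset bs = B \<and>
     (\<forall>l \<in> set Ps. distinct l) \<and> map set Ps = Vs \<and>
     d = enc_list id
       [enc_list enc_nat vs,
        enc_list (\<lambda>e. enc_list id
          [enc_nat e, enc_nat (tail G e), enc_nat (head G e), enc_real (x e)]) es,
        enc_list (\<lambda>l. Node (enc_list enc_nat l) (enc_real (y (set l)))) Ls,
        enc_list enc_nat bs,
        enc_list (enc_list enc_nat) Ps])"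

definition outputs :: "com \<Rightarrow> data \<Rightarrow> nat multiset \<Rightarrow> bool" where
  "outputs c d F \<longleftrightarrow> (\<exists>t es. computes c d t (enc_list enc_nat es) \<and> F = mset es)"


section \<open>Algorithms for Subtour Partition Cover\<close>

definition spc_algorithm :: "com \<Rightarrow> bool" where
  "spc_algorithm A \<longleftrightarrow> (\<forall>G L x y B Vs d. spc_input G L x y B Vs \<and> spc_code d G L x y B Vs \<longrightarrow>
     (\<exists>F. outputs A d F \<and> spc_solution G Vs F))"

definition spc_polynomial_time :: "com \<Rightarrow> bool" where
  "spc_polynomial_time A \<longleftrightarrow> (\<exists>p :: nat poly. \<forall>G L x y B Vs d.
     spc_input G L x y B Vs \<and> spc_code d G L x y B Vs \<longrightarrow>
     (\<exists>t r. computes A d t r \<and> t \<le> poly p (size d)))"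

definition spc_light :: "com \<Rightarrow> real \<Rightarrow> real \<Rightarrow> (nat, nat) pre_digraph \<Rightarrow> nat set set \<Rightarrow>
    (nat \<Rightarrow> real) \<Rightarrow> (nat set \<Rightarrow> real) \<Rightarrow> nat multiset \<Rightarrow> bool" where
  "spc_light A \<alpha> \<beta> G L x y B \<longleftrightarrow>
     (\<forall>Vs d F. spc_input G L x y B Vs \<and> spc_code d G L x y B Vs \<and> outputs A d F \<longrightarrow>
       (\<forall>T \<in> subtours_in G F. edge_verts G T \<inter> edge_verts G B = {} \<longrightarrow>
          total_weight G L y T \<le> \<alpha> * lb G L y T) \<and>
       total_weight G L y (subtours_meeting G F B) \<le> \<beta>)"

end

theory Submission
  imports Defs
begin

text \<open>
  It suffices to find an Eulerian multiset \<open>F\<close> that leaves every part \<open>P\<close> and enters every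
  vertex \<open>v\<close> with \<open>{v} \<in> L\<close> at most twice: then \<open>v\<close> contributes at most \<open>4 y\<^sub>v = 2 lb(v)\<close> to
  the weight of its subtour. Add to every part \<open>P\<close> an auxiliary vertex that may replace the end
  in \<open>P\<close> of any edge crossing the boundary of \<open>P\<close>, and look for an integral circulation
  that visits every auxiliary vertex exactly once and every \<open>v\<close> with \<open>{v} \<in> L\<close> at most once.
  Replacing the auxiliary vertex of \<open>P\<close> by a simple path inside \<open>P\<close> adds at most one visit per
  vertex. A fractional circulation of this kind is obtained from \<open>x\<close>, and splitting the
  vertices turns the problem into an uncapacitated transshipment with unit demands, where
  the fractional solution only serves to show that every source has an augmenting path.
  The algorithm therefore ignores \<open>x\<close> and \<open>y\<close>, needs no arithmetic, and works for all \<open>L\<close>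
  and \<open>B\<close>.

  The program is never written out: functions computable in polynomial time are closed under
  composition and folds with polynomially bounded values, and the algorithm is such a function.
\<close>

section \<open>Polynomial-time computable functions on trees\<close>

text \<open>Where the fractional solution comes from: every cut has value at least 2 and
  \<open>x\<close> is a circulation, so \<open>x\<close> leaves a part \<open>P\<close> at least
  once. Hence a fraction at most 1 of the flow across the boundary of \<open>P\<close> amounts to
  one unit, and this unit can be moved to the auxiliary vertex. For \<open>{v} \<in> L\<close>,
  tightness says that \<open>x\<close> visits \<open>v\<close> exactly once; whatever rerouting
  takes away from this unit can idle between the two copies of \<open>v\<close>, which turns an
  upper bound on the visits into an exact demand. Why integrality is elementary: without capacities
  the only obstruction is a set of nodes that no arc leaves and that contains more sources than
  sinks. Summing the fractional solution over such a set excludes it, so no integrality theorem for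
  flows is needed. Why the time is polynomial: supplies are single units, so there is one
  augmentation per source, whatever numbers occur in the input. An augmenting path uses each arc at
  most once in forward direction, so the flow stays small. This size bound is the one place where
  the running time depends on correctness.\<close>

lemma poly_nat_mono: "a \<le> b \<Longrightarrow> poly p a \<le> poly (p :: nat poly) b"
  by (induction p) (auto intro!: add_mono mult_mono)

definition poly_bounded :: "(nat \<Rightarrow> nat) \<Rightarrow> bool" where
  "poly_bounded h \<longleftrightarrow> (\<exists>p. \<forall>n. h n \<le> poly p n)"

lemma poly_bounded_poly: "poly_bounded (poly p)"
  unfolding poly_bounded_def by blast

lemma poly_bounded_const: "poly_bounded (\<lambda>_. c)"
  unfolding poly_bounded_def by (rule exI[of _ "[:c:]"]) simp

lemma poly_bounded_id: "poly_bounded (\<lambda>n. n)"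
  unfolding poly_bounded_def by (rule exI[of _ "[:0, 1:]"]) simp

lemma poly_bounded_add:
  assumes "poly_bounded f" "poly_bounded g"
  shows "poly_bounded (\<lambda>n. f n + g n)"
proof -
  obtain p q where "\<forall>n. f n \<le> poly p n" "\<forall>n. g n \<le> poly q n"
    using assms unfolding poly_bounded_def by blast
  then have "\<forall>n. f n + g n \<le> poly (p + q) n" by (simp add: add_mono)
  then show ?thesis unfolding poly_bounded_def by blast
qed

lemma poly_bounded_Suc: "poly_bounded f \<Longrightarrow> poly_bounded (\<lambda>n. Suc (f n))"
  using poly_bounded_add[OF poly_bounded_const[of 1]] by simp

lemma poly_bounded_mult:
  assumes "poly_bounded f" "poly_bounded g"
  shows "poly_bounded (\<lambda>n. f n * g n)"
proof -
  obtain p q where "\<forall>n. f n \<le> poly p n" "\<forall>n. g n \<le> poly q n"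
    using assms unfolding poly_bounded_def by blast
  then have "\<forall>n. f n * g n \<le> poly (p * q) n" by (simp add: mult_le_mono)
  then show ?thesis unfolding poly_bounded_def by blast
qed

lemma poly_bounded_comp:
  assumes "poly_bounded g"
  shows "poly_bounded (\<lambda>n. poly p (g n))"
proof -
  obtain q where "\<forall>n. g n \<le> poly q n"
    using assms unfolding poly_bounded_def by blast
  then have "\<forall>n. poly p (g n) \<le> poly (pcompose p q) n"
    by (simp add: poly_pcompose poly_nat_mono)
  then show ?thesis unfolding poly_bounded_def by blast
qed

lemmas poly_bounded_intros = poly_bounded_poly poly_bounded_const poly_bounded_id
  poly_bounded_add poly_bounded_Suc poly_bounded_mult poly_bounded_comp

section \<open>Time-bounded runs of programs\<close>

definition runs :: "com \<Rightarrow> nat \<Rightarrow> store \<Rightarrow> data \<Rightarrow> nat \<Rightarrow> bool" where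
  "runs c n s v b \<longleftrightarrow> (\<exists>t s'. exec c s t s' \<and> s' n = v \<and> (\<forall>m<n. s' m = s m) \<and> t \<le> b)"

lemma runs_mono: "runs c n s v b \<Longrightarrow> b \<le> b' \<Longrightarrow> runs c n s v b'"
  unfolding runs_def by fastforce

lemma runs_Assign: "cost e s \<le> b \<Longrightarrow> aval e s = v \<Longrightarrow> runs (Assign n e) n s v b"
  unfolding runs_def
  by (rule exI[of _ "cost e s"], rule exI[of _ "s(n := aval e s)"]) (auto intro: exec.Assign)

text \<open>The first program may leave its value in a higher register \<open>k\<close>. The second
  one must work from every store that agrees below \<open>k\<close>, because nothing is known about
  the scratch registers above \<open>k\<close>.\<close>

lemma runs_Seq:
  assumes "runs c1 k s v b1" "n \<le> k"
    and "\<And>s'. s' k = v \<Longrightarrow> \<forall>m<k. s' m = s m \<Longrightarrow> runs c2 n s' w b2"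
    and "b1 + b2 \<le> b"
  shows "runs (Seq c1 c2) n s w b"
proof -
  obtain t1 s1 where 1: "exec c1 s t1 s1" "s1 k = v" "\<forall>m<k. s1 m = s m" "t1 \<le> b1"
    using assms(1) unfolding runs_def by blast
  obtain t2 s2 where 2: "exec c2 s1 t2 s2" "s2 n = w" "\<forall>m<n. s2 m = s1 m" "t2 \<le> b2"
    using assms(3)[OF 1(2,3)] unfolding runs_def by blast
  have "exec (Seq c1 c2) s (t1 + t2) s2" using 1(1) 2(1) by (rule exec.Seq)
  moreover have "\<forall>m<n. s2 m = s m" using 1(3) 2(3) assms(2) by simp
  moreover have "t1 + t2 \<le> b" using 1(4) 2(4) assms(4) by linarith
  ultimately show ?thesis unfolding runs_def using 2(2) by blast
qed

lemma runs_If: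
  assumes "aval e s \<noteq> Leaf \<Longrightarrow> runs c1 n s v b'" "aval e s = Leaf \<Longrightarrow> runs c2 n s v b'"
    and "cost e s + b' \<le> b"
  shows "runs (IfNode e c1 c2) n s v b"
proof (cases "aval e s = Leaf")
  case True
  then obtain t s' where "exec c2 s t s'" "s' n = v" "\<forall>m<n. s' m = s m" "t \<le> b'"
    using assms(2) unfolding runs_def by blast
  then show ?thesis unfolding runs_def using IfFalse[OF True] assms(3)
    by (intro exI[of _ "cost e s + t"] exI[of _ s']) auto
next
  case False
  then obtain t s' where "exec c1 s t s'" "s' n = v" "\<forall>m<n. s' m = s m" "t \<le> b'"
    using assms(1) unfolding runs_def by blast
  then show ?thesis unfolding runs_def using IfTrue[OF False] assms(3)
    by (intro exI[of _ "cost e s + t"] exI[of _ s']) auto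
qed

lemma size_aval_le_cost: "size (aval e s) \<le> cost e s"
  by (induction e) auto

text \<open>Each evaluation is charged for the size of its value, so no register can grow faster
  than time passes.\<close>

lemma size_exec_le: "exec c s t s' \<Longrightarrow> size (s' m) \<le> size (s m) + t"
proof (induction arbitrary: m rule: exec.induct)
  case (Assign i e s)
  then show ?case using size_aval_le_cost[of e s] by (auto intro: trans_le_add2)
next
  case (Seq c1 s t1 s1 c2 t2 s2)
  show ?case using Seq.IH(1)[of m] Seq.IH(2)[of m] by simp
next
  case (IfTrue e s c1 t s1 c2)
  show ?case using IfTrue.IH[of m] by simp
next
  case (IfFalse e s c2 t s1 c1)
  show ?case using IfFalse.IH[of m] by simp
next
  case (WhileTrue e s c t1 s1 t2 s2)
  show ?case using WhileTrue.IH(1)[of m] WhileTrue.IH(2)[of m] by simp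
qed simp_all

lemma runs_size_le: "runs c n s v b \<Longrightarrow> size v \<le> size (s n) + b"
  unfolding runs_def using size_exec_le[of c s _ _ n] by fastforce

text \<open>Register \<open>n\<close> holds the input and the output of \<open>C n\<close>. The registers below \<open>n\<close> are
  preserved and those above are scratch space whose initial contents are arbitrary, so that
  programs compose without renaming. On inputs outside \<open>D\<close> nothing is required.\<close>

definition FP :: "data set \<Rightarrow> (data \<Rightarrow> data) \<Rightarrow> bool" where
  "FP D f \<longleftrightarrow> (\<exists>C p. \<forall>n s. s n \<in> D \<longrightarrow> runs (C n) n s (f (s n)) (poly p (size (s n))))"

lemma FPI:
  assumes "poly_bounded h"
    and "\<And>n s. s n \<in> D \<Longrightarrow> runs (C n) n s (f (s n)) (h (size (s n)))"
  shows "FP D f"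
proof -
  obtain p where p: "\<forall>n. h n \<le> poly p n" using assms(1) unfolding poly_bounded_def by blast
  have "runs (C n) n s (f (s n)) (poly p (size (s n)))" if "s n \<in> D" for n s
    using runs_mono[OF assms(2)[of s n, OF that]] p by blast
  then show ?thesis unfolding FP_def by blast
qed

text \<open>A time bound is also a bound on the size of the result, because values are paid for by
  their size. This is what makes composition polynomial.\<close>

lemma FP_size:
  assumes "FP D f"
  shows "\<exists>p. \<forall>d\<in>D. size (f d) \<le> poly p (size d)"
proof -
  obtain C p where C: "\<And>n s. s n \<in> D \<Longrightarrow> runs (C n) n s (f (s n)) (poly p (size (s n)))"
    using assms unfolding FP_def by blast
  have "size (f d) \<le> poly ([:0, 1:] + p) (size d)" if "d \<in> D" for d
    using runs_size_le[OF C[of "\<lambda>_. d" 0]] that by simp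
  then show ?thesis by blast
qed

text \<open>Works on a copy in a register \<open>k\<close> above \<open>n\<close>, so that the input
  in \<open>n\<close> survives and can be used again by the next subprogram.\<close>

lemma FP_load:
  assumes "FP D f"
  shows "\<exists>C p. \<forall>n k s. n < k \<and> s n \<in> D \<longrightarrow> runs (C n k) k s (f (s n)) (poly p (size (s n)))"
proof -
  obtain C p where C: "\<And>n s. s n \<in> D \<Longrightarrow> runs (C n) n s (f (s n)) (poly p (size (s n)))"
    using assms unfolding FP_def by blast
  have "runs (Seq (Assign k (Var n)) (C k)) k s (f (s n)) (poly ([:1, 1:] + p) (size (s n)))"
    if "n < k" "s n \<in> D" for n k s
  proof (rule runs_Seq)
    show "runs (Assign k (Var n)) k s (s n) (1 + size (s n))"
      by (rule runs_Assign) auto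
    show "runs (C k) k s' (f (s n)) (poly p (size (s n)))" if "s' k = s n" for s'
      using C[of s' k] that \<open>s n \<in> D\<close> by simp
  qed simp_all
  then show ?thesis
    by (intro exI[of _ "\<lambda>n k. Seq (Assign k (Var n)) (C k)"] exI[of _ "[:1, 1:] + p"]) simp
qed

section \<open>Closure properties of polynomial-time functions\<close>

lemma FP_cong:
  assumes "FP D f" "\<And>d. d \<in> D \<Longrightarrow> f d = g d"
  shows "FP D g"
proof -
  obtain C p where C: "\<And>n s. s n \<in> D \<Longrightarrow> runs (C n) n s (f (s n)) (poly p (size (s n)))"
    using assms(1) unfolding FP_def by blast
  have "\<forall>n s. s n \<in> D \<longrightarrow> runs (C n) n s (g (s n)) (poly p (size (s n)))"
    using C assms(2) by simp
  then show ?thesis unfolding FP_def by blast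
qed

lemma FP_id: "FP D (\<lambda>d. d)"
proof (rule FPI)
  show "runs Skip n s (s n) 1" for n s
    unfolding runs_def using exec.Skip by blast
qed (rule poly_bounded_const)

lemma FP_unary:
  assumes "poly_bounded h" "\<And>n s. aval (e n) s = f (s n)" "\<And>n s. cost (e n) s \<le> h (size (s n))"
  shows "FP D f"
  by (rule FPI[OF assms(1), where C = "\<lambda>n. Assign n (e n)"]) (auto intro: runs_Assign assms)

lemma size_left_le: "size (left d) \<le> size d" and size_right_le: "size (right d) \<le> size d"
  by (cases d; simp)+

text \<open>The time of the outer program is polynomial in the size of \<open>g d\<close>, which is
  itself polynomial in the size of \<open>d\<close>. The outer function is required on all trees, so
  that nothing has to be proved about the range of \<open>g\<close>.\<close>

lemma FP_comp:
  assumes "FP UNIV f" "FP D g"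
  shows "FP D (\<lambda>d. f (g d))"
proof -
  obtain C p where C: "\<And>n s. s n \<in> UNIV \<Longrightarrow> runs (C n) n s (f (s n)) (poly p (size (s n)))"
    using assms(1) unfolding FP_def by blast
  obtain C' p' where C': "\<And>n s. s n \<in> D \<Longrightarrow> runs (C' n) n s (g (s n)) (poly p' (size (s n)))"
    using assms(2) unfolding FP_def by blast
  obtain q where q: "\<And>d. d \<in> D \<Longrightarrow> size (g d) \<le> poly q (size d)"
    using FP_size[OF assms(2)] by blast
  show ?thesis
  proof (rule FPI[where h = "\<lambda>n. poly p' n + poly p (poly q n)"])
    fix n :: nat and s :: store assume D: "s n \<in> D"
    show "runs (Seq (C' n) (C n)) n s (f (g (s n)))
        (poly p' (size (s n)) + poly p (poly q (size (s n))))"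
    proof (rule runs_Seq[OF C'[of s n, OF D]])
      fix s' assume s': "s' n = g (s n)"
      show "runs (C n) n s' (f (g (s n))) (poly p (size (g (s n))))"
        using C[of s' n] s' by simp
    qed (auto intro: poly_nat_mono q D)
  qed (intro poly_bounded_intros)
qed

text \<open>Common pattern for tree construction and equality test: both arguments are computed in
  fresh registers from the same input, then one expression combines them. Monotonicity of
  \<open>h\<close> allows the argument sizes to be replaced by their bounds.\<close>

lemma FP_binary:
  assumes "FP D f" "FP D g" "poly_bounded h"
    and "\<And>i j s. aval (e i j) s = F (s i) (s j)"
    and "\<And>i j s. cost (e i j) s \<le> h (size (s i) + size (s j))" "mono h"
  shows "FP D (\<lambda>d. F (f d) (g d))"
proof -
  obtain C p where C:
    "\<And>n k s. n < k \<Longrightarrow> s n \<in> D \<Longrightarrow> runs (C n k) k s (f (s n)) (poly p (size (s n)))"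
    using FP_load[OF assms(1)] by blast
  obtain C' p' where C':
    "\<And>n k s. n < k \<Longrightarrow> s n \<in> D \<Longrightarrow> runs (C' n k) k s (g (s n)) (poly p' (size (s n)))"
    using FP_load[OF assms(2)] by blast
  obtain q where q: "\<And>d. d \<in> D \<Longrightarrow> size (f d) \<le> poly q (size d)"
    using FP_size[OF assms(1)] by blast
  obtain q' where q': "\<And>d. d \<in> D \<Longrightarrow> size (g d) \<le> poly q' (size d)"
    using FP_size[OF assms(2)] by blast
  obtain r where r: "\<forall>n. h n \<le> poly r n" using assms(3) unfolding poly_bounded_def by blast
  show ?thesis
  proof (rule FPI[where h = "\<lambda>n. poly p n + (poly p' n + poly r (poly q n + poly q' n))"])
    fix n :: nat and s :: store assume D: "s n \<in> D"
    let ?N = "size (s n)"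
    show "runs (Seq (C n (n+1)) (Seq (C' n (n+2)) (Assign n (e (n+1) (n+2))))) n s
      (F (f (s n)) (g (s n))) (poly p ?N + (poly p' ?N + poly r (poly q ?N + poly q' ?N)))"
    proof (rule runs_Seq[OF C[of n "n+1" s]])
      fix s1 assume s1: "s1 (n+1) = f (s n)" "\<forall>m<n+1. s1 m = s m"
      then have n1: "s1 n = s n" by simp
      show "runs (Seq (C' n (n+2)) (Assign n (e (n+1) (n+2)))) n s1
        (F (f (s n)) (g (s n))) (poly p' ?N + poly r (poly q ?N + poly q' ?N))"
      proof (rule runs_Seq[OF C'[of n "n+2" s1]])
        fix s2 assume s2: "s2 (n+2) = g (s1 n)" "\<forall>m<n+2. s2 m = s1 m"
        then have n2: "s2 (n+1) = f (s n)" "s2 (n+2) = g (s n)" using s1 n1 by simp_all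
        have "cost (e (n+1) (n+2)) s2 \<le> h (size (f (s n)) + size (g (s n)))"
          using assms(5)[of "n+1" "n+2" s2] n2 by simp
        also have "\<dots> \<le> h (poly q ?N + poly q' ?N)"
          using q[OF D] q'[OF D] by (intro monoD[OF assms(6)] add_mono)
        also have "\<dots> \<le> poly r (poly q ?N + poly q' ?N)" using r by blast
        finally show "runs (Assign n (e (n+1) (n+2))) n s2 (F (f (s n)) (g (s n)))
            (poly r (poly q ?N + poly q' ?N))"
          using n2 assms(4) by (intro runs_Assign) simp_all
      qed (use D n1 in simp_all)
    qed (use D in simp_all)
  qed (intro poly_bounded_intros)
qed

lemma FP_Node: "FP D f \<Longrightarrow> FP D g \<Longrightarrow> FP D (\<lambda>d. Node (f d) (g d))"
  by (rule FP_binary[where e = "\<lambda>i j. NodeE (Var i) (Var j)" and h = "\<lambda>n. 2 * n + 4"])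
    (auto intro!: poly_bounded_intros monoI)

lemma size_enc_bool_le: "size (enc_bool b) \<le> 1"
  by (cases b) auto

lemma FP_eq: "FP D f \<Longrightarrow> FP D g \<Longrightarrow> FP D (\<lambda>d. enc_bool (f d = g d))"
  by (rule FP_binary[where e = "\<lambda>i j. EqE (Var i) (Var j)" and h = "\<lambda>n. n + 4"])
    (use size_enc_bool_le in \<open>auto intro!: poly_bounded_intros monoI\<close>)

lemma FP_Leaf: "FP D (\<lambda>_. Leaf)"
  by (rule FP_unary[where e = "\<lambda>_. LeafE" and h = "\<lambda>_. 1"]) (auto intro: poly_bounded_intros)

lemma FP_const: "FP D (\<lambda>_. c)"
  by (induction c) (auto intro: FP_Leaf FP_Node)

lemma FP_left_UNIV: "FP UNIV left"
  by (rule FP_unary[where e = "\<lambda>n. LeftE (Var n)" and h = "\<lambda>n. 2 * n + 2"])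
    (auto intro!: poly_bounded_intros size_left_le)

lemma FP_right_UNIV: "FP UNIV right"
  by (rule FP_unary[where e = "\<lambda>n. RightE (Var n)" and h = "\<lambda>n. 2 * n + 2"])
    (auto intro!: poly_bounded_intros size_right_le)

lemmas FP_left = FP_comp[OF FP_left_UNIV] and FP_right = FP_comp[OF FP_right_UNIV]

lemma enc_bool_eq_Leaf [simp]: "enc_bool b = Leaf \<longleftrightarrow> \<not> b"
  by (cases b) auto

lemma Leaf_eq_enc_bool [simp]: "Leaf = enc_bool b \<longleftrightarrow> \<not> b"
  by (cases b) auto

lemma FP_If:
  assumes "FP D (\<lambda>d. enc_bool (P d))" "FP D f" "FP D g"
  shows "FP D (\<lambda>d. if P d then f d else g d)"
proof -
  obtain C p where C: "\<And>n k s. n < k \<Longrightarrow> s n \<in> D \<Longrightarrow>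
      runs (C n k) k s (enc_bool (P (s n))) (poly p (size (s n)))"
    using FP_load[OF assms(1)] by blast
  obtain C1 p1 where C1: "\<And>n s. s n \<in> D \<Longrightarrow> runs (C1 n) n s (f (s n)) (poly p1 (size (s n)))"
    using assms(2) unfolding FP_def by blast
  obtain C2 p2 where C2: "\<And>n s. s n \<in> D \<Longrightarrow> runs (C2 n) n s (g (s n)) (poly p2 (size (s n)))"
    using assms(3) unfolding FP_def by blast
  show ?thesis
  proof (rule FPI[where h = "\<lambda>n. poly p n + (2 + (poly p1 n + poly p2 n))"])
    fix n :: nat and s :: store assume D: "s n \<in> D"
    let ?N = "size (s n)"
    show "runs (Seq (C n (n+1)) (IfNode (Var (n+1)) (C1 n) (C2 n))) n s
      (if P (s n) then f (s n) else g (s n)) (poly p ?N + (2 + (poly p1 ?N + poly p2 ?N)))"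
    proof (rule runs_Seq[OF C[of n "n+1" s]])
      fix s1 assume s1: "s1 (n+1) = enc_bool (P (s n))" "\<forall>m<n+1. s1 m = s m"
      then have n1: "s1 n = s n" by simp
      show "runs (IfNode (Var (n+1)) (C1 n) (C2 n)) n s1
          (if P (s n) then f (s n) else g (s n)) (2 + (poly p1 ?N + poly p2 ?N))"
      proof (rule runs_If[where b' = "poly p1 ?N + poly p2 ?N"])
        show "runs (C1 n) n s1 (if P (s n) then f (s n) else g (s n)) (poly p1 ?N + poly p2 ?N)"
          if "aval (Var (n+1)) s1 \<noteq> Leaf"
        proof -
          have "P (s n)" using that s1(1) by simp
          then show ?thesis using runs_mono[OF C1[of s1 n], of "poly p1 ?N + poly p2 ?N"] D n1 by simp
        qed
        show "runs (C2 n) n s1 (if P (s n) then f (s n) else g (s n)) (poly p1 ?N + poly p2 ?N)"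
          if "aval (Var (n+1)) s1 = Leaf"
        proof -
          have "\<not> P (s n)" using that s1(1) by simp
          then show ?thesis using runs_mono[OF C2[of s1 n], of "poly p1 ?N + poly p2 ?N"] D n1 by simp
        qed
        show "cost (Var (n+1)) s1 + (poly p1 ?N + poly p2 ?N) \<le> 2 + (poly p1 ?N + poly p2 ?N)"
          using size_enc_bool_le[of "P (s n)"] by (simp only: cost.simps s1(1))
      qed
    qed (use D in simp_all)
  qed (intro poly_bounded_intros)
qed

subsection \<open>Trees as lists\<close>

fun to_list :: "data \<Rightarrow> data list" where
  "to_list Leaf = []"
| "to_list (Node a b) = a # to_list b"

definition of_list :: "data list \<Rightarrow> data" where
  "of_list xs = foldr Node xs Leaf"

lemma of_list_simps [simp]: "of_list [] = Leaf" "of_list (x # xs) = Node x (of_list xs)"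
  by (simp_all add: of_list_def)

lemma to_list_of_list [simp]: "to_list (of_list xs) = xs"
  by (induction xs) auto

lemma of_list_to_list [simp]: "of_list (to_list d) = d"
  by (induction d) auto

lemma enc_list_of_list: "enc_list f xs = of_list (map f xs)"
  by (induction xs) (auto simp: enc_list_def)

lemma length_to_list_le: "length (to_list d) \<le> size d"
  by (induction d) auto

lemma size_mem_to_list: "h \<in> set (to_list d) \<Longrightarrow> size h < size d"
  by (induction d) auto

text \<open>In a fold the body gets the whole input \<open>d\<close> in addition to the list element and the
  accumulator, so that no environments have to be passed explicitly.\<close>

lemma FP_fold:
  assumes step: "FP UNIV (\<lambda>z. step (left z) (left (right z)) (right (right z)))"
    and l: "FP D l" and a: "FP D a"
    and bound: "\<And>d xs ys. d \<in> D \<Longrightarrow> to_list (l d) = xs @ ys \<Longrightarrow>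
      size (fold (step d) xs (a d)) \<le> poly b (size d)"
  shows "FP D (\<lambda>d. fold (step d) (to_list (l d)) (a d))"
proof -
  obtain C p where C: "\<And>n s. s n \<in> UNIV \<Longrightarrow> runs (C n) n s
      (step (left (s n)) (left (right (s n))) (right (right (s n)))) (poly p (size (s n)))"
    using step unfolding FP_def by blast
  obtain C1 p1 where C1:
    "\<And>n k s. n < k \<Longrightarrow> s n \<in> D \<Longrightarrow> runs (C1 n k) k s (l (s n)) (poly p1 (size (s n)))"
    using FP_load[OF l] by blast
  obtain C2 p2 where C2:
    "\<And>n k s. n < k \<Longrightarrow> s n \<in> D \<Longrightarrow> runs (C2 n k) k s (a (s n)) (poly p2 (size (s n)))"
    using FP_load[OF a] by blast
  obtain q where q: "\<And>d. d \<in> D \<Longrightarrow> size (l d) \<le> poly q (size d)" using FP_size[OF l] by blast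
  \<comment> \<open>Bounds the triple of input, list element and accumulator handed to the body;
    \<open>K\<close> below bounds the time of one iteration including its test.\<close>
  define Z where "Z N = N + poly q N + poly b N + 2" for N
  define K where "K N = (1 + poly q N) + (10 * Z N + 10 + poly p (Z N) + (1 + poly b N)
     + 2 * (1 + poly q N))" for N
  define body where "body n =
     Seq (Assign (n+3) (NodeE (Var n) (NodeE (LeftE (Var (n+1))) (Var (n+2)))))
      (Seq (C (n+3)) (Seq (Assign (n+2) (Var (n+3))) (Assign (n+1) (RightE (Var (n+1))))))" for n
  define loop where "loop n = WhileNode (Var (n+1)) (body n)" for n
  \<comment> \<open>Loop invariant: register \<open>n\<close> keeps the input, \<open>n+1\<close>
    the unread rest \<open>ys\<close>, \<open>n+2\<close> the result for the consumed prefix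
    \<open>xs\<close>. Register \<open>n+3\<close> is the argument of the body.\<close>
  have loop: "\<exists>t s'. exec (loop n) s t s' \<and> s' (n+2) = fold (step (s n)) (to_list (l (s n))) (a (s n))
      \<and> (\<forall>m<n+1. s' m = s m) \<and> t \<le> length ys * K (size (s n)) + 1"
    if D: "s n \<in> D" and "to_list (l (s n)) = xs @ ys" "s (n+1) = of_list ys"
      "s (n+2) = fold (step (s n)) xs (a (s n))" for n s xs ys
    using that
  proof (induction ys arbitrary: xs s)
    case Nil
    have "exec (loop n) s 1 s" unfolding loop_def
      using WhileFalse[of "Var (n+1)" s "body n"] Nil by simp
    then show ?case using Nil by auto
  next
    case (Cons y ys)
    let ?d = "s n" let ?N = "size ?d" let ?a = "fold (step ?d) xs (a ?d)"
    let ?z = "Node ?d (Node y ?a)"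
    have sz: "size (Node y (of_list ys)) \<le> poly q ?N"
    proof -
      have "size (of_list ys') \<le> size (of_list (xs' @ ys'))" for xs' ys'
        by (induction xs') auto
      then have "size (of_list (y # ys)) \<le> size (l ?d)"
        by (metis Cons.prems(2) of_list_to_list)
      then show ?thesis using q[OF Cons.prems(1)] by simp
    qed
    have sa: "size ?a \<le> poly b ?N"
      using bound[of ?d xs "y # ys"] Cons.prems by simp
    have sa': "size (step ?d y ?a) \<le> poly b ?N"
      using bound[of ?d "xs @ [y]" ys] Cons.prems by simp
    have sz': "size ?z \<le> Z ?N" using sz sa unfolding Z_def by simp
    \<comment> \<open>\<open>runs\<close> at \<open>n+1\<close> says nothing about the accumulator
      in \<open>n+2\<close>. The second conjunct supplies its value for every run, which is
      justified by determinism of execution.\<close>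
    have B: "runs (body n) (n+1) s (of_list ys) (10 * Z ?N + 10 + poly p (Z ?N) + (1 + poly b ?N)
        + 2 * (1 + poly q ?N)) \<and>
      (\<forall>t s'. exec (body n) s t s' \<longrightarrow> s' (n+2) = step ?d y ?a)"
    proof -
      define s1 where "s1 = s(n+3 := ?z)"
      have e1: "exec (Assign (n+3) (NodeE (Var n) (NodeE (LeftE (Var (n+1))) (Var (n+2))))) s
          (cost (NodeE (Var n) (NodeE (LeftE (Var (n+1))) (Var (n+2)))) s) s1"
        using exec.Assign[of "n+3" "NodeE (Var n) (NodeE (LeftE (Var (n+1))) (Var (n+2)))" s] Cons.prems
        by (simp add: s1_def)
      have k1: "cost (NodeE (Var n) (NodeE (LeftE (Var (n+1))) (Var (n+2)))) s \<le> 10 * Z ?N + 10"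
        using sz sa Cons.prems unfolding Z_def by simp
      have "runs (C (n+3)) (n+3) s1 (step ?d y ?a) (poly p (size ?z))"
        using C[of s1 "n+3"] by (simp add: s1_def)
      then obtain t2 s2 where e2: "exec (C (n+3)) s1 t2 s2" "s2 (n+3) = step ?d y ?a"
        "\<forall>m<n+3. s2 m = s1 m" "t2 \<le> poly p (size ?z)" unfolding runs_def by blast
      have k2: "t2 \<le> poly p (Z ?N)" using e2(4) poly_nat_mono[OF sz', of p] by simp
      define s3 where "s3 = s2(n+2 := step ?d y ?a)"
      have e3: "exec (Assign (n+2) (Var (n+3))) s2 (1 + size (step ?d y ?a)) s3"
        using exec.Assign[of "n+2" "Var (n+3)" s2] e2(2) by (simp add: s3_def)
      have s3n: "s3 (n+1) = Node y (of_list ys)" using e2(3) Cons.prems(3) by (simp add: s3_def s1_def)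
      define s4 where "s4 = s3(n+1 := of_list ys)"
      have e4: "exec (Assign (n+1) (RightE (Var (n+1)))) s3 (1 + size (Node y (of_list ys)) + 1 + size (of_list ys)) s4"
        using exec.Assign[of "n+1" "RightE (Var (n+1))" s3] s3n by (simp add: s4_def)
      have e: "exec (body n) s (cost (NodeE (Var n) (NodeE (LeftE (Var (n+1))) (Var (n+2)))) s
          + (t2 + (1 + size (step ?d y ?a) + (1 + size (Node y (of_list ys)) + 1 + size (of_list ys))))) s4"
        unfolding body_def by (rule exec.Seq[OF e1 exec.Seq[OF e2(1) exec.Seq[OF e3 e4]]])
      have s4: "s4 (n+2) = step ?d y ?a" "\<forall>m<n+1. s4 m = s m" "s4 (n+1) = of_list ys"
        using e2(3) by (auto simp: s4_def s3_def s1_def)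
      have "cost (NodeE (Var n) (NodeE (LeftE (Var (n+1))) (Var (n+2)))) s
          + (t2 + (1 + size (step ?d y ?a) + (1 + size (Node y (of_list ys)) + 1 + size (of_list ys))))
         \<le> 10 * Z ?N + 10 + poly p (Z ?N) + (1 + poly b ?N) + 2 * (1 + poly q ?N)"
        using k1 k2 sa' sz by simp
      then show ?thesis unfolding runs_def using e s4 exec_determ[OF e] by blast
    qed
    then obtain t1 s1 where 1: "exec (body n) s t1 s1" "s1 (n+1) = of_list ys" "\<forall>m<n+1. s1 m = s m"
      "t1 \<le> 10 * Z ?N + 10 + poly p (Z ?N) + (1 + poly b ?N) + 2 * (1 + poly q ?N)"
      "s1 (n+2) = step ?d y ?a"
      unfolding runs_def by blast
    have d1: "s1 n = ?d" using 1(3) by simp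
    obtain t2 s2 where 2: "exec (loop n) s1 t2 s2"
      "s2 (n+2) = fold (step ?d) (to_list (l ?d)) (a ?d)" "\<forall>m<n+1. s2 m = s1 m"
      "t2 \<le> length ys * K ?N + 1"
      using Cons.IH[of s1 "xs @ [y]"] Cons.prems 1 d1 by auto
    have "exec (loop n) s (cost (Var (n+1)) s + t1 + t2) s2"
      using WhileTrue[of "Var (n+1)" s "body n" t1 s1 t2 s2] 1(1) 2(1) Cons.prems(3)
      unfolding loop_def by simp
    moreover have "cost (Var (n+1)) s + t1 + t2 \<le> length (y # ys) * K ?N + 1"
      using 1(4) 2(4) sz Cons.prems(3) unfolding K_def by simp
    ultimately show ?case using 1(3) 2(2,3) by auto
  qed
  show ?thesis
  proof (rule FPI[where h = "\<lambda>N. poly p1 N + (poly p2 N + ((poly q N * K N + 1) + (1 + poly b N)))"])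
    fix n :: nat and s :: store assume D: "s n \<in> D"
    let ?d = "s n" let ?N = "size ?d" let ?r = "fold (step ?d) (to_list (l ?d)) (a ?d)"
    show "runs (Seq (C1 n (n+1)) (Seq (C2 n (n+2)) (Seq (loop n) (Assign n (Var (n+2)))))) n s
      ?r (poly p1 ?N + (poly p2 ?N + ((poly q ?N * K ?N + 1) + (1 + poly b ?N))))"
    proof (rule runs_Seq[OF C1[of n "n+1" s]])
      fix s1 assume s1: "s1 (n+1) = l (s n)" "\<forall>m<n+1. s1 m = s m"
      then have n1: "s1 n = s n" by simp
      show "runs (Seq (C2 n (n+2)) (Seq (loop n) (Assign n (Var (n+2))))) n s1 ?r
          (poly p2 ?N + ((poly q ?N * K ?N + 1) + (1 + poly b ?N)))"
      proof (rule runs_Seq[OF C2[of n "n+2" s1]])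
        fix s2 assume s2: "s2 (n+2) = a (s1 n)" "\<forall>m<n+2. s2 m = s1 m"
        have n2: "s2 n = s n" "s2 (n+1) = l (s n)" "s2 (n+2) = a (s n)"
          "\<forall>m<n. s2 m = s m" using s1 s2 n1 by simp_all
        obtain t3 s3 where 3: "exec (loop n) s2 t3 s3" "s3 (n+2) = ?r" "\<forall>m<n+1. s3 m = s2 m"
          "t3 \<le> length (to_list (l ?d)) * K ?N + 1"
          using loop[of s2 n "[]" "to_list (l ?d)"] n2 D by auto
        have "length (to_list (l ?d)) \<le> poly q ?N"
          using length_to_list_le[of "l ?d"] q[OF D] by linarith
        then have "length (to_list (l ?d)) * K ?N \<le> poly q ?N * K ?N" by (rule mult_le_mono1)
        then have t3: "t3 \<le> poly q ?N * K ?N + 1" using 3(4) by linarith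
        have sr: "size ?r \<le> poly b ?N" using bound[OF D, of "to_list (l ?d)" "[]"] by simp
        have "exec (Assign n (Var (n+2))) s3 (1 + size ?r) (s3(n := ?r))"
          using exec.Assign[of n "Var (n+2)" s3] 3(2) by simp
        from exec.Seq[OF 3(1) this] show "runs (Seq (loop n) (Assign n (Var (n+2)))) n s2 ?r
            ((poly q ?N * K ?N + 1) + (1 + poly b ?N))"
          unfolding runs_def
        proof (intro exI conjI)
          show "\<forall>m<n. (s3(n := ?r)) m = s2 m" using 3(3) by simp
          show "t3 + (1 + size ?r) \<le> (poly q ?N * K ?N + 1) + (1 + poly b ?N)"
            using t3 sr by linarith
        qed (assumption, simp)
      qed (use D n1 in simp_all)
    qed (use D in simp_all)
  qed (unfold K_def Z_def, intro poly_bounded_intros)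
qed

text \<open>If a step adds an amount that depends only on the input and the element, and not on the
  accumulator, then the total growth is at most the number of steps times that amount. Iterated
  multiplicative growth, which could be exponential, is thereby ruled out.\<close>

lemma FP_fold_additive:
  assumes step: "FP UNIV (\<lambda>z. step (left z) (left (right z)) (right (right z)))"
    and l: "FP D l" and a: "FP D a"
    and grow: "\<And>d h acc. size (step d h acc) \<le> size acc + poly b (size d + size h)"
  shows "FP D (\<lambda>d. fold (step d) (to_list (l d)) (a d))"
proof -
  obtain q where q: "\<And>d. d \<in> D \<Longrightarrow> size (l d) \<le> poly q (size d)" using FP_size[OF l] by blast
  obtain r where r: "\<And>d. d \<in> D \<Longrightarrow> size (a d) \<le> poly r (size d)" using FP_size[OF a] by blast
  have "poly_bounded (\<lambda>N. poly r N + poly q N * poly b (N + poly q N))"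
    by (intro poly_bounded_intros)
  then obtain c where c: "\<And>N. poly r N + poly q N * poly b (N + poly q N) \<le> poly c N"
    unfolding poly_bounded_def by blast
  show ?thesis
  proof (rule FP_fold[OF step l a, where b = c])
    fix d xs ys assume d: "d \<in> D" and xs: "to_list (l d) = xs @ ys"
    have "size (fold (step d) zs e) \<le> size e + length zs * poly b (size d + size (l d))"
      if "set zs \<subseteq> set (to_list (l d))" for zs e
      using that
    proof (induction zs arbitrary: e)
      case (Cons z zs)
      have "size (step d z e) \<le> size e + poly b (size d + size z)" by (rule grow)
      also have "\<dots> \<le> size e + poly b (size d + size (l d))"
        using Cons.prems size_mem_to_list[of z "l d"] by (auto intro!: poly_nat_mono)
      finally show ?case using Cons.IH[of "step d z e"] Cons.prems by simp
    qed simp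
    from this[of xs "a d"] have
      "size (fold (step d) xs (a d)) \<le> size (a d) + length xs * poly b (size d + size (l d))"
      using xs by simp
    also have "\<dots> \<le> poly r (size d) + poly q (size d) * poly b (size d + poly q (size d))"
    proof (intro add_mono mult_le_mono poly_nat_mono order_refl r q d)
      have "length xs \<le> length (to_list (l d))" using xs by simp
      then show "length xs \<le> poly q (size d)" using length_to_list_le[of "l d"] q[OF d] by linarith
    qed
    finally show "size (fold (step d) xs (a d)) \<le> poly c (size d)" using c le_trans by blast
  qed
qed

subsection \<open>List operations\<close>

lemma size_of_list_append [simp]: "size (of_list (xs @ ys)) = size (of_list xs) + size (of_list ys)"
  by (induction xs) auto

lemma size_of_list_rev [simp]: "size (of_list (rev xs)) = size (of_list xs)"
  by (induction xs) auto

text \<open>Pushing the elements one by one onto the second list reverses the first. Reversal and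
  concatenation are both special uses of this fold.\<close>

lemma FP_revappend:
  assumes "FP D f" "FP D g"
  shows "FP D (\<lambda>d. of_list (rev (to_list (f d)) @ to_list (g d)))"
proof -
  have "FP D (\<lambda>d. fold (\<lambda>h acc. Node h acc) (to_list (f d)) (g d))"
    by (rule FP_fold_additive[where step = "\<lambda>_ h acc. Node h acc" and b = "[:1, 1:]", OF _ assms])
      (auto intro!: FP_Node FP_left FP_right FP_id)
  moreover have "fold (\<lambda>h acc. Node h acc) xs a = of_list (rev xs @ to_list a)" for xs a
    by (induction xs arbitrary: a) auto
  ultimately show ?thesis by simp
qed

lemma FP_rev: "FP D f \<Longrightarrow> FP D (\<lambda>d. of_list (rev (to_list (f d))))"
  using FP_revappend[OF _ FP_Leaf] by simp

lemma FP_append: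
  assumes "FP D (\<lambda>d. of_list (f d))" "FP D (\<lambda>d. of_list (g d))"
  shows "FP D (\<lambda>d. of_list (f d @ g d))"
  using FP_revappend[OF FP_rev[OF assms(1)] assms(2)] by simp

lemma FP_concat_map:
  assumes g: "FP UNIV (\<lambda>z. of_list (g (left z) (right z)))" and l: "FP D (\<lambda>d. of_list (l d))"
  shows "FP D (\<lambda>d. of_list (concat (map (g d) (l d))))"
proof -
  let ?step = "\<lambda>d h a. of_list (rev (g d h) @ to_list a)"
  have "FP UNIV (\<lambda>z. of_list (g (left (Node (left z) (left (right z))))
      (right (Node (left z) (left (right z))))))"
    by (rule FP_comp[OF g]) (intro FP_Node FP_left FP_right FP_id)
  then have g': "FP UNIV (\<lambda>z. of_list (g (left z) (left (right z))))" by simp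
  obtain p where p: "\<And>z. size (of_list (g (left z) (right z))) \<le> poly p (size z)"
    using FP_size[OF g] by blast
  have "FP D (\<lambda>d. fold (?step d) (to_list (of_list (l d))) Leaf)"
  \<comment> \<open>\<open>g\<close> runs on the pair \<open>Node d h\<close>, which is one larger
    than \<open>d\<close> and \<open>h\<close> together.\<close>
  proof (rule FP_fold_additive[where b = "pcompose p [:1, 1:]", OF _ l FP_Leaf])
    show "FP UNIV (\<lambda>z. of_list (rev (g (left z) (left (right z))) @ to_list (right (right z))))"
      using FP_revappend[OF g' FP_right[OF FP_right[OF FP_id]]] by simp
    show "size (of_list (rev (g d h) @ to_list acc))
        \<le> size acc + poly (pcompose p [:1, 1:]) (size d + size h)" for d h acc
      using p[of "Node d h"] by (simp add: poly_pcompose)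
  qed
  moreover have "fold (?step d) xs a = of_list (rev (concat (map (g d) xs)) @ to_list a)" for d xs a
    by (induction xs arbitrary: a) auto
  ultimately have "FP D (\<lambda>d. of_list (rev (concat (map (g d) (l d)))))" by simp
  from FP_rev[OF this] show ?thesis by simp
qed

lemma FP_map:
  assumes "FP UNIV (\<lambda>z. g (left z) (right z))" "FP D (\<lambda>d. of_list (l d))"
  shows "FP D (\<lambda>d. of_list (map (g d) (l d)))"
proof -
  have "FP D (\<lambda>d. of_list (concat (map (\<lambda>h. [g d h]) (l d))))"
    by (rule FP_concat_map[OF _ assms(2)]) (auto intro: FP_Node FP_Leaf assms(1))
  moreover have "concat (map (\<lambda>h. [f h]) xs) = map f xs" for f :: "data \<Rightarrow> data" and xs
    by (induction xs) auto
  ultimately show ?thesis by simp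
qed

lemma FP_filter:
  assumes "FP UNIV (\<lambda>z. enc_bool (P (left z) (right z)))" "FP D (\<lambda>d. of_list (l d))"
  shows "FP D (\<lambda>d. of_list (filter (P d) (l d)))"
proof -
  have "FP D (\<lambda>d. of_list (concat (map (\<lambda>h. if P d h then [h] else []) (l d))))"
  proof (rule FP_concat_map[OF _ assms(2)])
    have "FP UNIV (\<lambda>z. if P (left z) (right z) then Node (right z) Leaf else Leaf)"
      by (intro FP_If assms(1) FP_Node FP_Leaf FP_right FP_id)
    then show "FP UNIV (\<lambda>z. of_list (if P (left z) (right z) then [right z] else []))"
      by (rule FP_cong) auto
  qed
  moreover have "concat (map (\<lambda>h. if Q h then [h] else []) xs) = filter Q xs"
    for Q :: "data \<Rightarrow> bool" and xs by (induction xs) auto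
  ultimately show ?thesis by simp
qed

lemma FP_list_If:
  assumes "FP D (\<lambda>d. enc_bool (P d))" "FP D (\<lambda>d. of_list (f d))" "FP D (\<lambda>d. of_list (g d))"
  shows "FP D (\<lambda>d. of_list (if P d then f d else g d))"
  using FP_If[OF assms] by (rule FP_cong) auto

lemma FP_list_Cons:
  assumes "FP D f" "FP D (\<lambda>d. of_list (g d))"
  shows "FP D (\<lambda>d. of_list (f d # g d))"
  using FP_Node[OF assms] by simp

lemma FP_list_Nil: "FP D (\<lambda>d. of_list [])"
  using FP_Leaf by simp

lemma FP_list: "FP D f \<Longrightarrow> FP D (\<lambda>d. of_list (to_list (f d)))"
  by simp

section \<open>Boolean tests and bounded search\<close>

lemma FP_True: "FP D (\<lambda>_. enc_bool True)"
  by (rule FP_const)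

lemma FP_not:
  assumes "FP D (\<lambda>d. enc_bool (P d))"
  shows "FP D (\<lambda>d. enc_bool (\<not> P d))"
  using FP_If[OF assms FP_const[of _ "enc_bool False"] FP_True] by (rule FP_cong) simp

lemma FP_conj:
  assumes "FP D (\<lambda>d. enc_bool (P d))" "FP D (\<lambda>d. enc_bool (Q d))"
  shows "FP D (\<lambda>d. enc_bool (P d \<and> Q d))"
  using FP_If[OF assms FP_const[of _ "enc_bool False"]] by (rule FP_cong) simp

lemma FP_disj:
  assumes "FP D (\<lambda>d. enc_bool (P d))" "FP D (\<lambda>d. enc_bool (Q d))"
  shows "FP D (\<lambda>d. enc_bool (P d \<or> Q d))"
  using FP_If[OF assms(1) FP_True assms(2)] by (rule FP_cong) simp

text \<open>Converts from pairs of input and element to the triples of a fold, where the accumulator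
  comes last.\<close>

lemma FP_reindex:
  assumes "FP UNIV (\<lambda>z. f (left z) (right z))"
  shows "FP UNIV (\<lambda>z. f (left z) (left (right z)))"
  using FP_comp[OF assms FP_Node[OF FP_left[OF FP_id] FP_left[OF FP_right[OF FP_id]]]] by simp

lemma FP_Bex:
  assumes "FP UNIV (\<lambda>z. enc_bool (P (left z) (right z)))" "FP D (\<lambda>d. of_list (l d))"
  shows "FP D (\<lambda>d. enc_bool (\<exists>h\<in>set (l d). P d h))"
proof -
  let ?step = "\<lambda>d h a. if P d h then enc_bool True else a"
  have "FP D (\<lambda>d. fold (?step d) (to_list (of_list (l d))) (enc_bool False))"
    by (rule FP_fold_additive[where b = "[:1:]", OF _ assms(2) FP_const])
      (auto intro!: FP_If FP_const FP_reindex[where f = "\<lambda>d h. enc_bool (P d h)"] assms(1) FP_right FP_id)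
  moreover have "fold (?step d) xs a = (if \<exists>h\<in>set xs. P d h then enc_bool True else a)" for d xs a
    by (induction xs arbitrary: a) auto
  then have "fold (?step d) (to_list (of_list (l d))) (enc_bool False) = enc_bool (\<exists>h\<in>set (l d). P d h)"
    for d by simp
  ultimately show ?thesis by (rule FP_cong)
qed

definition pick :: "(data \<Rightarrow> bool) \<Rightarrow> data list \<Rightarrow> data" where
  "pick P xs = fold (\<lambda>h a. if P h then h else a) xs Leaf"

lemma pick: "\<exists>h\<in>set xs. P h \<Longrightarrow> pick P xs \<in> set xs \<and> P (pick P xs)"
proof -
  have "fold (\<lambda>h a. if P h then h else a) xs a = a \<and> (\<forall>h\<in>set xs. \<not> P h) \<or>
    fold (\<lambda>h a. if P h then h else a) xs a \<in> set xs \<and> P (fold (\<lambda>h a. if P h then h else a) xs a)"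
    for a
  proof (induction xs arbitrary: a)
    case (Cons x xs)
    show ?case using Cons[of x] Cons[of a] by (cases "P x") auto
  qed simp
  then show "\<exists>h\<in>set xs. P h \<Longrightarrow> pick P xs \<in> set xs \<and> P (pick P xs)"
    unfolding pick_def by blast
qed

lemma FP_pick:
  assumes "FP UNIV (\<lambda>z. enc_bool (P (left z) (right z)))" "FP D (\<lambda>d. of_list (l d))"
  shows "FP D (\<lambda>d. pick (P d) (l d))"
proof -
  have "FP D (\<lambda>d. fold (\<lambda>h a. if P d h then h else a) (to_list (of_list (l d))) Leaf)"
    by (rule FP_fold_additive[where b = "[:0, 1:]" and step = "\<lambda>d h a. if P d h then h else a",
          OF _ assms(2) FP_Leaf])
      (auto intro!: FP_If FP_reindex[where f = "\<lambda>d h. enc_bool (P d h)"] assms(1) FP_left FP_right FP_id)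
  then show ?thesis unfolding pick_def by simp
qed

lemmas FP_intros = FP_Node FP_eq FP_left FP_right FP_If FP_not FP_conj FP_disj FP_Bex FP_pick
  FP_append FP_concat_map FP_map FP_filter FP_list_If FP_list_Cons FP_list_Nil FP_list FP_const FP_id

text \<open>Curried functions are treated through nested pairs: the definition is analysed once on
  projections, and arbitrary arguments are substituted by composition.\<close>

lemma FP_fun2:
  assumes "FP UNIV (\<lambda>z. f (left z) (right z))" "FP D a" "FP D b"
  shows "FP D (\<lambda>d. f (a d) (b d))"
  using FP_comp[OF assms(1) FP_Node[OF assms(2,3)]] by simp

lemma FP_fun3:
  assumes "FP UNIV (\<lambda>z. f (left z) (left (right z)) (right (right z)))" "FP D a" "FP D b" "FP D c"
  shows "FP D (\<lambda>d. f (a d) (b d) (c d))"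
  using FP_comp[OF assms(1) FP_Node[OF assms(2) FP_Node[OF assms(3,4)]]] by simp

lemma FP_fun4:
  assumes "FP UNIV (\<lambda>z. f (left z) (left (right z)) (left (right (right z))) (right (right (right z))))"
    "FP D a" "FP D b" "FP D c" "FP D e"
  shows "FP D (\<lambda>d. f (a d) (b d) (c d) (e d))"
  using FP_comp[OF assms(1) FP_Node[OF assms(2) FP_Node[OF assms(3) FP_Node[OF assms(4,5)]]]] by simp

section \<open>The algorithm\<close>

subsection \<open>Graph search\<close>

abbreviation (input) mk_arc :: "data \<Rightarrow> data \<Rightarrow> data \<Rightarrow> data" where
  "mk_arc t h l \<equiv> Node t (Node h l)"

abbreviation (input) atail :: "data \<Rightarrow> data" where "atail a \<equiv> left a"
abbreviation (input) ahead :: "data \<Rightarrow> data" where "ahead a \<equiv> left (right a)"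
abbreviation (input) alabel :: "data \<Rightarrow> data" where "alabel a \<equiv> right (right a)"

text \<open>\<open>R\<close> lists the arcs of an arborescence rooted at \<open>s\<close>, the most recent one first.\<close>

definition reached :: "data \<Rightarrow> data \<Rightarrow> data \<Rightarrow> bool" where
  "reached s R n \<longleftrightarrow> n = s \<or> (\<exists>r\<in>set (to_list R). ahead r = n)"

definition grow :: "data \<Rightarrow> data \<Rightarrow> data \<Rightarrow> data" where
  "grow s a R = (if reached s R (atail a) \<and> \<not> reached s R (ahead a) then Node a R else R)"

definition sweep :: "data \<Rightarrow> data \<Rightarrow> data \<Rightarrow> data" where
  "sweep A s R = fold (grow s) (to_list A) R"

text \<open>The outer list is only a clock. A sweep that does not certify closure adds an arc, and
  no more arcs can be added than \<open>A\<close> contains, so this many sweeps suffice.\<close>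

definition search :: "data \<Rightarrow> data \<Rightarrow> data" where
  "search A s = fold (\<lambda>_. sweep A s) (to_list A) Leaf"

text \<open>State: the current node and the path collected from it. The arc into the tail of a tree
  arc is older, hence later in the list, so one pass follows all parents back to the root.\<close>

definition trace :: "data \<Rightarrow> data \<Rightarrow> data" where
  "trace a st = (if ahead a = left st then Node (atail a) (Node a (right st)) else st)"

definition path_to :: "data \<Rightarrow> data \<Rightarrow> data" where
  "path_to R t = right (fold trace (to_list R) (Node t Leaf))"

lemma FP_reached:
  "FP D s \<Longrightarrow> FP D R \<Longrightarrow> FP D n \<Longrightarrow> FP D (\<lambda>d. enc_bool (reached (s d) (R d) (n d)))"
  by (rule FP_fun3[where f = "\<lambda>s R n. enc_bool (reached s R n)"]) (unfold reached_def, intro FP_intros)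

lemma size_sweep: "size (sweep A s R) \<le> size R + size A"
proof -
  have "size (fold (grow s) xs R) \<le> size R + size (of_list xs)" for xs
  proof (induction xs arbitrary: R)
    case (Cons a xs)
    have "size (grow s a R) \<le> size R + size a + 1" by (simp add: grow_def)
    then show ?case using Cons[of "grow s a R"] by simp
  qed simp
  from this[of "to_list A"] show ?thesis by (simp add: sweep_def)
qed

lemma FP_sweep:
  assumes "FP D A" "FP D s" "FP D R"
  shows "FP D (\<lambda>d. sweep (A d) (s d) (R d))"
proof -
  have "FP UNIV (\<lambda>d. fold (grow (left (right d))) (to_list (left d)) (right (right d)))"
    by (rule FP_fold_additive[where b = "[:1, 1:]" and step = "\<lambda>d. grow (left (right d))"])
      (auto simp: grow_def intro!: FP_intros FP_reached)
  from FP_fun3[OF this assms] show ?thesis unfolding sweep_def .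
qed

lemma FP_search:
  assumes "FP D A" "FP D s"
  shows "FP D (\<lambda>d. search (A d) (s d))"
proof -
  have "FP UNIV (\<lambda>d. fold (\<lambda>_. sweep (left d) (right d)) (to_list (left d)) Leaf)"
  proof (rule FP_fold_additive[where b = "[:0, 1:]" and step = "\<lambda>d _. sweep (left d) (right d)"])
    show "size (sweep (left d) (right d) acc) \<le> size acc + poly [:0, 1:] (size d + size h)" for d h acc
      using size_sweep[of "left d" "right d" acc] size_left_le[of d] by simp
  qed (intro FP_intros FP_sweep)+
  from FP_fun2[where f = "\<lambda>A s. fold (\<lambda>_. sweep A s) (to_list A) Leaf", OF this assms]
  show ?thesis unfolding search_def .
qed

lemma FP_path_to:
  assumes "FP D R" "FP D t"
  shows "FP D (\<lambda>d. path_to (R d) (t d))"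
proof -
  have "FP UNIV (\<lambda>d. fold trace (to_list (left d)) (Node (right d) Leaf))"
  proof (rule FP_fold_additive[where b = "[:2, 2:]" and step = "\<lambda>_. trace"])
    show "size (trace h acc) \<le> size acc + poly [:2, 2:] (size d + size h)" for d h acc :: data
      using size_left_le[of h] size_right_le[of acc] by (auto simp: trace_def)
  qed (unfold trace_def, (intro FP_intros)+)
  from FP_fun2[where f = "\<lambda>R t. fold trace (to_list R) (Node t Leaf)", OF this assms]
  show ?thesis unfolding path_to_def by (rule FP_right)
qed

subsection \<open>Transshipment by augmenting paths\<close>

text \<open>The label of an arc of the residual network records whether it is a forward or
  a backward arc, and its original arc.\<close>

definition residual :: "data \<Rightarrow> data \<Rightarrow> data" where
  "residual A M = of_list
     (map (\<lambda>a. mk_arc (atail a) (ahead a) (Node (enc_bool False) a)) (to_list A) @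
      map (\<lambda>a. mk_arc (ahead a) (atail a) (Node (enc_bool True) a)) (to_list M))"

text \<open>The left component records whether a copy of \<open>a\<close> has already been removed,
  so that further copies stay. The order of the list is reversed, which is harmless since only the
  multiset of arcs matters.\<close>

definition drop_step :: "data \<Rightarrow> data \<Rightarrow> data \<Rightarrow> data" where
  "drop_step a h st = (if left st = Leaf \<and> h = a then Node (enc_bool True) (right st)
     else Node (left st) (Node h (right st)))"

definition drop_one :: "data \<Rightarrow> data \<Rightarrow> data" where
  "drop_one a M = right (fold (drop_step a) (to_list M) (Node (enc_bool False) Leaf))"

definition push_arc :: "data \<Rightarrow> data \<Rightarrow> data" where
  "push_arc r M = (if left (alabel r) = enc_bool False then Node (right (alabel r)) M
     else drop_one (right (alabel r)) M)"

definition push :: "data \<Rightarrow> data \<Rightarrow> data" where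
  "push p M = fold push_arc (to_list p) M"

definition served :: "data \<Rightarrow> data \<Rightarrow> bool" where
  "served M t \<longleftrightarrow> (\<exists>a\<in>set (to_list M). ahead a = t)"

definition augment_to :: "data \<Rightarrow> data \<Rightarrow> data \<Rightarrow> data \<Rightarrow> data" where
  "augment_to T s M R =
     push (path_to R (pick (\<lambda>t. \<not> served M t \<and> reached s R t) (to_list T))) M"

definition augment :: "data \<Rightarrow> data \<Rightarrow> data \<Rightarrow> data \<Rightarrow> data" where
  "augment A T s M = augment_to T s M (search (residual A M) s)"

definition transship :: "data \<Rightarrow> data \<Rightarrow> data \<Rightarrow> data" where
  "transship A S T = fold (augment A T) (to_list S) Leaf"

lemma FP_residual: "FP D A \<Longrightarrow> FP D M \<Longrightarrow> FP D (\<lambda>d. residual (A d) (M d))"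
  by (rule FP_fun2) (unfold residual_def, intro FP_intros)

lemma size_drop_one: "size (drop_one a M) \<le> size M"
proof -
  have "size (right (fold (drop_step a) xs st)) \<le> size (right st) + size (of_list xs)" for xs st
  proof (induction xs arbitrary: st)
    case (Cons h xs)
    have "size (right (drop_step a h st)) \<le> size (right st) + size h + 1" by (simp add: drop_step_def)
    then show ?case using Cons[of "drop_step a h st"] by simp
  qed simp
  from this[of "to_list M" "Node (enc_bool False) Leaf"] show ?thesis by (simp add: drop_one_def)
qed

lemma FP_drop_one:
  assumes "FP D a" "FP D M"
  shows "FP D (\<lambda>d. drop_one (a d) (M d))"
proof -
  have "FP UNIV (\<lambda>d. fold (drop_step (left d)) (to_list (right d)) (Node (enc_bool False) Leaf))"
  proof (rule FP_fold_additive[where b = "[:2, 1:]" and step = "\<lambda>d. drop_step (left d)"])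
    show "size (drop_step (left d) h acc) \<le> size acc + poly [:2, 1:] (size d + size h)" for d h acc
    proof (cases acc)
      case (Node b c)
      then show ?thesis by (auto simp: drop_step_def)
    qed (auto simp: drop_step_def)
  qed (unfold drop_step_def, (intro FP_intros)+)
  from FP_fun2[where f = "\<lambda>a M. fold (drop_step a) (to_list M) (Node (enc_bool False) Leaf)", OF this assms]
  show ?thesis unfolding drop_one_def by (rule FP_right)
qed

lemma FP_push:
  assumes "FP D p" "FP D M"
  shows "FP D (\<lambda>d. push (p d) (M d))"
proof -
  have "FP UNIV (\<lambda>d. fold push_arc (to_list (left d)) (right d))"
  proof (rule FP_fold_additive[where b = "[:1, 1:]" and step = "\<lambda>_. push_arc"])
    show "size (push_arc h acc) \<le> size acc + poly [:1, 1:] (size d + size h)" for d h acc :: data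
      using size_right_le[of h] size_right_le[of "right h"] size_right_le[of "alabel h"]
        size_drop_one[of "right (alabel h)" acc]
      by (auto simp: push_arc_def)
  qed (unfold push_arc_def, (intro FP_intros FP_drop_one)+)
  from FP_fun2[where f = "\<lambda>p M. fold push_arc (to_list p) M", OF this assms]
  show ?thesis unfolding push_def .
qed

lemma FP_served: "FP D M \<Longrightarrow> FP D t \<Longrightarrow> FP D (\<lambda>d. enc_bool (served (M d) (t d)))"
  by (rule FP_fun2[where f = "\<lambda>M t. enc_bool (served M t)"]) (unfold served_def, intro FP_intros)

lemma FP_augment_to: "FP D T \<Longrightarrow> FP D s \<Longrightarrow> FP D M \<Longrightarrow> FP D R \<Longrightarrow>
    FP D (\<lambda>d. augment_to (T d) (s d) (M d) (R d))"
  by (rule FP_fun4) (unfold augment_to_def, intro FP_intros FP_push FP_path_to FP_served FP_reached)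

lemma FP_augment: "FP D A \<Longrightarrow> FP D T \<Longrightarrow> FP D s \<Longrightarrow> FP D M \<Longrightarrow>
    FP D (\<lambda>d. augment (A d) (T d) (s d) (M d))"
  unfolding augment_def by (intro FP_augment_to FP_search FP_residual)

subsection \<open>The network\<close>

abbreviation (input) ename :: "data \<Rightarrow> data" where "ename e \<equiv> left e"
abbreviation (input) etail :: "data \<Rightarrow> data" where "etail e \<equiv> left (right e)"
abbreviation (input) ehead :: "data \<Rightarrow> data" where "ehead e \<equiv> left (right (right e))"

abbreviation (input) input_verts :: "data \<Rightarrow> data list" where "input_verts d \<equiv> to_list (left d)"
abbreviation (input) input_edges :: "data \<Rightarrow> data list" where "input_edges d \<equiv> to_list (left (right d))"
abbreviation (input) input_family :: "data \<Rightarrow> data list" where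
  "input_family d \<equiv> to_list (left (right (right d)))"
abbreviation (input) input_parts :: "data \<Rightarrow> data list" where
  "input_parts d \<equiv> to_list (left (right (right (right (right d)))))"

text \<open>A vertex \<open>v\<close> with \<open>{v} \<in> L\<close> is split into \<open>vout v\<close>, a source, and \<open>vin v\<close>, a sink. Any
  other vertex is the single node \<open>vmid v\<close>. A part \<open>P\<close> has the source \<open>pout P\<close> and the sink
  \<open>pin P\<close>, which stand for one visit of \<open>P\<close>.\<close>

abbreviation (input) vmid :: "data \<Rightarrow> data" where "vmid v \<equiv> Node Leaf v"
abbreviation (input) vout :: "data \<Rightarrow> data" where "vout v \<equiv> Node (Node Leaf Leaf) v"
abbreviation (input) vin :: "data \<Rightarrow> data" where "vin v \<equiv> Node (Node (Node Leaf Leaf) Leaf) v"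
abbreviation (input) pout :: "data \<Rightarrow> data" where "pout P \<equiv> Node (Node Leaf (Node Leaf Leaf)) P"
abbreviation (input) pin :: "data \<Rightarrow> data" where "pin P \<equiv> Node (Node (Node Leaf Leaf) (Node Leaf Leaf)) P"

definition listed :: "data \<Rightarrow> data \<Rightarrow> bool" where
  "listed v P \<longleftrightarrow> (\<exists>u\<in>set (to_list P). u = v)"

text \<open>A duplicate-free listing of a singleton has exactly one entry, so its code is
  \<open>Node v Leaf\<close> with \<open>v\<close> the code of the vertex, and comparing trees
  decides membership in the family.\<close>

definition splits :: "data \<Rightarrow> data \<Rightarrow> bool" where
  "splits d v \<longleftrightarrow> (\<exists>l\<in>set (input_family d). left l = Node v Leaf)"

definition out_node :: "data \<Rightarrow> data \<Rightarrow> data" where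
  "out_node d v = (if splits d v then vout v else vmid v)"

definition in_node :: "data \<Rightarrow> data \<Rightarrow> data" where
  "in_node d v = (if splits d v then vin v else vmid v)"

definition out_nodes :: "data \<Rightarrow> data \<Rightarrow> data list" where
  "out_nodes d e = out_node d (etail e) #
     map (\<lambda>P. pout P) (filter (\<lambda>P. listed (etail e) P \<and> \<not> listed (ehead e) P) (input_parts d))"

definition in_nodes :: "data \<Rightarrow> data \<Rightarrow> data list" where
  "in_nodes d e = in_node d (ehead e) #
     map (\<lambda>P. pin P) (filter (\<lambda>P. listed (ehead e) P \<and> \<not> listed (etail e) P) (input_parts d))"

text \<open>Loops belong to no cut, so they contribute neither to the cut values of \<open>x\<close>
  nor to the weight, and they are left out.\<close>

definition edge_arcs :: "data \<Rightarrow> data \<Rightarrow> data list" where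
  "edge_arcs d e = (if etail e = ehead e then []
     else concat (map (\<lambda>t. map (\<lambda>h. mk_arc t h e) (in_nodes d e)) (out_nodes d e)))"

text \<open>The arcs from \<open>vout v\<close> to \<open>vin v\<close>, labelled \<open>Leaf\<close>, are used by the vertices which
  are not visited.\<close>

definition network :: "data \<Rightarrow> data" where
  "network d = of_list (concat (map (edge_arcs d) (input_edges d)) @
     map (\<lambda>v. mk_arc (vout v) (vin v) Leaf) (filter (splits d) (input_verts d)))"

definition sources :: "data \<Rightarrow> data" where
  "sources d = of_list (map (\<lambda>v. vout v) (filter (splits d) (input_verts d)) @
     map (\<lambda>P. pout P) (input_parts d))"

definition sinks :: "data \<Rightarrow> data" where
  "sinks d = of_list (map (\<lambda>v. vin v) (filter (splits d) (input_verts d)) @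
     map (\<lambda>P. pin P) (input_parts d))"

text \<open>In the final flow exactly one arc enters \<open>pin P\<close>. Its label remembers the
  original edge, whose true head is the vertex of \<open>P\<close> at which the inner path has to
  start.\<close>

definition entry :: "data \<Rightarrow> data \<Rightarrow> data" where
  "entry M P = ehead (alabel (pick (\<lambda>a. ahead a = pin P) (to_list M)))"

definition exit_of :: "data \<Rightarrow> data \<Rightarrow> data" where
  "exit_of M P = etail (alabel (pick (\<lambda>a. atail a = pout P) (to_list M)))"

definition inner_arcs :: "data \<Rightarrow> data \<Rightarrow> data" where
  "inner_arcs d P = of_list (map (\<lambda>e. mk_arc (etail e) (ehead e) e)
     (filter (\<lambda>e. listed (etail e) P \<and> listed (ehead e) P) (input_edges d)))"

definition connection :: "data \<Rightarrow> data \<Rightarrow> data \<Rightarrow> data" where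
  "connection d M P = path_to (search (inner_arcs d P) (entry M P)) (exit_of M P)"

definition assemble :: "data \<Rightarrow> data \<Rightarrow> data" where
  "assemble d M = of_list (map (\<lambda>a. ename (alabel a)) (filter (\<lambda>a. alabel a \<noteq> Leaf) (to_list M)) @
     concat (map (\<lambda>P. map (\<lambda>a. ename (alabel a)) (to_list (connection d M P))) (input_parts d)))"

definition solve :: "data \<Rightarrow> data" where
  "solve d = assemble d (transship (network d) (sources d) (sinks d))"

lemma FP_listed: "FP D v \<Longrightarrow> FP D P \<Longrightarrow> FP D (\<lambda>d. enc_bool (listed (v d) (P d)))"
  by (rule FP_fun2[where f = "\<lambda>v P. enc_bool (listed v P)"]) (unfold listed_def, intro FP_intros)

lemma FP_splits: "FP D d \<Longrightarrow> FP D v \<Longrightarrow> FP D (\<lambda>z. enc_bool (splits (d z) (v z)))"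
  by (rule FP_fun2[where f = "\<lambda>d v. enc_bool (splits d v)"]) (unfold splits_def, intro FP_intros)

lemma FP_out_nodes: "FP D d \<Longrightarrow> FP D e \<Longrightarrow> FP D (\<lambda>z. of_list (out_nodes (d z) (e z)))"
  by (rule FP_fun2[where f = "\<lambda>d e. of_list (out_nodes d e)"])
    (unfold out_nodes_def out_node_def, intro FP_intros FP_listed FP_splits)

lemma FP_in_nodes: "FP D d \<Longrightarrow> FP D e \<Longrightarrow> FP D (\<lambda>z. of_list (in_nodes (d z) (e z)))"
  by (rule FP_fun2[where f = "\<lambda>d e. of_list (in_nodes d e)"])
    (unfold in_nodes_def in_node_def, intro FP_intros FP_listed FP_splits)

lemma FP_edge_arcs: "FP D d \<Longrightarrow> FP D e \<Longrightarrow> FP D (\<lambda>z. of_list (edge_arcs (d z) (e z)))"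
  by (rule FP_fun2[where f = "\<lambda>d e. of_list (edge_arcs d e)"])
    (unfold edge_arcs_def, intro FP_intros FP_out_nodes FP_in_nodes)

lemma FP_network: "FP D d \<Longrightarrow> FP D (\<lambda>z. network (d z))"
  by (rule FP_comp) (unfold network_def, intro FP_intros FP_edge_arcs FP_splits)

lemma FP_sources: "FP D d \<Longrightarrow> FP D (\<lambda>z. sources (d z))"
  by (rule FP_comp) (unfold sources_def, intro FP_intros FP_splits)

lemma FP_sinks: "FP D d \<Longrightarrow> FP D (\<lambda>z. sinks (d z))"
  by (rule FP_comp) (unfold sinks_def, intro FP_intros FP_splits)

lemma FP_connection: "FP D d \<Longrightarrow> FP D M \<Longrightarrow> FP D P \<Longrightarrow>
    FP D (\<lambda>z. connection (d z) (M z) (P z))"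
  by (rule FP_fun3)
    (unfold connection_def inner_arcs_def entry_def exit_of_def,
     intro FP_intros FP_path_to FP_search FP_listed)

lemma FP_assemble: "FP D d \<Longrightarrow> FP D M \<Longrightarrow> FP D (\<lambda>z. assemble (d z) (M z))"
  by (rule FP_fun2) (unfold assemble_def, intro FP_intros FP_connection)

text \<open>One augmentation changes the accumulator along a path of a residual network that itself
  depends on the accumulator, so the additive rule does not apply directly. The bound on all
  prefixes is left as a hypothesis, to be derived from the invariant of the augmentations.\<close>

lemma FP_solve:
  assumes "\<And>d xs ys. d \<in> D \<Longrightarrow> to_list (sources d) = xs @ ys \<Longrightarrow>
    size (fold (augment (network d) (sinks d)) xs Leaf) \<le> poly b (size d)"
  shows "FP D solve"
  unfolding solve_def transship_def
  by (intro FP_assemble FP_id FP_fold FP_Leaf FP_augment FP_network FP_sinks FP_sources FP_left FP_right)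
    (use assms in auto)

section \<open>Correctness\<close>

subsection \<open>Graph search\<close>

lemma reached_simps [simp]:
  "reached s Leaf n \<longleftrightarrow> n = s"
  "reached s (Node a R) n \<longleftrightarrow> reached s R n \<or> n = ahead a"
  by (auto simp: reached_def)

fun arborescence :: "data \<Rightarrow> data \<Rightarrow> bool" where
  "arborescence s Leaf = True"
| "arborescence s (Node a R) =
     (arborescence s R \<and> reached s R (atail a) \<and> \<not> reached s R (ahead a))"

lemma arborescence_grow: "arborescence s R \<Longrightarrow> arborescence s (fold (grow s) xs R)"
  by (induction xs arbitrary: R) (auto simp: grow_def)

lemma set_grow: "set (to_list (fold (grow s) xs R)) \<subseteq> set (to_list R) \<union> set xs"
proof (induction xs arbitrary: R)
  case (Cons a xs)
  have "set (to_list (grow s a R)) \<subseteq> insert a (set (to_list R))" by (auto simp: grow_def)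
  then show ?case using Cons[of "grow s a R"] by auto
qed simp

lemma length_grow: "length (to_list R) \<le> length (to_list (fold (grow s) xs R))"
proof (induction xs arbitrary: R)
  case (Cons a xs)
  have "length (to_list R) \<le> length (to_list (grow s a R))" by (auto simp: grow_def)
  then show ?case using Cons[of "grow s a R"] by auto
qed simp

definition closed_under :: "data list \<Rightarrow> data set \<Rightarrow> bool" where
  "closed_under A N \<longleftrightarrow> (\<forall>a\<in>set A. atail a \<in> N \<longrightarrow> ahead a \<in> N)"

text \<open>If a sweep adds nothing, the reached set never changed during it, so every arc was
  tested against the final set.\<close>

lemma grow_progress:
  "fold (grow s) xs R = R \<and> closed_under xs {n. reached s R n} \<or>
   length (to_list R) < length (to_list (fold (grow s) xs R))"
proof (induction xs arbitrary: R)
  case (Cons a xs)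
  show ?case
  proof (cases "grow s a R = R")
    case True
    \<comment> \<open>The comparison of sizes excludes \<open>Node a R = R\<close>.\<close>
    then have "reached s R (atail a) \<longrightarrow> reached s R (ahead a)"
      by (auto simp: grow_def dest: arg_cong[of _ _ size] split: if_splits)
    then show ?thesis using Cons[of R] True by (auto simp: closed_under_def)
  next
    case False
    then have "length (to_list R) < length (to_list (grow s a R))"
      by (auto simp: grow_def split: if_splits)
    then show ?thesis using length_grow[of "grow s a R" s xs] by simp
  qed
qed (simp add: closed_under_def)

lemma arborescence_distinct:
  "arborescence s R \<Longrightarrow> distinct (map (\<lambda>a. ahead a) (to_list R)) \<and> s \<notin> (\<lambda>a. ahead a) ` set (to_list R)"
  by (induction R) (auto simp: reached_def)

text \<open>Closure in two cases. Either some sweep was idle, or the tree has as many arcs as the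
  list \<open>A\<close> has entries; tree arcs have distinct heads and are therefore distinct, so
  then every arc of \<open>A\<close> is a tree arc and its head is reached.\<close>

lemma search:
  shows "arborescence s (search A s)"
    and "set (to_list (search A s)) \<subseteq> set (to_list A)"
    and "closed_under (to_list A) {n. reached s (search A s) n}"
proof -
  define S where "S ys = fold (\<lambda>_. sweep A s) ys Leaf" for ys :: "data list"
  have 1: "arborescence s (S ys) \<and> set (to_list (S ys)) \<subseteq> set (to_list A) \<and>
    (closed_under (to_list A) {n. reached s (S ys) n} \<or> length ys \<le> length (to_list (S ys)))" for ys
  proof (induction ys rule: rev_induct)
    case Nil
    show ?case by (simp add: S_def)
  next
    case (snoc y ys)
    have S: "S (ys @ [y]) = fold (grow s) (to_list A) (S ys)" by (simp add: S_def sweep_def)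
    have "closed_under (to_list A) {n. reached s (S (ys @ [y])) n} \<or>
        length (ys @ [y]) \<le> length (to_list (S (ys @ [y])))"
    proof (cases "closed_under (to_list A) {n. reached s (S ys) n}")
      case True
      have "fold (grow s) xs R = R" if "closed_under xs {n. reached s R n}" for xs R
        using that by (induction xs) (auto simp: grow_def closed_under_def)
      then show ?thesis using True S by simp
    next
      case False
      then have "length ys \<le> length (to_list (S ys))" using snoc by blast
      moreover have "closed_under (to_list A) {n. reached s (S (ys @ [y])) n} \<or>
          length (to_list (S ys)) < length (to_list (S (ys @ [y])))"
        unfolding S using grow_progress[of s "to_list A" "S ys"] by auto
      ultimately show ?thesis by auto
    qed
    then show ?case using snoc arborescence_grow[of s "S ys" "to_list A"]
      set_grow[of s "to_list A" "S ys"] S by auto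
  qed
  have R: "search A s = S (to_list A)" by (simp add: search_def S_def)
  show a: "arborescence s (search A s)" and b: "set (to_list (search A s)) \<subseteq> set (to_list A)"
    using 1 R by auto
  show "closed_under (to_list A) {n. reached s (search A s) n}"
  proof (cases "length (to_list A) \<le> length (to_list (search A s))")
    case True
    have "distinct (to_list (search A s))" using arborescence_distinct[OF a] by (simp add: distinct_map)
    then have "card (set (to_list (search A s))) = length (to_list (search A s))"
      by (rule distinct_card)
    moreover have "card (set (to_list A)) \<le> length (to_list A)" by (rule card_length)
    ultimately have "set (to_list (search A s)) = set (to_list A)"
      using b True by (intro card_seteq) auto
    then show ?thesis unfolding closed_under_def reached_def by auto
  next
    case False
    then show ?thesis using 1[of "to_list A"] R by auto
  qed
qed

fun walk :: "data \<Rightarrow> data list \<Rightarrow> data \<Rightarrow> bool" where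
  "walk s [] t \<longleftrightarrow> s = t"
| "walk s (a # p) t \<longleftrightarrow> atail a = s \<and> walk (ahead a) p t"

lemma walk_append: "walk s (p @ q) t \<longleftrightarrow> (\<exists>m. walk s p m \<and> walk m q t)"
  by (induction p arbitrary: s) auto

lemma trace_Node:
  "trace a (Node n P) = (if ahead a = n then Node (atail a) (Node a P) else Node n P)"
  by (simp add: trace_def)

text \<open>\<open>q\<close> is the newly traced part, in front of the path \<open>P\<close> already
  collected. Heads in an arborescence are pairwise distinct, so no node is entered twice.\<close>

lemma trace_walk:
  assumes "arborescence s R" "reached s R n"
  shows "\<exists>q. fold trace (to_list R) (Node n P) = Node s (of_list (q @ to_list P)) \<and> walk s q n \<and>
    distinct (map (\<lambda>a. ahead a) q) \<and> set q \<subseteq> set (to_list R)"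
  using assms
proof (induction R arbitrary: n P)
  case Leaf
  then show ?case by (intro exI[of _ "[]"]) simp
next
  case (Node a R)
  show ?case
  proof (cases "ahead a = n")
    case True
    obtain q where q: "fold trace (to_list R) (Node (atail a) (Node a P)) =
        Node s (of_list (q @ to_list (Node a P)))" "walk s q (atail a)"
      "distinct (map (\<lambda>a. ahead a) q)" "set q \<subseteq> set (to_list R)"
      using Node.IH(2)[of "atail a" "Node a P"] Node.prems by auto
    have "ahead a \<notin> (\<lambda>a. ahead a) ` set q" using Node.prems(1) q(4) by (auto simp: reached_def)
    then show ?thesis using q True
      by (intro exI[of _ "q @ [a]"]) (auto simp: trace_Node walk_append)
  next
    case False
    then have "reached s R n" using Node.prems by auto
    then show ?thesis using Node.IH(2)[of n P] Node.prems False by (auto simp: trace_Node)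
  qed
qed

lemma path_to:
  assumes "arborescence s R" "reached s R t"
  shows "walk s (to_list (path_to R t)) t"
    and "distinct (map (\<lambda>a. ahead a) (to_list (path_to R t)))"
    and "s \<notin> (\<lambda>a. ahead a) ` set (to_list (path_to R t))"
    and "set (to_list (path_to R t)) \<subseteq> set (to_list R)"
  using trace_walk[OF assms, of Leaf] arborescence_distinct[OF assms(1)]
  by (auto simp: path_to_def)

subsection \<open>Transshipment\<close>

text \<open>Net outflow, so sources count positively and sinks negatively.\<close>

definition excess :: "data multiset \<Rightarrow> data \<Rightarrow> int" where
  "excess M n = (\<Sum>a\<in>#M. of_bool (atail a = n) - of_bool (ahead a = n))"

lemma excess_simps [simp]:
  "excess {#} n = 0"
  "excess (add_mset a M) n = of_bool (atail a = n) - of_bool (ahead a = n) + excess M n"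
  "excess (M + N) n = excess M n + excess N n"
  by (simp_all add: excess_def)

lemma excess_walk: "walk s p t \<Longrightarrow> excess (mset p) n = of_bool (n = s) - of_bool (n = t)"
  by (induction p arbitrary: s) (auto simp: eq_commute)

lemma sum_excess:
  "finite N \<Longrightarrow> (\<Sum>n\<in>N. excess M n) = (\<Sum>a\<in>#M. of_bool (atail a \<in> N) - of_bool (ahead a \<in> N))"
proof (induction M)
  case (add a M)
  have "(\<Sum>n\<in>N. of_bool (b = n) :: int) = of_bool (b \<in> N)" for b
    using add.prems by (simp add: of_bool_def sum.delta)
  then show ?case using add by (simp add: sum.distrib sum_subtractf)
qed simp

lemma mset_drop_one: "mset (to_list (drop_one a M)) = mset (to_list M) - {#a#}"
proof -
  have T: "mset (to_list (right (fold (drop_step a) xs (Node (enc_bool True) S)))) = mset xs + mset (to_list S)"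
    for xs S by (induction xs arbitrary: S) (auto simp: drop_step_def)
  have "mset (to_list (right (fold (drop_step a) xs (Node Leaf S)))) =
      mset xs - {#a#} + mset (to_list S)" for xs S
    by (induction xs arbitrary: S) (use T in \<open>auto simp: drop_step_def\<close>)
  from this[of "to_list M" Leaf] show ?thesis by (simp add: drop_one_def)
qed

definition is_forward :: "data \<Rightarrow> bool" where
  "is_forward r \<longleftrightarrow> left (alabel r) = Leaf"

definition forward_arcs :: "data list \<Rightarrow> data list" where
  "forward_arcs p = map (\<lambda>r. right (alabel r)) (filter is_forward p)"

definition backward_arcs :: "data list \<Rightarrow> data list" where
  "backward_arcs p = map (\<lambda>r. right (alabel r)) (filter (\<lambda>r. \<not> is_forward r) p)"

text \<open>Written as an equation of sums to avoid truncated subtraction. Since all backward arcs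
  lie in the initial multiset, with multiplicity, no removal can fail, however additions and
  removals interleave.\<close>

lemma mset_push:
  "mset (backward_arcs p) \<subseteq># mset (to_list M) \<Longrightarrow>
   mset (to_list (fold push_arc p M)) + mset (backward_arcs p) = mset (to_list M) + mset (forward_arcs p)"
proof (induction p arbitrary: M)
  case Nil
  then show ?case by (simp add: backward_arcs_def forward_arcs_def)
next
  case (Cons r p)
  let ?a = "right (alabel r)"
  show ?case
  proof (cases "is_forward r")
    case True
    have e: "backward_arcs (r # p) = backward_arcs p" "forward_arcs (r # p) = ?a # forward_arcs p"
      "push_arc r M = Node ?a M"
      using True by (auto simp: backward_arcs_def forward_arcs_def push_arc_def is_forward_def)
    have "mset (to_list M) \<subseteq># mset (to_list (Node ?a M))"
      using mset_subset_eq_add_left[of "mset (to_list M)" "{#?a#}"] by simp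
    with Cons.prems have "mset (backward_arcs p) \<subseteq># mset (to_list (Node ?a M))"
      unfolding e(1) by (rule subset_mset.order_trans)
    from Cons.IH[OF this] show ?thesis using e by simp
  next
    case False
    have e: "backward_arcs (r # p) = ?a # backward_arcs p" "forward_arcs (r # p) = forward_arcs p"
      "push_arc r M = drop_one ?a M"
      using False by (auto simp: backward_arcs_def forward_arcs_def push_arc_def is_forward_def)
    have sub: "add_mset ?a (mset (backward_arcs p)) \<subseteq># mset (to_list M)" using Cons.prems e by simp
    then have "mset (backward_arcs p) \<subseteq># mset (to_list M) - {#?a#}"
      by (simp add: insert_subset_eq_iff)
    then have IH: "mset (to_list (fold push_arc p (drop_one ?a M))) + mset (backward_arcs p) =
        mset (to_list M) - {#?a#} + mset (forward_arcs p)"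
      using Cons.IH[of "drop_one ?a M"] by (simp add: mset_drop_one)
    have "?a \<in># mset (to_list M)" using sub by (rule mset_subset_eq_insertD[THEN conjunct1])
    then have "add_mset ?a (mset (to_list M) - {#?a#}) = mset (to_list M)" by simp
    moreover have "mset (to_list (fold push_arc p (drop_one ?a M))) + add_mset ?a (mset (backward_arcs p)) =
        add_mset ?a (mset (to_list M) - {#?a#}) + mset (forward_arcs p)"
      using IH by simp
    ultimately show ?thesis using e by simp
  qed
qed

lemma mset_le_of_distinct:
  assumes "distinct xs" "set xs \<subseteq> set_mset M"
  shows "mset xs \<subseteq># M"
proof (rule mset_subset_eqI)
  fix a
  have "count (mset xs) a = (if a \<in> set xs then 1 else 0)"
    using assms(1) by (simp add: distinct_count_atmost_1)
  also have "\<dots> \<le> count M a" using assms(2) by (auto simp: Suc_le_eq)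
  finally show "count (mset xs) a \<le> count M a" .
qed

lemma residual_cases:
  assumes "r \<in> set (to_list (residual A M))"
  obtains (forward) a where "a \<in> set (to_list A)" "r = mk_arc (atail a) (ahead a) (Node Leaf a)" "is_forward r"
  | (backward) a where "a \<in> set (to_list M)" "r = mk_arc (ahead a) (atail a) (Node (Node Leaf Leaf) a)"
    "\<not> is_forward r"
  using assms by (auto simp: residual_def is_forward_def)

text \<open>A residual arc is determined by its direction and its original arc. A path without
  repetitions therefore adds each arc at most once and removes each at most once; the former bounds
  the growth, the latter makes all removals possible.\<close>

lemma push_residual_path:
  assumes p: "set p \<subseteq> set (to_list (residual A M))" "distinct p" "walk s p t"
  defines "M' \<equiv> fold push_arc p M"
  shows "excess (mset (to_list M')) n =
      excess (mset (to_list M)) n + of_bool (n = s) - of_bool (n = t)"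
    and "set (to_list M') \<subseteq> set (to_list M) \<union> set (to_list A)"
    and "length (to_list M') \<le> length (to_list M) + length (to_list A)"
proof -
  have "inj_on (\<lambda>r. right (alabel r)) (set (filter is_forward p))"
  proof (rule inj_onI)
    fix r r' assume "r \<in> set (filter is_forward p)" "r' \<in> set (filter is_forward p)"
      "right (alabel r) = right (alabel r')"
    moreover from this have "r \<in> set (to_list (residual A M))" "r' \<in> set (to_list (residual A M))"
      using p(1) by auto
    ultimately show "r = r'" by (elim residual_cases) auto
  qed
  then have df: "distinct (forward_arcs p)" using p(2) unfolding forward_arcs_def by (simp add: distinct_map)
  have "inj_on (\<lambda>r. right (alabel r)) (set (filter (\<lambda>r. \<not> is_forward r) p))"
  proof (rule inj_onI)
    fix r r' assume "r \<in> set (filter (\<lambda>r. \<not> is_forward r) p)" "r' \<in> set (filter (\<lambda>r. \<not> is_forward r) p)"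
      "right (alabel r) = right (alabel r')"
    moreover from this have "r \<in> set (to_list (residual A M))" "r' \<in> set (to_list (residual A M))"
      using p(1) by auto
    ultimately show "r = r'" by (elim residual_cases) auto
  qed
  then have db: "distinct (backward_arcs p)" using p(2) unfolding backward_arcs_def by (simp add: distinct_map)
  have sb: "set (backward_arcs p) \<subseteq> set (to_list M)"
    using p(1) unfolding backward_arcs_def by (auto elim!: residual_cases)
  have sf: "set (forward_arcs p) \<subseteq> set (to_list A)"
    using p(1) unfolding forward_arcs_def by (auto elim!: residual_cases)
  have eq: "mset (to_list M') + mset (backward_arcs p) = mset (to_list M) + mset (forward_arcs p)"
    unfolding M'_def using db sb by (intro mset_push mset_le_of_distinct) auto
  have "excess (mset q) n = excess (mset (forward_arcs q)) n - excess (mset (backward_arcs q)) n"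
    if "set q \<subseteq> set (to_list (residual A M))" for q
    using that
  proof (induction q)
    case (Cons r q)
    have "r \<in> set (to_list (residual A M))" using Cons.prems by simp
    then show ?case using Cons
      by (cases rule: residual_cases) (auto simp: forward_arcs_def backward_arcs_def is_forward_def)
  qed (simp add: forward_arcs_def backward_arcs_def)
  from this[OF p(1)] excess_walk[OF p(3), of n]
  show "excess (mset (to_list M')) n = excess (mset (to_list M)) n + of_bool (n = s) - of_bool (n = t)"
    using arg_cong[OF eq, of "\<lambda>M. excess M n"] by simp
  show "set (to_list M') \<subseteq> set (to_list M) \<union> set (to_list A)"
    using arg_cong[OF eq, of set_mset] sf by auto
  have "length (forward_arcs p) = card (set (forward_arcs p))" using df by (simp add: distinct_card)
  also have "\<dots> \<le> card (set (to_list A))" using sf by (intro card_mono) auto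
  also have "\<dots> \<le> length (to_list A)" by (rule card_length)
  finally show "length (to_list M') \<le> length (to_list M) + length (to_list A)"
    using arg_cong[OF eq, of size] by simp
qed

lemma excess_sink:
  assumes "\<And>a. a \<in># M \<Longrightarrow> atail a \<noteq> n"
  shows "excess M n \<le> 0 \<and> (excess M n < 0 \<longleftrightarrow> (\<exists>a\<in>#M. ahead a = n))"
  using assms by (induction M) auto

text \<open>The condition on \<open>A\<close>, \<open>S\<close> and \<open>T\<close> is necessary for the existence of a transshipment,
  since no arc leaves \<open>N\<close>. If the search from \<open>s\<close> meets no sink with a demand left, then
  it applies to the set \<open>N\<close> of the nodes met, which no arc of \<open>M\<close> enters.\<close>

locale transshipment =
  fixes A S T :: data
  assumes distinct_S: "distinct (to_list S)" and distinct_T: "distinct (to_list T)"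
    and disjoint: "set (to_list S) \<inter> set (to_list T) = {}"
    and sink: "\<And>a. a \<in> set (to_list A) \<Longrightarrow> atail a \<notin> set (to_list T)"
    and hall: "\<And>N. closed_under (to_list A) N \<Longrightarrow>
      card (set (to_list S) \<inter> N) \<le> card (set (to_list T) \<inter> N)"
begin

definition partial :: "data set \<Rightarrow> data \<Rightarrow> bool" where
  "partial S' M \<longleftrightarrow> set (to_list M) \<subseteq> set (to_list A) \<and>
    (\<forall>n. excess (mset (to_list M)) n = of_bool (n \<in> S') - of_bool (n \<in> set (to_list T) \<and> served M n))"

lemma partial_augment:
  assumes M: "partial S' M" and s: "s \<in> set (to_list S)" "s \<notin> S'" "S' \<subseteq> set (to_list S)"
  shows "partial (insert s S') (augment A T s M)"
    and "length (to_list (augment A T s M)) \<le> length (to_list M) + length (to_list A)"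
proof -
  define R where "R = search (residual A M) s"
  define t where "t = pick (\<lambda>t. \<not> served M t \<and> reached s R t) (to_list T)"
  let ?N = "{n. reached s R n}"
  have sub: "set (to_list M) \<subseteq> set (to_list A)" using M by (simp add: partial_def)
  have ex: "excess (mset (to_list M)) n = of_bool (n \<in> S') - of_bool (n \<in> set (to_list T) \<and> served M n)"
    for n using M by (simp add: partial_def)
  have R: "arborescence s R" "set (to_list R) \<subseteq> set (to_list (residual A M))"
    "closed_under (to_list (residual A M)) ?N"
    unfolding R_def by (rule search)+
  have "\<exists>t\<in>set (to_list T). \<not> served M t \<and> reached s R t"
  proof (rule ccontr)
    assume none: "\<not> ?thesis"
    have fin: "finite ?N" unfolding reached_def by (rule finite_subset[of _ "insert s ((\<lambda>a. ahead a) ` set (to_list R))"]) auto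
    have fwd: "ahead a \<in> ?N" if "a \<in> set (to_list A)" "atail a \<in> ?N" for a
      using R(3)[unfolded closed_under_def, rule_format, of "mk_arc (atail a) (ahead a) (Node (enc_bool False) a)"]
        that by (auto simp: residual_def)
    \<comment> \<open>Backward residual arcs: an arc of \<open>M\<close> with its head in the
      reached set also has its tail there.\<close>
    have bwd: "atail a \<in> ?N" if "a \<in> set (to_list M)" "ahead a \<in> ?N" for a
      using R(3)[unfolded closed_under_def, rule_format, of "mk_arc (ahead a) (atail a) (Node (enc_bool True) a)"]
        that by (auto simp: residual_def)
    have "closed_under (to_list A) ?N"
      using fwd unfolding closed_under_def by blast
    then have "card (set (to_list S) \<inter> ?N) \<le> card (set (to_list T) \<inter> ?N)" by (rule hall)
    \<comment> \<open>Arcs of \<open>M\<close> have both ends in the reached set or none, so its net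
      outflow is zero. All sinks in it are served, hence they are as many as the treated sources in
      it. The untreated \<open>s\<close> is one source too many for the cardinality
      condition.\<close>
    moreover have "card (set (to_list T) \<inter> ?N) = card (S' \<inter> ?N)"
    proof -
      have "(\<Sum>n\<in>?N. excess (mset (to_list M)) n) = 0"
      proof -
        have "of_bool (atail a \<in> ?N) - of_bool (ahead a \<in> ?N) = (0::int)" if "a \<in># mset (to_list M)" for a
          using that sub fwd[of a] bwd[of a] by (auto simp: of_bool_def)
        then show ?thesis unfolding sum_excess[OF fin] by (metis (no_types, lifting) image_mset_cong sum_mset.neutral_const)
      qed
      moreover have "excess (mset (to_list M)) n = of_bool (n \<in> S') - of_bool (n \<in> set (to_list T))"
        if "n \<in> ?N" for n using ex[of n] none that by auto
      then have "(\<Sum>n\<in>?N. excess (mset (to_list M)) n) =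
          (\<Sum>n\<in>?N. of_bool (n \<in> S') - of_bool (n \<in> set (to_list T)))"
        by (intro sum.cong) auto
      moreover have "(\<Sum>n\<in>?N. of_bool (n \<in> X) :: int) = int (card (X \<inter> ?N))" for X
        using fin by (simp add: Int_commute)
      ultimately show ?thesis by (simp add: sum_subtractf)
    qed
    moreover have "card (S' \<inter> ?N) < card (set (to_list S) \<inter> ?N)"
      using s by (intro psubset_card_mono) (auto simp: reached_def)
    ultimately show False by simp
  qed
  then have t: "t \<in> set (to_list T)" "\<not> served M t" "reached s R t"
    using pick[where xs = "to_list T" and P = "\<lambda>t. \<not> served M t \<and> reached s R t"]
    unfolding t_def by simp_all
  let ?p = "to_list (path_to R t)"
  have p: "walk s ?p t" "distinct ?p" "set ?p \<subseteq> set (to_list (residual A M))"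
    using path_to[OF R(1) t(3)] R(2) by (auto simp: distinct_map)
  have a: "augment A T s M = fold push_arc ?p M"
    by (simp add: augment_def augment_to_def push_def R_def t_def)
  let ?M = "augment A T s M"
  have ex': "excess (mset (to_list ?M)) n =
      excess (mset (to_list M)) n + of_bool (n = s) - of_bool (n = t)" for n
    unfolding a by (rule push_residual_path[OF p(3,2,1)])
  have sub': "set (to_list ?M) \<subseteq> set (to_list A)"
    using push_residual_path(2)[OF p(3,2,1)] sub a by auto
  have "excess (mset (to_list ?M)) n =
      of_bool (n \<in> insert s S') - of_bool (n \<in> set (to_list T) \<and> served ?M n)" for n
  \<comment> \<open>No arc leaves a sink, so its excess is minus the number of entering arcs, and it
    is negative exactly if the sink is served.\<close>
  proof (cases "n \<in> set (to_list T)")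
    case True
    then have "n \<notin> S'" "n \<noteq> s" using disjoint s by auto
    then have e: "excess (mset (to_list ?M)) n = - of_bool (served M n) - of_bool (n = t)"
      using ex'[of n] ex[of n] True by simp
    moreover have "atail b \<noteq> n" if "b \<in># mset (to_list ?M)" for b
      using that sub' sink[of b] True by auto
    then have "excess (mset (to_list ?M)) n < 0 \<longleftrightarrow> served ?M n"
      using excess_sink[of "mset (to_list ?M)" n] by (simp add: served_def)
    ultimately show ?thesis using \<open>n \<notin> S'\<close> \<open>n \<noteq> s\<close> True t(2)
      by (cases "n = t"; cases "served M n"; cases "served ?M n") auto
  next
    case False
    then have "n \<noteq> t" using t(1) by auto
    then show ?thesis using ex'[of n] ex[of n] False s(2) by auto
  qed
  then show "partial (insert s S') ?M" using sub' by (simp add: partial_def)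
  show "length (to_list ?M) \<le> length (to_list M) + length (to_list A)"
    unfolding a by (rule push_residual_path(3)[OF p(3,2,1)])
qed

lemma partial_prefix:
  assumes "to_list S = xs @ ys"
  shows "partial (set xs) (fold (augment A T) xs Leaf) \<and>
    length (to_list (fold (augment A T) xs Leaf)) \<le> length xs * length (to_list A)"
  using assms
proof (induction xs arbitrary: ys rule: rev_induct)
  case Nil
  show ?case by (simp add: partial_def served_def)
next
  case (snoc x xs)
  have IH: "partial (set xs) (fold (augment A T) xs Leaf)"
    "length (to_list (fold (augment A T) xs Leaf)) \<le> length xs * length (to_list A)"
    using snoc.IH[of "x # ys"] snoc.prems by auto
  have "x \<in> set (to_list S)" "x \<notin> set xs" "set xs \<subseteq> set (to_list S)"
    using snoc.prems distinct_S by auto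
  from partial_augment[OF IH(1) this] show ?case using IH(2) by simp
qed

text \<open>Once all sources are treated, the net outflows of all nodes add up to zero, so as many
  sinks are served as there are sources. Equal numbers then leave no sink unserved.\<close>

lemma transship:
  assumes "length (to_list S) = length (to_list T)"
  shows "set (to_list (transship A S T)) \<subseteq> set (to_list A)"
    and "excess (mset (to_list (transship A S T))) n =
      of_bool (n \<in> set (to_list S)) - of_bool (n \<in> set (to_list T))"
proof -
  let ?M = "transship A S T"
  let ?U = "{n \<in> set (to_list T). served ?M n}"
  have "partial (set (to_list S)) ?M"
    using partial_prefix[of "to_list S" "[]"] by (simp add: transship_def)
  then show "set (to_list ?M) \<subseteq> set (to_list A)" by (simp add: partial_def)
  have ex: "excess (mset (to_list ?M)) n = of_bool (n \<in> set (to_list S)) - of_bool (n \<in> ?U)" for n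
    using \<open>partial (set (to_list S)) ?M\<close> by (simp add: partial_def)
  let ?N = "set (to_list S) \<union> set (to_list T) \<union> (\<lambda>a. atail a) ` set (to_list ?M) \<union> (\<lambda>a. ahead a) ` set (to_list ?M)"
  have fin: "finite ?N" by simp
  have "(\<Sum>n\<in>?N. excess (mset (to_list ?M)) n) = 0"
  proof -
    have "of_bool (atail a \<in> ?N) - of_bool (ahead a \<in> ?N) = (0::int)" if "a \<in># mset (to_list ?M)" for a
      using that by auto
    then show ?thesis unfolding sum_excess[OF fin]
      by (metis (no_types, lifting) image_mset_cong sum_mset.neutral_const)
  qed
  moreover have "(\<Sum>n\<in>?N. of_bool (n \<in> X) :: int) = int (card X)" if "X \<subseteq> ?N" for X
    using fin that by (simp add: Int_absorb1)
  moreover have "?U \<subseteq> ?N" "set (to_list S) \<subseteq> ?N" by auto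
  ultimately have "card (set (to_list S)) = card ?U"
    unfolding ex by (simp only: sum_subtractf)
  then have "card ?U = card (set (to_list T))"
    using assms distinct_S distinct_T by (simp add: distinct_card)
  then have "?U = set (to_list T)" by (intro card_subset_eq) auto
  then show "excess (mset (to_list ?M)) n = of_bool (n \<in> set (to_list S)) - of_bool (n \<in> set (to_list T))"
    using ex by simp
qed

end

subsection \<open>Encodings\<close>

lemma inj_enc_bool: "inj enc_bool"
  by (rule injI) (case_tac x; case_tac y; simp)

lemma enc_list_simps [simp]:
  "enc_list f [] = Leaf" "enc_list f (x # xs) = Node (f x) (enc_list f xs)"
  by (simp_all add: enc_list_def)

lemma inj_enc_list: "inj f \<Longrightarrow> inj (enc_list f)"
proof (rule injI)
  fix xs ys assume "inj f" "enc_list f xs = enc_list f ys"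
  then show "xs = ys"
  proof (induction xs arbitrary: ys)
    case Nil
    then show ?case by (cases ys) auto
  next
    case (Cons x xs)
    then show ?case by (cases ys) (auto dest: injD)
  qed
qed

lemma inj_nat_bits: "inj nat_bits"
proof (rule injI)
  fix m n assume "nat_bits m = nat_bits n"
  then show "m = n"
  proof (induction m arbitrary: n rule: nat_bits.induct)
    case (1 m)
    show ?case
    proof (cases "m = 0 \<or> n = 0")
      case True
      then show ?thesis using 1(2) by (auto simp: nat_bits.simps[of m] nat_bits.simps[of n] split: if_splits)
    next
      case False
      then have "odd m = odd n" "nat_bits (m div 2) = nat_bits (n div 2)"
        using 1(2) by (auto simp: nat_bits.simps[of m] nat_bits.simps[of n])
      then have "m div 2 = n div 2" "m mod 2 = n mod 2" using 1(1)[of "n div 2"] False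
        by (simp_all add: mod2_eq_if)
      then have "m div 2 * 2 + m mod 2 = n div 2 * 2 + n mod 2" by (simp only:)
      then show ?thesis by (simp only: div_mult_mod_eq)
    qed
  qed
qed

lemma inj_enc_nat: "inj enc_nat"
  unfolding enc_nat_def
  using inj_compose[OF inj_enc_list[OF inj_enc_bool] inj_nat_bits] by (simp add: comp_def)

lemma enc_nat_eq_iff [simp]: "enc_nat m = enc_nat n \<longleftrightarrow> m = n"
  using inj_enc_nat by (auto dest: injD)

lemma enc_nats_eq_iff [simp]: "enc_list enc_nat xs = enc_list enc_nat ys \<longleftrightarrow> xs = ys"
  using inj_enc_list[OF inj_enc_nat] by (auto dest: injD)

subsection \<open>Cuts\<close>

lemma sum_filter_of_bool:
  fixes f :: "'c \<Rightarrow> real"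
  assumes "finite A"
  shows "sum f {a \<in> A. P a} = (\<Sum>a\<in>A. f a * of_bool (P a))"
proof -
  have "(\<Sum>a\<in>A. f a * of_bool (P a)) = (\<Sum>a\<in>A. if P a then f a else 0)"
    by (rule sum.cong) auto
  then show ?thesis using sum.inter_filter[OF assms, of f P] by simp
qed

context atsp_instance
begin

lemma sum_out_cut: "sum f (out_cut G S) = (\<Sum>e\<in>arcs G. f e * of_bool (tail G e \<in> S \<and> head G e \<notin> S))"
  for f :: "'b \<Rightarrow> real"
  unfolding out_cut_def by (rule sum_filter_of_bool) simp

lemma sum_in_cut: "sum f (in_cut G S) = (\<Sum>e\<in>arcs G. f e * of_bool (tail G e \<notin> S \<and> head G e \<in> S))"
  for f :: "'b \<Rightarrow> real"
  unfolding in_cut_def by (rule sum_filter_of_bool) simp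

lemma cut_difference:
  "sum x (out_cut G S) - sum x (in_cut G S) =
    (\<Sum>e\<in>arcs G. x e * (of_bool (tail G e \<in> S) - of_bool (head G e \<in> S)))"
  unfolding sum_out_cut sum_in_cut sum_subtractf[symmetric]
  by (rule sum.cong) auto

text \<open>Conservation is summed over the vertices of \<open>S\<close>; edges with both ends in
  \<open>S\<close> cancel.\<close>

lemma circulation_cut:
  assumes "S \<subseteq> verts G"
  shows "sum x (out_cut G S) = sum x (in_cut G S)"
proof -
  have fin: "finite S" by (rule finite_subset[OF assms]) simp
  have ind: "of_bool (u \<in> S) = (\<Sum>v\<in>S. of_bool (u \<in> {v}) :: real)" for u
  proof -
    have "(\<Sum>v\<in>S. of_bool (u \<in> {v}) :: real) = (\<Sum>v\<in>S. if v = u then 1 else 0)"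
      by (rule sum.cong) auto
    then show ?thesis using fin by simp
  qed
  have "x e * (of_bool (tail G e \<in> S) - of_bool (head G e \<in> S)) =
      (\<Sum>v\<in>S. x e * (of_bool (tail G e \<in> {v}) - of_bool (head G e \<in> {v})))" for e
    unfolding ind[of "tail G e"] ind[of "head G e"] sum_subtractf[symmetric] by (rule sum_distrib_left)
  then have "sum x (out_cut G S) - sum x (in_cut G S) =
      (\<Sum>e\<in>arcs G. \<Sum>v\<in>S. x e * (of_bool (tail G e \<in> {v}) - of_bool (head G e \<in> {v})))"
    unfolding cut_difference by (simp only:)
  also have "\<dots> = (\<Sum>v\<in>S. sum x (out_cut G {v}) - sum x (in_cut G {v}))"
    unfolding cut_difference by (rule sum.swap)
  also have "\<dots> = 0" using x_circulation assms by (intro sum.neutral ballI) (simp add: subset_iff)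
  finally show ?thesis by simp
qed

text \<open>By balance the cut splits into two equal halves of a total of at least 2. This is what
  keeps the rerouted fraction of a part at most 1.\<close>

lemma out_cut_ge_1:
  assumes "S \<noteq> {}" "S \<subset> verts G"
  shows "1 \<le> sum x (out_cut G S)"
proof -
  have "out_cut G S \<inter> in_cut G S = {}" by (auto simp: out_cut_def in_cut_def)
  moreover have "finite (out_cut G S)" "finite (in_cut G S)"
    by (auto simp: out_cut_def in_cut_def)
  ultimately have "sum x (cut G S) = sum x (out_cut G S) + sum x (in_cut G S)"
    unfolding cut_def by (simp add: sum.union_disjoint)
  then show ?thesis using x_cut[OF assms] circulation_cut[of S] assms by auto
qed

text \<open>The edges leaving \<open>{v}\<close> are the non-loops with tail \<open>v\<close>, so
  exchanging the sums charges each of them to its tail.\<close>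

lemma sum_vertex_out_cut:
  "(\<Sum>v\<in>verts G. f v * sum x (out_cut G {v})) =
    (\<Sum>e\<in>arcs G. of_bool (tail G e \<noteq> head G e) * x e * f (tail G e))"
proof -
  have "(\<Sum>v\<in>verts G. f v * sum x (out_cut G {v})) =
      (\<Sum>e\<in>arcs G. \<Sum>v\<in>verts G. f v * (x e * of_bool (tail G e = v \<and> head G e \<noteq> v)))"
    unfolding sum_out_cut sum_distrib_left by (subst sum.swap) simp
  also have "\<dots> = (\<Sum>e\<in>arcs G. of_bool (tail G e \<noteq> head G e) * x e * f (tail G e))"
  proof (rule sum.cong)
    fix e assume "e \<in> arcs G"
    then have "tail G e \<in> verts G" by simp
    have "(\<Sum>v\<in>verts G. f v * (x e * of_bool (tail G e = v \<and> head G e \<noteq> v))) =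
        (\<Sum>v\<in>verts G. if v = tail G e then of_bool (tail G e \<noteq> head G e) * x e * f (tail G e) else 0)"
      by (rule sum.cong) auto
    then show "(\<Sum>v\<in>verts G. f v * (x e * of_bool (tail G e = v \<and> head G e \<noteq> v))) =
        of_bool (tail G e \<noteq> head G e) * x e * f (tail G e)"
      using \<open>tail G e \<in> verts G\<close> by simp
  qed simp
  finally show ?thesis .
qed

lemma sum_vertex_in_cut:
  "(\<Sum>v\<in>verts G. f v * sum x (in_cut G {v})) =
    (\<Sum>e\<in>arcs G. of_bool (tail G e \<noteq> head G e) * x e * f (head G e))"
proof -
  have "(\<Sum>v\<in>verts G. f v * sum x (in_cut G {v})) =
      (\<Sum>e\<in>arcs G. \<Sum>v\<in>verts G. f v * (x e * of_bool (tail G e \<noteq> v \<and> head G e = v)))"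
    unfolding sum_in_cut sum_distrib_left by (subst sum.swap) simp
  also have "\<dots> = (\<Sum>e\<in>arcs G. of_bool (tail G e \<noteq> head G e) * x e * f (head G e))"
  proof (rule sum.cong)
    fix e assume "e \<in> arcs G"
    then have "head G e \<in> verts G" by simp
    have "(\<Sum>v\<in>verts G. f v * (x e * of_bool (tail G e \<noteq> v \<and> head G e = v))) =
        (\<Sum>v\<in>verts G. if v = head G e then of_bool (tail G e \<noteq> head G e) * x e * f (head G e) else 0)"
      by (rule sum.cong) auto
    then show "(\<Sum>v\<in>verts G. f v * (x e * of_bool (tail G e \<noteq> v \<and> head G e = v))) =
        of_bool (tail G e \<noteq> head G e) * x e * f (head G e)"
      using \<open>head G e \<in> verts G\<close> by simp
  qed simp
  finally show ?thesis .
qed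

end

subsection \<open>The network of an encoded instance\<close>

locale spc_encoded = atsp_instance G L x y
  for G :: "(nat, nat) pre_digraph" and L x y +
  fixes B :: "nat multiset" and vs es :: "nat list" and Ls Ps :: "nat list list" and d :: data
  assumes parts: "partition_on (verts G - edge_verts G B) (set (map set Ps))"
    and distinct_parts: "distinct (map set Ps)"
    and parts_connected: "\<And>P. P \<in> set Ps \<Longrightarrow> strongly_connected (G \<restriction> set P)"
    and parts_proper: "verts G \<notin> set (map set Ps)"
    and vs: "distinct vs" "set vs = verts G"
    and es: "distinct es" "set es = arcs G"
    and Ls: "\<And>l. l \<in> set Ls \<Longrightarrow> distinct l" "set (map set Ls) = L"
    and d_verts: "input_verts d = map enc_nat vs"
    and d_edges: "input_edges d = map (\<lambda>e. enc_list id
          [enc_nat e, enc_nat (tail G e), enc_nat (head G e), enc_real (x e)]) es"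
    and d_family: "input_family d = map (\<lambda>l. Node (enc_list enc_nat l) (enc_real (y (set l)))) Ls"
    and d_parts: "input_parts d = map (enc_list enc_nat) Ps"
begin

abbreviation (input) enc_edge :: "nat \<Rightarrow> data" where
  "enc_edge e \<equiv> Node (enc_nat e) (Node (enc_nat (tail G e)) (Node (enc_nat (head G e))
     (Node (enc_real (x e)) Leaf)))"

abbreviation (input) enc_part :: "nat list \<Rightarrow> data" where "enc_part P \<equiv> enc_list enc_nat P"

lemma d_edges': "input_edges d = map (\<lambda>e. enc_edge e) es"
  using d_edges by simp

definition tight :: "nat set" where "tight = {v \<in> verts G. {v} \<in> L}"

lemma part:
  assumes "P \<in> set Ps"
  shows "set P \<subset> verts G" "set P \<noteq> {}"
  using parts parts_proper assms unfolding partition_on_def by auto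

lemma parts_disjoint: "P \<in> set Ps \<Longrightarrow> Q \<in> set Ps \<Longrightarrow> v \<in> set P \<Longrightarrow> v \<in> set Q \<Longrightarrow> P = Q"
proof -
  assume P: "P \<in> set Ps" "Q \<in> set Ps" "v \<in> set P" "v \<in> set Q"
  have "disjoint (set (map set Ps))" using parts by (rule partition_onD2)
  then have "set P = set Q" using P unfolding disjoint_def by auto
  then show "P = Q" using distinct_parts P(1,2) by (auto simp: distinct_map dest: inj_onD)
qed

lemma distinct_Ps: "distinct Ps"
  using distinct_parts by (simp add: distinct_map)

text \<open>The type is kept general because the bound serves both the real-valued fractions and the
  integer degrees.\<close>

lemma sum_parts_le_1: "(\<Sum>P\<in>set Ps. of_bool (v \<in> set P)) \<le> (1 :: 'c :: linordered_semidom)"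
proof (cases "\<exists>P\<in>set Ps. v \<in> set P")
  case True
  then obtain P where P: "P \<in> set Ps" "v \<in> set P" by blast
  have "(\<Sum>Q\<in>set Ps. of_bool (v \<in> set Q)) = (\<Sum>Q\<in>set Ps. if Q = P then 1 else (0 :: 'c))"
    using P parts_disjoint by (intro sum.cong) auto
  then show ?thesis using P by simp
next
  case False
  then have "(\<Sum>Q\<in>set Ps. of_bool (v \<in> set Q)) = (0 :: 'c)" by (intro sum.neutral) auto
  then show ?thesis by simp
qed

lemma listed_enc [simp]: "listed (enc_nat v) (enc_part P) \<longleftrightarrow> v \<in> set P"
  by (auto simp: listed_def enc_list_of_list)

lemma splits_enc [simp]: "splits d (enc_nat v) \<longleftrightarrow> {v} \<in> L"
proof
  assume "splits d (enc_nat v)"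
  then obtain l where "l \<in> set Ls" "enc_list enc_nat l = enc_list enc_nat [v]"
    unfolding splits_def d_family by auto
  then have "[v] \<in> set Ls" by (simp only: enc_nats_eq_iff)
  then have "set [v] \<in> set ` set Ls" by (rule imageI)
  then show "{v} \<in> L" using Ls(2) by simp
next
  assume "{v} \<in> L"
  then obtain l where l: "l \<in> set Ls" "set l = {v}" using Ls(2) by auto
  have "length l = card (set l)" using Ls(1)[OF l(1)] by (simp add: distinct_card)
  then have "length l = 1" using l(2) by simp
  then have "l = [v]" using l(2) by (cases l) auto
  then have "Node (enc_list enc_nat [v]) (enc_real (y {v})) \<in> set (input_family d)"
    unfolding d_family using l by force
  then show "splits d (enc_nat v)" unfolding splits_def by force
qed

lemma set_out_nodes: "set (out_nodes d (enc_edge e)) =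
    insert (out_node d (enc_nat (tail G e)))
      ((\<lambda>P. pout (enc_part P)) ` {P \<in> set Ps. tail G e \<in> set P \<and> head G e \<notin> set P})"
  by (auto simp: out_nodes_def d_parts)

lemma set_in_nodes: "set (in_nodes d (enc_edge e)) =
    insert (in_node d (enc_nat (head G e)))
      ((\<lambda>P. pin (enc_part P)) ` {P \<in> set Ps. head G e \<in> set P \<and> tail G e \<notin> set P})"
  by (auto simp: in_nodes_def d_parts)

lemma set_network: "set (to_list (network d)) =
    {mk_arc t h (enc_edge e) | t h e. e \<in> arcs G \<and> tail G e \<noteq> head G e \<and>
       t \<in> set (out_nodes d (enc_edge e)) \<and> h \<in> set (in_nodes d (enc_edge e))} \<union>
    {mk_arc (vout (enc_nat v)) (vin (enc_nat v)) Leaf | v. v \<in> tight}"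
  unfolding network_def d_verts d_edges' to_list_of_list tight_def
  by (auto simp: edge_arcs_def es(2) vs(2) split: if_splits)

lemma sources: "to_list (sources d) =
    map (\<lambda>v. vout (enc_nat v)) (filter (\<lambda>v. {v} \<in> L) vs) @ map (\<lambda>P. pout (enc_part P)) Ps"
  by (simp add: sources_def d_verts d_parts filter_map comp_def)

lemma sinks: "to_list (sinks d) =
    map (\<lambda>v. vin (enc_nat v)) (filter (\<lambda>v. {v} \<in> L) vs) @ map (\<lambda>P. pin (enc_part P)) Ps"
  by (simp add: sinks_def d_verts d_parts filter_map comp_def)

lemma set_sources: "set (to_list (sources d)) =
    (\<lambda>v. vout (enc_nat v)) ` tight \<union> (\<lambda>P. pout (enc_part P)) ` set Ps"
  by (auto simp: sources tight_def vs(2))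

lemma set_sinks: "set (to_list (sinks d)) =
    (\<lambda>v. vin (enc_nat v)) ` tight \<union> (\<lambda>P. pin (enc_part P)) ` set Ps"
  by (auto simp: sinks tight_def vs(2))

lemma finite_tight: "finite tight"
  by (simp add: tight_def)

lemma card_sources: "real (card (set (to_list (sources d)) \<inter> X)) =
    (\<Sum>v\<in>tight. of_bool (vout (enc_nat v) \<in> X)) + (\<Sum>P\<in>set Ps. of_bool (pout (enc_part P) \<in> X))"
proof -
  have "real (card (set (to_list (sources d)) \<inter> X)) = (\<Sum>n\<in>set (to_list (sources d)). of_bool (n \<in> X))"
    by simp
  also have "\<dots> = (\<Sum>n\<in>(\<lambda>v. vout (enc_nat v)) ` tight. of_bool (n \<in> X)) +
      (\<Sum>n\<in>(\<lambda>P. pout (enc_part P)) ` set Ps. of_bool (n \<in> X))"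
    unfolding set_sources using finite_tight by (intro sum.union_disjoint) auto
  also have "(\<Sum>n\<in>(\<lambda>v. vout (enc_nat v)) ` tight. of_bool (n \<in> X)) =
      (\<Sum>v\<in>tight. of_bool (vout (enc_nat v) \<in> X) :: real)"
    by (rule sum.reindex_cong[of "\<lambda>v. vout (enc_nat v)"]) (auto intro: inj_onI)
  also have "(\<Sum>n\<in>(\<lambda>P. pout (enc_part P)) ` set Ps. of_bool (n \<in> X)) =
      (\<Sum>P\<in>set Ps. of_bool (pout (enc_part P) \<in> X) :: real)"
    by (rule sum.reindex_cong[of "\<lambda>P. pout (enc_part P)"]) (auto intro: inj_onI)
  finally show ?thesis .
qed

lemma card_sinks: "real (card (set (to_list (sinks d)) \<inter> X)) =
    (\<Sum>v\<in>tight. of_bool (vin (enc_nat v) \<in> X)) + (\<Sum>P\<in>set Ps. of_bool (pin (enc_part P) \<in> X))"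
proof -
  have "real (card (set (to_list (sinks d)) \<inter> X)) = (\<Sum>n\<in>set (to_list (sinks d)). of_bool (n \<in> X))"
    by simp
  also have "\<dots> = (\<Sum>n\<in>(\<lambda>v. vin (enc_nat v)) ` tight. of_bool (n \<in> X)) +
      (\<Sum>n\<in>(\<lambda>P. pin (enc_part P)) ` set Ps. of_bool (n \<in> X))"
    unfolding set_sinks using finite_tight by (intro sum.union_disjoint) auto
  also have "(\<Sum>n\<in>(\<lambda>v. vin (enc_nat v)) ` tight. of_bool (n \<in> X)) =
      (\<Sum>v\<in>tight. of_bool (vin (enc_nat v) \<in> X) :: real)"
    by (rule sum.reindex_cong[of "\<lambda>v. vin (enc_nat v)"]) (auto intro: inj_onI)
  also have "(\<Sum>n\<in>(\<lambda>P. pin (enc_part P)) ` set Ps. of_bool (n \<in> X)) =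
      (\<Sum>P\<in>set Ps. of_bool (pin (enc_part P) \<in> X) :: real)"
    by (rule sum.reindex_cong[of "\<lambda>P. pin (enc_part P)"]) (auto intro: inj_onI)
  finally show ?thesis .
qed

text \<open>Rerouting the fraction \<open>1 / x(\<delta>\<^sup>+(P))\<close> of all flow that enters or leaves \<open>P\<close>
  through \<open>pin P\<close> and \<open>pout P\<close>, and dropping the same fraction of the flow inside \<open>P\<close>,
  turns \<open>x\<close> into a fractional transshipment. An edge whose tail side meets a closed set
  \<open>X\<close> has its whole head side in \<open>X\<close>.\<close>

lemma network_hall:
  assumes X: "closed_under (to_list (network d)) X"
  shows "card (set (to_list (sources d)) \<inter> X) \<le> card (set (to_list (sinks d)) \<inter> X)"
proof -
  define c where "c P = 1 / sum x (out_cut G (set P))" for P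
  \<comment> \<open>The share of the visits of \<open>v\<close> that is rerouted or dropped:
    \<open>c P\<close> if \<open>v\<close> lies in the part \<open>P\<close>, and 0 outside all
    parts.\<close>
  define lam where "lam v = (\<Sum>P\<in>set Ps. of_bool (v \<in> set P) * c P)" for v
  define ov where "ov v = (of_bool (out_node d (enc_nat v) \<in> X) :: real)" for v
  define iv where "iv v = (of_bool (in_node d (enc_nat v) \<in> X) :: real)" for v
  define op where "op P = (of_bool (pout (enc_part P) \<in> X) :: real)" for P
  define ip where "ip P = (of_bool (pin (enc_part P) \<in> X) :: real)" for P
  \<comment> \<open>\<open>ro e\<close> and \<open>ri e\<close> are the shares of the flow on
    \<open>e\<close> whose tail node, respectively head node, lies in \<open>X\<close>. The first
    summand is the original end, the second the auxiliary one.\<close>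
  define ro where "ro e = (1 - lam (tail G e)) * ov (tail G e) +
    (\<Sum>P\<in>set Ps. of_bool (tail G e \<in> set P \<and> head G e \<notin> set P) * c P * op P)" for e
  define ri where "ri e = (1 - lam (head G e)) * iv (head G e) +
    (\<Sum>P\<in>set Ps. of_bool (tail G e \<notin> set P \<and> head G e \<in> set P) * c P * ip P)" for e
  have c: "0 \<le> c P" "c P \<le> 1" "c P * sum x (out_cut G (set P)) = 1"
    "c P * sum x (in_cut G (set P)) = 1" if "P \<in> set Ps" for P
    using out_cut_ge_1[of "set P"] part[OF that] circulation_cut[of "set P"] unfolding c_def by auto
  have "lam v \<le> (\<Sum>P\<in>set Ps. of_bool (v \<in> set P))" for v
    unfolding lam_def by (intro sum_mono) (use c in auto)
  then have lam1: "lam v \<le> 1" for v using sum_parts_le_1[of v] by (rule order_trans)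
  have lam0: "0 \<le> lam v" for v unfolding lam_def by (intro sum_nonneg) (use c in auto)
  have bounds: "0 \<le> ov v" "ov v \<le> 1" "0 \<le> iv v" "0 \<le> op P" "op P \<le> 1" "0 \<le> ip P" for v P
    by (simp_all add: ov_def iv_def op_def ip_def)
  have edge: "ro e \<le> ri e" if e: "e \<in> arcs G" "tail G e \<noteq> head G e" for e
  proof (cases "\<exists>t\<in>set (out_nodes d (enc_edge e)). t \<in> X")
    case True
    then obtain t where t: "t \<in> set (out_nodes d (enc_edge e))" "t \<in> X" by blast
    have all: "h \<in> X" if "h \<in> set (in_nodes d (enc_edge e))" for h
    proof -
      have "mk_arc t h (enc_edge e) \<in> set (to_list (network d))"
        unfolding set_network using t that e by blast
      then show ?thesis using X t(2) unfolding closed_under_def by force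
    qed
    have "ro e \<le> (1 - lam (tail G e)) * 1 +
        (\<Sum>P\<in>set Ps. of_bool (tail G e \<in> set P \<and> head G e \<notin> set P) * c P * 1)"
      unfolding ro_def using lam1 bounds c by (intro add_mono sum_mono mult_left_mono) auto
    \<comment> \<open>Tail side and head side carry the same total: everything except what is
      dropped when both ends lie in the same part.\<close>
    also have "\<dots> = 1 - (\<Sum>P\<in>set Ps. of_bool (tail G e \<in> set P \<and> head G e \<in> set P) * c P)"
    proof -
      have "(\<Sum>P\<in>set Ps. of_bool (tail G e \<in> set P \<and> head G e \<notin> set P) * c P * 1) =
          lam (tail G e) - (\<Sum>P\<in>set Ps. of_bool (tail G e \<in> set P \<and> head G e \<in> set P) * c P)"
        unfolding lam_def sum_subtractf[symmetric] by (rule sum.cong) auto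
      then show ?thesis by simp
    qed
    also have "\<dots> = (1 - lam (head G e)) * 1 +
        (\<Sum>P\<in>set Ps. of_bool (tail G e \<notin> set P \<and> head G e \<in> set P) * c P)"
    proof -
      have "(\<Sum>P\<in>set Ps. of_bool (tail G e \<notin> set P \<and> head G e \<in> set P) * c P) =
          lam (head G e) - (\<Sum>P\<in>set Ps. of_bool (tail G e \<in> set P \<and> head G e \<in> set P) * c P)"
        unfolding lam_def sum_subtractf[symmetric] by (rule sum.cong) auto
      then show ?thesis by simp
    qed
    also have "\<dots> = ri e"
    proof -
      have "iv (head G e) = 1" unfolding iv_def using all by (simp add: set_in_nodes)
      moreover have "of_bool (tail G e \<notin> set P \<and> head G e \<in> set P) * c P =
          of_bool (tail G e \<notin> set P \<and> head G e \<in> set P) * c P * ip P" if "P \<in> set Ps" for P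
        unfolding ip_def using all that by (auto simp: set_in_nodes)
      then have "(\<Sum>P\<in>set Ps. of_bool (tail G e \<notin> set P \<and> head G e \<in> set P) * c P) =
          (\<Sum>P\<in>set Ps. of_bool (tail G e \<notin> set P \<and> head G e \<in> set P) * c P * ip P)"
        by (rule sum.cong[OF refl])
      ultimately show ?thesis unfolding ri_def by simp
    qed
    finally show ?thesis .
  next
    case False
    then have "ov (tail G e) = 0" by (auto simp: ov_def set_out_nodes)
    moreover have "of_bool (tail G e \<in> set P \<and> head G e \<notin> set P) * c P * op P = 0"
      if "P \<in> set Ps" for P using False that by (auto simp: op_def set_out_nodes)
    then have "(\<Sum>P\<in>set Ps. of_bool (tail G e \<in> set P \<and> head G e \<notin> set P) * c P * op P) = 0"
      by (intro sum.neutral ballI)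
    ultimately have "ro e = 0" unfolding ro_def by simp
    moreover have "0 \<le> ri e"
      unfolding ri_def using lam1 bounds c
      by (intro add_nonneg_nonneg sum_nonneg mult_nonneg_nonneg) auto
    ultimately show ?thesis by simp
  qed
  have "(\<Sum>e\<in>arcs G. of_bool (tail G e \<noteq> head G e) * x e * ro e) =
      (\<Sum>v\<in>verts G. (1 - lam v) * ov v * sum x (out_cut G {v})) + (\<Sum>P\<in>set Ps. op P)"
  proof -
    \<comment> \<open>\<open>c P\<close> is chosen so that exactly one unit leaves through
      \<open>pout P\<close>.\<close>
    have "(\<Sum>P\<in>set Ps. op P) = (\<Sum>P\<in>set Ps. c P * op P * sum x (out_cut G (set P)))"
      using c(3) by (intro sum.cong) (auto simp: algebra_simps)
    also have "\<dots> = (\<Sum>e\<in>arcs G. of_bool (tail G e \<noteq> head G e) * x e *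
        (\<Sum>P\<in>set Ps. of_bool (tail G e \<in> set P \<and> head G e \<notin> set P) * c P * op P))"
      unfolding sum_out_cut sum_distrib_left by (subst sum.swap) (intro sum.cong refl, auto)
    finally show ?thesis
      unfolding ro_def sum_vertex_out_cut by (simp add: distrib_left sum.distrib mult.assoc)
  qed
  moreover have "(\<Sum>e\<in>arcs G. of_bool (tail G e \<noteq> head G e) * x e * ri e) =
      (\<Sum>v\<in>verts G. (1 - lam v) * iv v * sum x (in_cut G {v})) + (\<Sum>P\<in>set Ps. ip P)"
  proof -
    have "(\<Sum>P\<in>set Ps. ip P) = (\<Sum>P\<in>set Ps. c P * ip P * sum x (in_cut G (set P)))"
      using c(4) by (intro sum.cong) (auto simp: algebra_simps)
    also have "\<dots> = (\<Sum>e\<in>arcs G. of_bool (tail G e \<noteq> head G e) * x e *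
        (\<Sum>P\<in>set Ps. of_bool (tail G e \<notin> set P \<and> head G e \<in> set P) * c P * ip P))"
      unfolding sum_in_cut sum_distrib_left by (subst sum.swap) (intro sum.cong refl, auto)
    finally show ?thesis
      unfolding ri_def sum_vertex_in_cut by (simp add: distrib_left sum.distrib mult.assoc)
  qed
  moreover have "(\<Sum>e\<in>arcs G. of_bool (tail G e \<noteq> head G e) * x e * ro e) \<le>
      (\<Sum>e\<in>arcs G. of_bool (tail G e \<noteq> head G e) * x e * ri e)"
  proof (rule sum_mono)
    fix e assume "e \<in> arcs G"
    then show "of_bool (tail G e \<noteq> head G e) * x e * ro e \<le> of_bool (tail G e \<noteq> head G e) * x e * ri e"
      using edge[of e] x_pos[of e] by (cases "tail G e = head G e") auto
  qed
  moreover have "(\<Sum>v\<in>tight. ov v - iv v) \<le>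
      (\<Sum>v\<in>verts G. (1 - lam v) * ov v * sum x (out_cut G {v})) -
      (\<Sum>v\<in>verts G. (1 - lam v) * iv v * sum x (in_cut G {v}))"
  proof -
    have "(\<Sum>v\<in>tight. ov v - iv v) = (\<Sum>v\<in>verts G. (ov v - iv v) * of_bool ({v} \<in> L))"
      unfolding tight_def by (rule sum_filter_of_bool) simp
    also have "\<dots> \<le> (\<Sum>v\<in>verts G. (1 - lam v) * ov v * sum x (out_cut G {v}) -
        (1 - lam v) * iv v * sum x (in_cut G {v}))"
    proof (rule sum_mono)
      fix v assume v: "v \<in> verts G"
      show "(ov v - iv v) * of_bool ({v} \<in> L) \<le>
          (1 - lam v) * ov v * sum x (out_cut G {v}) - (1 - lam v) * iv v * sum x (in_cut G {v})"
      proof (cases "{v} \<in> L")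
        case True
        then have "mk_arc (vout (enc_nat v)) (vin (enc_nat v)) Leaf \<in> set (to_list (network d))"
          unfolding set_network using v by (auto simp: tight_def)
        then have "ov v \<le> iv v"
          using X True unfolding closed_under_def ov_def iv_def out_node_def in_node_def by force
        \<comment> \<open>The idle arc absorbs the share \<open>lam v\<close> of the unit at
          \<open>v\<close>. Closure of \<open>X\<close> under this arc makes the difference
          nonpositive, so scaling it by \<open>1 - lam v\<close> can only increase it.\<close>
        then have "ov v - iv v \<le> (1 - lam v) * (ov v - iv v)"
          using lam0[of v] mult_nonneg_nonpos[of "lam v" "ov v - iv v"] by (simp add: algebra_simps)
        then show ?thesis using True L_tight[OF True] by (simp add: algebra_simps)
      next
        case False
        \<comment> \<open>An unsplit vertex has the same node on both sides, so its contributions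
          cancel by conservation.\<close>
        then show ?thesis using x_circulation[OF v]
          by (simp add: ov_def iv_def out_node_def in_node_def)
      qed
    qed
    finally show ?thesis by (simp add: sum_subtractf)
  qed
  ultimately have "(\<Sum>v\<in>tight. ov v - iv v) + (\<Sum>P\<in>set Ps. op P) \<le> (\<Sum>P\<in>set Ps. ip P)" by linarith
  moreover have "ov v = of_bool (vout (enc_nat v) \<in> X)" "iv v = of_bool (vin (enc_nat v) \<in> X)"
    if "v \<in> tight" for v using that by (auto simp: ov_def iv_def out_node_def in_node_def tight_def)
  ultimately have "real (card (set (to_list (sources d)) \<inter> X)) \<le> real (card (set (to_list (sinks d)) \<inter> X))"
    unfolding card_sources card_sinks op_def ip_def by (simp add: sum_subtractf)
  then show ?thesis by simp
qed

sublocale transshipment "network d" "sources d" "sinks d"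
proof
  show "distinct (to_list (sources d))" "distinct (to_list (sinks d))"
    using vs(1) distinct_Ps by (auto simp: sources sinks distinct_map inj_on_def)
  show "set (to_list (sources d)) \<inter> set (to_list (sinks d)) = {}"
    unfolding set_sources set_sinks by auto
  show "atail a \<notin> set (to_list (sinks d))" if "a \<in> set (to_list (network d))" for a
    using that unfolding set_network set_sinks set_out_nodes by (auto simp: out_node_def split: if_splits)
qed (rule network_hall)

lemma length_sources: "length (to_list (sources d)) = length (to_list (sinks d))"
  by (simp add: sources sinks)

end

subsection \<open>The output\<close>

lemma int_length_filter: "int (length (filter Q xs)) = (\<Sum>a\<leftarrow>xs. of_bool (Q a))"
  by (induction xs) auto

lemma size_filter_mset: "int (size {#e \<in># mset xs. Q e#}) = (\<Sum>e\<leftarrow>xs. of_bool (Q e))"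
  using int_length_filter[of Q xs] by (simp flip: mset_filter)

lemma excess_sum_list:
  "excess (mset xs) n = (\<Sum>a\<leftarrow>xs. of_bool (atail a = n)) - (\<Sum>a\<leftarrow>xs. of_bool (ahead a = n))"
  by (induction xs) auto

lemma sum_list_partition:
  "(\<Sum>a\<leftarrow>xs. f a) = (\<Sum>a\<leftarrow>filter K xs. f a) + (\<Sum>a\<leftarrow>filter (\<lambda>a. \<not> K a) xs. f a)"
  for f :: "'a \<Rightarrow> int"
  by (induction xs) auto

lemma sum_list_sum_swap:
  "(\<Sum>a\<leftarrow>xs. \<Sum>p\<in>A. f a p) = (\<Sum>p\<in>A. \<Sum>a\<leftarrow>xs. f a p)" for f :: "'a \<Rightarrow> 'b \<Rightarrow> int"
  by (induction xs) (auto simp: sum.distrib)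

lemma sum_list_concat_map:
  "(\<Sum>a\<leftarrow>concat (map g ps). f a) = (\<Sum>p\<leftarrow>ps. \<Sum>a\<leftarrow>g p. f a)" for f :: "'a \<Rightarrow> int"
  by (induction ps) auto

lemma sum_list_cong: "(\<And>a. a \<in> set xs \<Longrightarrow> f a = g a) \<Longrightarrow> (\<Sum>a\<leftarrow>xs. f a) = (\<Sum>a\<leftarrow>xs. g a)"
  by (metis map_eq_conv)

lemma sum_list_unique:
  assumes "(\<Sum>a\<leftarrow>xs. of_bool (Q a)) = (1 :: int)" "b \<in> set xs" "Q b"
  shows "(\<Sum>a\<leftarrow>xs. of_bool (Q a \<and> R a)) = (of_bool (R b) :: int)"
proof -
  have "length (filter Q xs) = 1" using assms(1) int_length_filter[of Q xs] by simp
  then obtain c where c: "filter Q xs = [c]" by (auto simp: length_Suc_conv)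
  have "b \<in> set (filter Q xs)" using assms(2,3) by simp
  then have "c = b" using c by simp
  have "(\<Sum>a\<leftarrow>xs. of_bool (Q a \<and> R a)) = (\<Sum>a\<leftarrow>filter Q xs. of_bool (R a) :: int)"
    by (induction xs) auto
  then show ?thesis using c \<open>c = b\<close> by simp
qed

lemma sum_list_distinct:
  "distinct (map f xs) \<Longrightarrow> (\<Sum>a\<leftarrow>xs. of_bool (f a = c)) = (of_bool (c \<in> f ` set xs) :: int)"
  by (induction xs) auto

context spc_encoded
begin

definition flow :: "data list" where
  "flow = to_list (transship (network d) (sources d) (sinks d))"

definition used :: "data list" where
  "used = filter (\<lambda>a. alabel a \<noteq> Leaf) flow"

definition edge_of :: "data \<Rightarrow> nat" where
  "edge_of a = inv enc_nat (ename (alabel a))"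

definition part_path :: "nat list \<Rightarrow> data list" where
  "part_path P = to_list (connection d (of_list flow) (enc_part P))"

definition solution :: "nat list" where
  "solution = map edge_of used @ concat (map (\<lambda>P. map edge_of (part_path P)) Ps)"

lemma edge_of_simp [simp]: "edge_of (mk_arc t h (enc_edge e)) = e"
  using inj_enc_nat by (simp add: edge_of_def)

lemma flow_network: "set flow \<subseteq> set (to_list (network d))"
  unfolding flow_def by (rule transship(1)[OF length_sources])

lemma excess_flow:
  "excess (mset flow) n = of_bool (n \<in> set (to_list (sources d))) - of_bool (n \<in> set (to_list (sinks d)))"
  unfolding flow_def by (rule transship(2)[OF length_sources])

lemma flow_cases:
  assumes "a \<in> set flow"
  obtains (edge) e t h where "a = mk_arc t h (enc_edge e)" "e \<in> arcs G" "tail G e \<noteq> head G e"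
      "t \<in> set (out_nodes d (enc_edge e))" "h \<in> set (in_nodes d (enc_edge e))"
  | (loop) v where "a = mk_arc (vout (enc_nat v)) (vin (enc_nat v)) Leaf" "v \<in> tight"
proof -
  have "a \<in> set (to_list (network d))" using assms flow_network by auto
  then show thesis unfolding set_network using edge loop by auto
qed

lemma used_cases:
  assumes "a \<in> set used"
  obtains e t h where "a = mk_arc t h (enc_edge e)" "e \<in> arcs G" "tail G e \<noteq> head G e"
      "t \<in> set (out_nodes d (enc_edge e))" "h \<in> set (in_nodes d (enc_edge e))"
proof -
  have "a \<in> set flow" "alabel a \<noteq> Leaf" using assms by (auto simp: used_def)
  then show thesis using that by (cases rule: flow_cases) auto
qed

section \<open>Degrees of the flow at the nodes of the network\<close>

lemma source_no_head:
  assumes "a \<in> set flow" "n \<in> set (to_list (sources d))"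
  shows "ahead a \<noteq> n"
  using assms(1)
  by (cases rule: flow_cases)
    (use assms(2) in \<open>auto simp: set_sources set_in_nodes in_node_def split: if_splits\<close>)

lemma sink_no_tail:
  assumes "a \<in> set flow" "n \<in> set (to_list (sinks d))"
  shows "atail a \<noteq> n"
  using sink[of a] assms flow_network by auto

text \<open>No arc enters a source, so its net outflow 1 is its number of leaving arcs.\<close>

lemma source_count:
  assumes "n \<in> set (to_list (sources d))"
  shows "(\<Sum>a\<leftarrow>flow. of_bool (atail a = n)) = (1 :: int)"
proof -
  have "(\<Sum>a\<leftarrow>flow. of_bool (ahead a = n)) = (\<Sum>a\<leftarrow>flow. 0 :: int)"
    by (rule sum_list_cong) (use source_no_head assms in auto)
  moreover have "n \<notin> set (to_list (sinks d))" using assms disjoint by auto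
  ultimately show ?thesis using excess_flow[of n] assms by (simp add: excess_sum_list)
qed

lemma sink_count:
  assumes "n \<in> set (to_list (sinks d))"
  shows "(\<Sum>a\<leftarrow>flow. of_bool (ahead a = n)) = (1 :: int)"
proof -
  have "(\<Sum>a\<leftarrow>flow. of_bool (atail a = n)) = (\<Sum>a\<leftarrow>flow. 0 :: int)"
    by (rule sum_list_cong) (use sink_no_tail assms in auto)
  moreover have "n \<notin> set (to_list (sources d))" using assms disjoint by auto
  ultimately show ?thesis using excess_flow[of n] assms by (simp add: excess_sum_list)
qed

lemma out_node_eq_iff [simp]: "out_node d (enc_nat u) = out_node d (enc_nat v) \<longleftrightarrow> u = v"
  by (auto simp: out_node_def)

lemma in_node_eq_iff [simp]: "in_node d (enc_nat u) = in_node d (enc_nat v) \<longleftrightarrow> u = v"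
  by (auto simp: in_node_def)

lemma out_node_neq [simp]: "out_node d u \<noteq> pout P" "pout P \<noteq> out_node d u"
  by (auto simp: out_node_def)

lemma in_node_neq [simp]: "in_node d u \<noteq> pin P" "pin P \<noteq> in_node d u"
  by (auto simp: in_node_def)

text \<open>An arc starts either at the node of the original tail of its edge or at the auxiliary
  source of exactly one part, so the two kinds of departures from \<open>v\<close> can be counted
  separately.\<close>

lemma tail_split:
  assumes "a \<in> set used"
  shows "of_bool (tail G (edge_of a) = v) = of_bool (atail a = out_node d (enc_nat v)) +
    (\<Sum>P\<in>set Ps. of_bool (atail a = pout (enc_part P) \<and> tail G (edge_of a) = v) :: int)"
  using assms
proof (cases rule: used_cases)
  case (1 e t h)
  show ?thesis
  proof (cases "t = out_node d (enc_nat (tail G e))")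
    case True
    then show ?thesis using 1(1) by simp
  next
    case False
    then obtain Q where Q: "Q \<in> set Ps" "t = pout (enc_part Q)" using 1(4) by (auto simp: set_out_nodes)
    have "(\<Sum>P\<in>set Ps. of_bool (t = pout (enc_part P) \<and> tail G e = v) :: int) =
        (\<Sum>P\<in>set Ps. if P = Q then of_bool (tail G e = v) else 0)"
      using Q(2) by (intro sum.cong) auto
    also have "\<dots> = of_bool (tail G e = v)" using Q(1) by simp
    finally show ?thesis using 1(1) Q(2) by simp
  qed
qed

lemma head_split:
  assumes "a \<in> set used"
  shows "of_bool (head G (edge_of a) = v) = of_bool (ahead a = in_node d (enc_nat v)) +
    (\<Sum>P\<in>set Ps. of_bool (ahead a = pin (enc_part P) \<and> head G (edge_of a) = v) :: int)"
  using assms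
proof (cases rule: used_cases)
  case (1 e t h)
  show ?thesis
  proof (cases "h = in_node d (enc_nat (head G e))")
    case True
    then show ?thesis using 1(1) by simp
  next
    case False
    then obtain Q where Q: "Q \<in> set Ps" "h = pin (enc_part Q)" using 1(5) by (auto simp: set_in_nodes)
    have "(\<Sum>P\<in>set Ps. of_bool (h = pin (enc_part P) \<and> head G e = v) :: int) =
        (\<Sum>P\<in>set Ps. if P = Q then of_bool (head G e = v) else 0)"
      using Q(2) by (intro sum.cong) auto
    also have "\<dots> = of_bool (head G e = v)" using Q(1) by simp
    finally show ?thesis using 1(1) Q(2) by simp
  qed
qed

text \<open>In the whole flow both counts agree, either as the single unit of a source and a sink or
  by zero excess at an unsplit vertex. An idle arc contributes equally to both counts, so removing
  the idle arcs keeps the equality and can only lower the counts.\<close>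

lemma node_balance:
  "(\<Sum>a\<leftarrow>used. of_bool (atail a = out_node d (enc_nat v))) =
   (\<Sum>a\<leftarrow>used. of_bool (ahead a = in_node d (enc_nat v)) :: int)" (is ?balance)
  and node_in_le: "v \<in> tight \<Longrightarrow> (\<Sum>a\<leftarrow>used. of_bool (ahead a = in_node d (enc_nat v)) :: int) \<le> 1"
proof -
  let ?idle = "filter (\<lambda>a. \<not> alabel a \<noteq> Leaf) flow"
  have idle: "(\<Sum>a\<leftarrow>?idle. of_bool (atail a = out_node d (enc_nat v))) =
      (\<Sum>a\<leftarrow>?idle. of_bool (ahead a = in_node d (enc_nat v)) :: int)"
  proof (rule sum_list_cong)
    fix a assume "a \<in> set ?idle"
    then have "a \<in> set flow" "alabel a = Leaf" by auto
    then obtain w where "a = mk_arc (vout (enc_nat w)) (vin (enc_nat w)) Leaf" "w \<in> tight"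
      by (cases rule: flow_cases) auto
    then show "of_bool (atail a = out_node d (enc_nat v)) = (of_bool (ahead a = in_node d (enc_nat v)) :: int)"
      by (auto simp: out_node_def in_node_def)
  qed
  have part: "(\<Sum>a\<leftarrow>flow. f a) = (\<Sum>a\<leftarrow>used. f a) + (\<Sum>a\<leftarrow>?idle. f a)" for f :: "data \<Rightarrow> int"
    unfolding used_def by (rule sum_list_partition)
  have all: "(\<Sum>a\<leftarrow>flow. of_bool (atail a = out_node d (enc_nat v))) =
      (\<Sum>a\<leftarrow>flow. of_bool (ahead a = in_node d (enc_nat v)) :: int) \<and>
      (v \<in> tight \<longrightarrow> (\<Sum>a\<leftarrow>flow. of_bool (ahead a = in_node d (enc_nat v)) :: int) = 1)"
  proof (cases "{v} \<in> L")
    case True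
    then have v: "v \<in> tight" using L_subsets[OF True] by (auto simp: tight_def)
    have o: "out_node d (enc_nat v) = vout (enc_nat v)" "in_node d (enc_nat v) = vin (enc_nat v)"
      using True by (auto simp: out_node_def in_node_def)
    have "vout (enc_nat v) \<in> set (to_list (sources d))" "vin (enc_nat v) \<in> set (to_list (sinks d))"
      using v by (auto simp: set_sources set_sinks)
    then show ?thesis unfolding o using source_count sink_count by simp
  next
    case False
    then have o: "out_node d (enc_nat v) = vmid (enc_nat v)" "in_node d (enc_nat v) = vmid (enc_nat v)"
      by (auto simp: out_node_def in_node_def)
    have "excess (mset flow) (vmid (enc_nat v)) = 0"
      unfolding excess_flow by (auto simp: set_sources set_sinks)
    then show ?thesis unfolding o using False by (simp add: excess_sum_list tight_def)
  qed
  show ?balance using all idle unfolding part by linarith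
  have "0 \<le> (\<Sum>a\<leftarrow>?idle. of_bool (ahead a = in_node d (enc_nat v)) :: int)"
    by (rule sum_list_nonneg) auto
  then show "v \<in> tight \<Longrightarrow> (\<Sum>a\<leftarrow>used. of_bool (ahead a = in_node d (enc_nat v)) :: int) \<le> 1"
    using all unfolding part by linarith
qed

section \<open>Turning a visit of a part into a path inside it\<close>

definition part_entry :: "nat list \<Rightarrow> nat" where
  "part_entry P = inv enc_nat (entry (of_list flow) (enc_part P))"

definition part_exit :: "nat list \<Rightarrow> nat" where
  "part_exit P = inv enc_nat (exit_of (of_list flow) (enc_part P))"

lemma sum_used:
  assumes "\<And>a. a \<in> set flow \<Longrightarrow> alabel a = Leaf \<Longrightarrow> f a = 0"
  shows "(\<Sum>a\<leftarrow>used. f a) = (\<Sum>a\<leftarrow>flow. f a :: int)"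
  unfolding used_def by (rule sum_list_map_filter) (use assms in auto)

text \<open>The demand of \<open>pin P\<close> is one unit, so the arc picked is the only one that
  enters it. Idle arcs never end there, so the count over \<open>used\<close> equals that over the
  flow.\<close>

lemma part_entry:
  assumes P: "P \<in> set Ps"
  shows "enc_nat (part_entry P) = entry (of_list flow) (enc_part P)" "part_entry P \<in> set P"
    and "(\<Sum>a\<leftarrow>used. of_bool (ahead a = pin (enc_part P) \<and> head G (edge_of a) = v)) =
      (of_bool (part_entry P = v) :: int)"
proof -
  let ?Q = "\<lambda>a. ahead a = pin (enc_part P)"
  define b where "b = pick ?Q flow"
  have one: "(\<Sum>a\<leftarrow>flow. of_bool (?Q a)) = (1 :: int)"
    using P by (intro sink_count) (auto simp: set_sinks)
  have "\<exists>a\<in>set flow. ?Q a"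
  proof (rule ccontr)
    assume "\<not> ?thesis"
    then have "(\<Sum>a\<leftarrow>flow. of_bool (?Q a)) = (\<Sum>a\<leftarrow>flow. 0 :: int)" by (intro sum_list_cong) auto
    then show False using one by simp
  qed
  then have b: "b \<in> set flow" "?Q b"
    using pick[where xs = flow and P = ?Q] unfolding b_def by simp_all
  from b(1) obtain e t h where e: "b = mk_arc t h (enc_edge e)"
      "h \<in> set (in_nodes d (enc_edge e))"
    using b(2) by (cases rule: flow_cases) auto
  then have "h = pin (enc_part P)" using b(2) by simp
  then have "head G e \<in> set P" using e(2) by (auto simp: set_in_nodes)
  have en: "entry (of_list flow) (enc_part P) = enc_nat (head G e)"
    unfolding entry_def to_list_of_list b_def[symmetric] using e(1) by simp
  then have pe: "part_entry P = head G e" using inj_enc_nat by (simp add: part_entry_def)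
  then show "enc_nat (part_entry P) = entry (of_list flow) (enc_part P)" "part_entry P \<in> set P"
    using en \<open>head G e \<in> set P\<close> by simp_all
  have "(\<Sum>a\<leftarrow>used. of_bool (?Q a \<and> head G (edge_of a) = v)) =
      (\<Sum>a\<leftarrow>flow. of_bool (?Q a \<and> head G (edge_of a) = v) :: int)"
  proof (rule sum_used)
    fix a assume "a \<in> set flow" "alabel a = Leaf"
    then show "of_bool (?Q a \<and> head G (edge_of a) = v) = (0 :: int)"
      by (cases rule: flow_cases) auto
  qed
  also have "\<dots> = of_bool (head G (edge_of b) = v)" by (rule sum_list_unique[OF one b])
  finally show "(\<Sum>a\<leftarrow>used. of_bool (?Q a \<and> head G (edge_of a) = v)) = (of_bool (part_entry P = v) :: int)"
    using pe e(1) by simp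
qed

text \<open>The same for the supply of \<open>pout P\<close>. The arc found there is labelled by an
  edge that leaves \<open>P\<close>, which is the edge that makes the output cover this
  part.\<close>

lemma part_exit:
  assumes P: "P \<in> set Ps"
  shows "enc_nat (part_exit P) = exit_of (of_list flow) (enc_part P)" "part_exit P \<in> set P"
    and "(\<Sum>a\<leftarrow>used. of_bool (atail a = pout (enc_part P) \<and> tail G (edge_of a) = v)) =
      (of_bool (part_exit P = v) :: int)"
    and "\<exists>e\<in>edge_of ` set used. tail G e \<in> set P \<and> head G e \<notin> set P"
proof -
  let ?Q = "\<lambda>a. atail a = pout (enc_part P)"
  define b where "b = pick ?Q flow"
  have one: "(\<Sum>a\<leftarrow>flow. of_bool (?Q a)) = (1 :: int)"
    using P by (intro source_count) (auto simp: set_sources)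
  have "\<exists>a\<in>set flow. ?Q a"
  proof (rule ccontr)
    assume "\<not> ?thesis"
    then have "(\<Sum>a\<leftarrow>flow. of_bool (?Q a)) = (\<Sum>a\<leftarrow>flow. 0 :: int)" by (intro sum_list_cong) auto
    then show False using one by simp
  qed
  then have b: "b \<in> set flow" "?Q b"
    using pick[where xs = flow and P = ?Q] unfolding b_def by simp_all
  from b(1) obtain e t h where e: "b = mk_arc t h (enc_edge e)"
      "t \<in> set (out_nodes d (enc_edge e))"
    using b(2) by (cases rule: flow_cases) auto
  then have "t = pout (enc_part P)" using b(2) by simp
  then have eP: "tail G e \<in> set P" "head G e \<notin> set P" using e(2) by (auto simp: set_out_nodes)
  have en: "exit_of (of_list flow) (enc_part P) = enc_nat (tail G e)"
    unfolding exit_of_def to_list_of_list b_def[symmetric] using e(1) by simp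
  then have pe: "part_exit P = tail G e" using inj_enc_nat by (simp add: part_exit_def)
  then show "enc_nat (part_exit P) = exit_of (of_list flow) (enc_part P)" "part_exit P \<in> set P"
    using en eP by simp_all
  have "(\<Sum>a\<leftarrow>used. of_bool (?Q a \<and> tail G (edge_of a) = v)) =
      (\<Sum>a\<leftarrow>flow. of_bool (?Q a \<and> tail G (edge_of a) = v) :: int)"
  proof (rule sum_used)
    fix a assume "a \<in> set flow" "alabel a = Leaf"
    then show "of_bool (?Q a \<and> tail G (edge_of a) = v) = (0 :: int)"
      by (cases rule: flow_cases) auto
  qed
  also have "\<dots> = of_bool (tail G (edge_of b) = v)" by (rule sum_list_unique[OF one b])
  finally show "(\<Sum>a\<leftarrow>used. of_bool (?Q a \<and> tail G (edge_of a) = v)) = (of_bool (part_exit P = v) :: int)"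
    using pe e(1) by simp
  have "b \<in> set used" using b(1) e(1) by (simp add: used_def)
  moreover have "edge_of b = e" using e(1) by simp
  ultimately show "\<exists>e\<in>edge_of ` set used. tail G e \<in> set P \<and> head G e \<notin> set P"
    using eP by blast
qed

lemma set_inner_arcs: "set (to_list (inner_arcs d (enc_part P))) =
    (\<lambda>e. mk_arc (enc_nat (tail G e)) (enc_nat (head G e)) (enc_edge e)) `
      {e \<in> arcs G. tail G e \<in> set P \<and> head G e \<in> set P}"
proof -
  have "to_list (inner_arcs d (enc_part P)) =
      map (\<lambda>e. mk_arc (enc_nat (tail G e)) (enc_nat (head G e)) (enc_edge e))
        (filter (\<lambda>e. tail G e \<in> set P \<and> head G e \<in> set P) es)"
    by (simp add: inner_arcs_def d_edges' filter_map comp_def)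
  then show ?thesis by (simp add: es(2))
qed

text \<open>Strong connectivity of the part gives a walk from entry to exit inside \<open>P\<close>;
  the set met by the search is closed under inner arcs, so it contains the exit.\<close>

lemma part_path:
  assumes P: "P \<in> set Ps"
  shows "walk (enc_nat (part_entry P)) (part_path P) (enc_nat (part_exit P))"
    and "distinct (map (\<lambda>a. ahead a) (part_path P))"
    and "enc_nat (part_entry P) \<notin> (\<lambda>a. ahead a) ` set (part_path P)"
    and "set (part_path P) \<subseteq> set (to_list (inner_arcs d (enc_part P)))"
proof -
  define A s R where "A = inner_arcs d (enc_part P)" and "s = enc_nat (part_entry P)"
    and "R = search A s"
  have R: "arborescence s R" "set (to_list R) \<subseteq> set (to_list A)"
    "closed_under (to_list A) {n. reached s R n}"
    unfolding R_def by (rule search)+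
  have reach: "reached s R (enc_nat v)"
    if "(part_entry P, v) \<in> rtrancl_on (set P) (arcs_ends (G \<restriction> set P))" for v
    using that
  proof (induction rule: rtrancl_on_induct)
    case base
    then show ?case by (simp add: s_def reached_def)
  next
    case (step u v)
    from step(2) obtain e where e: "e \<in> arcs (G \<restriction> set P)" "u = tail G e" "v = head G e"
      by (auto simp: arcs_ends_def arc_to_ends_def)
    then have "mk_arc (enc_nat u) (enc_nat v) (enc_edge e) \<in> set (to_list A)"
      unfolding A_def set_inner_arcs by (auto simp: induce_subgraph_arcs)
    then show ?case using R(3) step.IH unfolding closed_under_def by force
  qed
  have r: "reached s R (enc_nat (part_exit P))"
    using parts_connected[OF P] part_entry(2)[OF P] part_exit(2)[OF P]
    unfolding strongly_connected_def reachable_def by (intro reach) simp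
  have pp: "part_path P = to_list (path_to R (enc_nat (part_exit P)))"
    using part_entry(1)[OF P] part_exit(1)[OF P]
    by (simp add: part_path_def connection_def A_def R_def s_def)
  show "walk (enc_nat (part_entry P)) (part_path P) (enc_nat (part_exit P))"
    and "distinct (map (\<lambda>a. ahead a) (part_path P))"
    and "enc_nat (part_entry P) \<notin> (\<lambda>a. ahead a) ` set (part_path P)"
    unfolding pp s_def[symmetric] by (rule path_to[OF R(1) r])+
  show "set (part_path P) \<subseteq> set (to_list (inner_arcs d (enc_part P)))"
    using path_to(4)[OF R(1) r] R(2) unfolding pp A_def by simp
qed

lemma part_path_arc:
  assumes "P \<in> set Ps" "a \<in> set (part_path P)"
  shows "edge_of a \<in> arcs G" "enc_nat (edge_of a) = ename (alabel a)"
    "atail a = enc_nat (tail G (edge_of a))" "ahead a = enc_nat (head G (edge_of a))"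
    "head G (edge_of a) \<in> set P"
  using part_path(4)[OF assms(1)] assms(2) by (auto simp: set_inner_arcs)

lemma path_tails: "P \<in> set Ps \<Longrightarrow>
    (\<Sum>a\<leftarrow>part_path P. of_bool (tail G (edge_of a) = v)) =
    (\<Sum>a\<leftarrow>part_path P. of_bool (atail a = enc_nat v) :: int)"
  by (rule sum_list_cong) (simp add: part_path_arc)

lemma path_heads: "P \<in> set Ps \<Longrightarrow>
    (\<Sum>a\<leftarrow>part_path P. of_bool (head G (edge_of a) = v)) =
    (\<Sum>a\<leftarrow>part_path P. of_bool (ahead a = enc_nat v) :: int)"
  by (rule sum_list_cong) (simp add: part_path_arc)

text \<open>The auxiliary visit arrives at the entry and departs at the exit; the inner path has
  exactly the opposite imbalance.\<close>

lemma path_balance: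
  assumes P: "P \<in> set Ps"
  shows "of_bool (part_exit P = v) + (\<Sum>a\<leftarrow>part_path P. of_bool (tail G (edge_of a) = v)) =
    of_bool (part_entry P = v) + (\<Sum>a\<leftarrow>part_path P. of_bool (head G (edge_of a) = v) :: int)"
  using excess_walk[OF part_path(1)[OF P], of "enc_nat v"]
  unfolding excess_sum_list path_tails[OF P] path_heads[OF P] by (auto simp: eq_commute)

text \<open>The path enters no vertex twice and never returns to its start, so even with the arrival
  at the entry every vertex of \<open>P\<close> is entered at most once.\<close>

lemma path_in_le:
  assumes P: "P \<in> set Ps"
  shows "of_bool (part_entry P = v) + (\<Sum>a\<leftarrow>part_path P. of_bool (head G (edge_of a) = v) :: int)
    \<le> of_bool (v \<in> set P)"
proof -
  have "(\<Sum>a\<leftarrow>part_path P. of_bool (head G (edge_of a) = v) :: int) =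
      of_bool (enc_nat v \<in> (\<lambda>a. ahead a) ` set (part_path P))"
    unfolding path_heads[OF P] by (rule sum_list_distinct[OF part_path(2)[OF P]])
  moreover have "v \<in> set P" if "enc_nat v \<in> (\<lambda>a. ahead a) ` set (part_path P)"
    using that part_path_arc[OF P] by auto
  moreover have "\<not> (part_entry P = v \<and> enc_nat v \<in> (\<lambda>a. ahead a) ` set (part_path P))"
    using part_path(3)[OF P] by auto
  ultimately show ?thesis using part_entry(2)[OF P] by auto
qed

section \<open>Degrees and cuts in the assembled edge list\<close>

lemma sum_solution: "(\<Sum>e\<leftarrow>solution. f e) =
    (\<Sum>a\<leftarrow>used. f (edge_of a)) + (\<Sum>P\<in>set Ps. \<Sum>a\<leftarrow>part_path P. f (edge_of a) :: int)"
proof -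
  have "(\<Sum>e\<leftarrow>concat (map (\<lambda>P. map edge_of (part_path P)) Ps). f e) =
      (\<Sum>P\<leftarrow>Ps. \<Sum>a\<leftarrow>part_path P. f (edge_of a))"
    unfolding sum_list_concat_map by (simp add: comp_def)
  also have "\<dots> = (\<Sum>P\<in>set Ps. \<Sum>a\<leftarrow>part_path P. f (edge_of a))"
    by (rule sum_list_distinct_conv_sum_set[OF distinct_Ps])
  finally show ?thesis by (simp add: solution_def comp_def)
qed

lemma output_tails: "(\<Sum>e\<leftarrow>solution. of_bool (tail G e = v)) =
    (\<Sum>a\<leftarrow>used. of_bool (atail a = out_node d (enc_nat v))) +
    (\<Sum>P\<in>set Ps. of_bool (part_exit P = v) + (\<Sum>a\<leftarrow>part_path P. of_bool (tail G (edge_of a) = v)) :: int)"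
proof -
  have "(\<Sum>a\<leftarrow>used. of_bool (tail G (edge_of a) = v)) =
      (\<Sum>a\<leftarrow>used. of_bool (atail a = out_node d (enc_nat v)) +
        (\<Sum>P\<in>set Ps. of_bool (atail a = pout (enc_part P) \<and> tail G (edge_of a) = v)) :: int)"
    by (rule sum_list_cong) (rule tail_split)
  also have "\<dots> = (\<Sum>a\<leftarrow>used. of_bool (atail a = out_node d (enc_nat v))) +
      (\<Sum>P\<in>set Ps. of_bool (part_exit P = v))"
    unfolding sum_list_addf sum_list_sum_swap using part_exit(3) by (simp cong: sum.cong)
  finally show ?thesis unfolding sum_solution by (simp add: sum.distrib)
qed

lemma output_heads: "(\<Sum>e\<leftarrow>solution. of_bool (head G e = v)) =
    (\<Sum>a\<leftarrow>used. of_bool (ahead a = in_node d (enc_nat v))) +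
    (\<Sum>P\<in>set Ps. of_bool (part_entry P = v) + (\<Sum>a\<leftarrow>part_path P. of_bool (head G (edge_of a) = v)) :: int)"
proof -
  have "(\<Sum>a\<leftarrow>used. of_bool (head G (edge_of a) = v)) =
      (\<Sum>a\<leftarrow>used. of_bool (ahead a = in_node d (enc_nat v)) +
        (\<Sum>P\<in>set Ps. of_bool (ahead a = pin (enc_part P) \<and> head G (edge_of a) = v)) :: int)"
    by (rule sum_list_cong) (rule head_split)
  also have "\<dots> = (\<Sum>a\<leftarrow>used. of_bool (ahead a = in_node d (enc_nat v))) +
      (\<Sum>P\<in>set Ps. of_bool (part_entry P = v))"
    unfolding sum_list_addf sum_list_sum_swap using part_entry(3) by (simp cong: sum.cong)
  finally show ?thesis unfolding sum_solution by (simp add: sum.distrib)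
qed

lemma output_arcs: "set solution \<subseteq> arcs G"
  unfolding solution_def using part_path_arc(1) by (auto elim!: used_cases)

lemma output_balance:
  "size {#e \<in># mset solution. tail G e = v#} = size {#e \<in># mset solution. head G e = v#}"
proof -
  have "(\<Sum>e\<leftarrow>solution. of_bool (tail G e = v)) = (\<Sum>e\<leftarrow>solution. of_bool (head G e = v) :: int)"
    unfolding output_tails output_heads node_balance
    by (rule arg_cong[where f = "\<lambda>z. _ + z"], rule sum.cong[OF refl path_balance])
  then show ?thesis using size_filter_mset[of "\<lambda>e. tail G e = v" solution]
    size_filter_mset[of "\<lambda>e. head G e = v" solution] by simp
qed

lemma eulerian_solution: "eulerian G (mset solution)"
  unfolding eulerian_def using output_arcs output_balance by simp

text \<open>One entry comes from the flow at the node of \<open>v\<close> itself. The parts are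
  disjoint, so at most one further entry comes from the visit of a part.\<close>

lemma output_indegree:
  assumes "v \<in> tight"
  shows "size {#e \<in># mset solution. head G e = v#} \<le> 2"
proof -
  have "(\<Sum>P\<in>set Ps. of_bool (part_entry P = v) + (\<Sum>a\<leftarrow>part_path P. of_bool (head G (edge_of a) = v)) :: int)
      \<le> (\<Sum>P\<in>set Ps. of_bool (v \<in> set P))"
    by (rule sum_mono) (rule path_in_le)
  also have "\<dots> \<le> 1" by (rule sum_parts_le_1)
  finally have "(\<Sum>e\<leftarrow>solution. of_bool (head G e = v) :: int) \<le> 2"
    unfolding output_heads using node_in_le[OF assms] by linarith
  then show ?thesis using size_filter_mset[of "\<lambda>e. head G e = v" solution] by simp
qed

lemma spc_solution_solution: "spc_solution G (map set Ps) (mset solution)"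
proof -
  have "size (out_cut_in G (mset solution) (set P)) \<ge> 1" if P: "P \<in> set Ps" for P
  proof -
    obtain e where e: "e \<in> edge_of ` set used" "tail G e \<in> set P" "head G e \<notin> set P"
      using part_exit(4)[OF P] by blast
    then have "e \<in># mset solution" by (simp add: solution_def)
    moreover from this have "e \<in> out_cut G (set P)" using e output_arcs by (auto simp: out_cut_def)
    ultimately have "e \<in># out_cut_in G (mset solution) (set P)" by (simp add: out_cut_in_def)
    then have "out_cut_in G (mset solution) (set P) \<noteq> {#}" by auto
    then show ?thesis by (simp add: Suc_le_eq nonempty_has_size)
  qed
  then show ?thesis unfolding spc_solution_def using eulerian_solution by simp
qed

lemma enc_solution: "solve d = enc_list enc_nat solution"
proof -
  have 1: "map (\<lambda>a. ename (alabel a)) used = map enc_nat (map edge_of used)"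
  proof -
    have "ename (alabel a) = enc_nat (edge_of a)" if "a \<in> set used" for a
      using that by (cases rule: used_cases) simp
    then show ?thesis by simp
  qed
  have 2: "map (\<lambda>a. ename (alabel a)) (part_path P) = map enc_nat (map edge_of (part_path P))"
    if "P \<in> set Ps" for P
    using part_path_arc(2)[OF that] by simp
  have "map (\<lambda>P. map (\<lambda>a. ename (alabel a)) (part_path P)) Ps =
      map (\<lambda>P. map enc_nat (map edge_of (part_path P))) Ps"
    using 2 by (intro map_cong refl)
  then have "concat (map (\<lambda>P. map (\<lambda>a. ename (alabel a)) (part_path P)) Ps) =
      map enc_nat (concat (map (\<lambda>P. map edge_of (part_path P)) Ps))"
    by (simp only: map_concat map_map comp_def)
  then have "map (\<lambda>a. ename (alabel a)) used @
      concat (map (\<lambda>P. map (\<lambda>a. ename (alabel a)) (part_path P)) Ps) = map enc_nat solution"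
    using 1 by (simp add: solution_def)
  moreover have "solve d = of_list (map (\<lambda>a. ename (alabel a)) used @
      concat (map (\<lambda>P. map (\<lambda>a. ename (alabel a)) (part_path P)) Ps))"
    by (simp add: solve_def assemble_def d_parts used_def part_path_def flow_def comp_def)
  ultimately show ?thesis by (simp add: enc_list_of_list)
qed

end

subsection \<open>The weight of the output\<close>

lemma size_filter_mset_disj:
  "(\<And>e. Q e \<Longrightarrow> A e \<or> B e) \<Longrightarrow> size {#e \<in># T. Q e#} \<le> size {#e \<in># T. A e#} + size {#e \<in># T. B e#}"
  by (induction T) auto

context spc_encoded
begin

lemma tight_iff: "v \<in> tight \<longleftrightarrow> {v} \<in> L"
  using L_subsets[of "{v}"] by (auto simp: tight_def)

lemma finite_L: "finite L"
  by (rule finite_subset[of L "Pow (verts G)"]) (use L_subsets in auto)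

lemma total_weight_eq:
  "total_weight G L y T = (\<Sum>S\<in>L. y S * real (size {#e \<in># T. e \<in> cut G S#}))"
proof (induction T)
  case empty
  show ?case by (simp add: total_weight_def)
next
  case (add e T)
  have "weight G L y e = (\<Sum>S\<in>L. y S * of_bool (e \<in> cut G S))"
    unfolding weight_def by (rule sum_filter_of_bool[OF finite_L])
  moreover have "y S * real (size {#f \<in># add_mset e T. f \<in> cut G S#}) =
      y S * of_bool (e \<in> cut G S) + y S * real (size {#f \<in># T. f \<in> cut G S#})" for S
    by (simp add: algebra_simps)
  ultimately show ?case using add by (simp add: total_weight_def sum.distrib)
qed

text \<open>The estimate is made vertex by vertex from degrees, which can only drop in a
  sub-multiset; connectedness of \<open>T\<close> does not enter.\<close>

lemma solution_light:
  assumes single: "singleton_family L" and T: "T \<subseteq># mset solution"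
  shows "total_weight G L y T \<le> 2 * lb G L y T"
proof -
  let ?E = "edge_verts G T"
  let ?k = "\<lambda>v. size {#e \<in># T. e \<in> cut G {v}#}"
  have finE: "finite ?E" by (simp add: edge_verts_def)
  \<comment> \<open>4 is two entries plus two departures. The departures are bounded through the
    balance of the whole solution, since \<open>T\<close> is an arbitrary sub-multiset here.\<close>
  have k: "?k v \<le> (if v \<in> ?E then 4 else 0)" if v: "v \<in> tight" for v
  proof (cases "v \<in> ?E")
    case True
    have "?k v \<le> size {#e \<in># T. tail G e = v#} + size {#e \<in># T. head G e = v#}"
      by (rule size_filter_mset_disj) (auto simp: cut_def out_cut_def in_cut_def)
    also have "\<dots> \<le> size {#e \<in># mset solution. tail G e = v#} + size {#e \<in># mset solution. head G e = v#}"
      by (intro add_mono size_mset_mono multiset_filter_mono T)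
    also have "\<dots> \<le> 4" using output_indegree[OF v] output_balance[of v] by simp
    finally show ?thesis using True by simp
  next
    case False
    then have "set_mset {#e \<in># T. e \<in> cut G {v}#} = {}"
      by (auto simp: edge_verts_def cut_def out_cut_def in_cut_def)
    then have "{#e \<in># T. e \<in> cut G {v}#} = {#}" by (simp only: set_mset_eq_empty_iff)
    then show ?thesis using False by simp
  qed
  have L: "L = (\<lambda>v. {v}) ` tight"
    using single L_subsets unfolding singleton_family_def tight_def by force
  have "total_weight G L y T = (\<Sum>S\<in>(\<lambda>v. {v}) ` tight. y S * real (size {#e \<in># T. e \<in> cut G S#}))"
    unfolding total_weight_eq using L by simp
  also have "\<dots> = (\<Sum>v\<in>tight. y {v} * real (?k v))"
    by (rule sum.reindex_cong[of "\<lambda>v. {v}"]) (auto intro: inj_onI)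
  also have "\<dots> \<le> (\<Sum>v\<in>tight. if v \<in> ?E then 4 * y {v} else 0)"
  proof (rule sum_mono)
    fix v assume v: "v \<in> tight"
    then have "0 \<le> y {v}" using y_nonneg[of "{v}"] by (simp add: tight_def)
    then have "y {v} * real (?k v) \<le> y {v} * real (if v \<in> ?E then 4 else 0)"
      by (intro mult_left_mono of_nat_mono k[OF v])
    then show "y {v} * real (?k v) \<le> (if v \<in> ?E then 4 * y {v} else 0)"
      by (cases "v \<in> ?E") simp_all
  qed
  also have "\<dots> = (\<Sum>v\<in>tight \<inter> ?E. 4 * y {v})"
    by (rule sum.inter_restrict[OF finite_tight, symmetric])
  also have "\<dots> = (\<Sum>v\<in>?E \<inter> tight. 4 * y {v})" by (simp only: Int_commute)
  also have "\<dots> = (\<Sum>v\<in>?E. if v \<in> tight then 4 * y {v} else 0)"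
    by (rule sum.inter_restrict[OF finE])
  also have "\<dots> = (\<Sum>v\<in>?E. 2 * lb_vert L y v)"
    by (rule sum.cong) (auto simp: lb_vert_def tight_iff)
  also have "\<dots> = 2 * lb G L y T" by (simp add: lb_def sum_distrib_left)
  finally show ?thesis .
qed

end

subsection \<open>The running time\<close>

lemma size_le_length:
  "(\<And>a. a \<in> set (to_list D) \<Longrightarrow> size a < k) \<Longrightarrow> size D \<le> length (to_list D) * k"
proof (induction D)
  case (Node a D)
  have "size a < k" using Node.prems by simp
  moreover have "size D \<le> length (to_list D) * k" using Node by simp
  ultimately show ?case by simp
qed simp

text \<open>Every arc of an intermediate flow is an arc of the network, hence smaller than its code,
  and each augmentation adds at most as many arcs as the network lists.\<close>

lemma (in spc_encoded) augment_size:
  assumes "to_list (sources d) = xs @ ys"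
  shows "size (fold (augment (network d) (sinks d)) xs Leaf) \<le>
    size (sources d) * size (network d) * size (network d)"
proof -
  let ?M = "fold (augment (network d) (sinks d)) xs Leaf"
  have M: "set (to_list ?M) \<subseteq> set (to_list (network d))"
    "length (to_list ?M) \<le> length xs * length (to_list (network d))"
    using partial_prefix[OF assms] by (auto simp: partial_def)
  have "size ?M \<le> length (to_list ?M) * size (network d)"
    by (rule size_le_length) (use M(1) size_mem_to_list in auto)
  also have "\<dots> \<le> (length xs * length (to_list (network d))) * size (network d)"
    by (rule mult_le_mono1[OF M(2)])
  also have "\<dots> \<le> (size (sources d) * size (network d)) * size (network d)"
  proof (intro mult_le_mono1 mult_le_mono)
    show "length xs \<le> size (sources d)"
      using length_to_list_le[of "sources d"] assms by simp
    show "length (to_list (network d)) \<le> size (network d)" by (rule length_to_list_le)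
  qed
  finally show ?thesis .
qed

lemma to_list_enc_list: "to_list (enc_list f xs) = map f xs"
  by (induction xs) auto

lemma spc_encodedE:
  assumes "spc_input G L x y B Vs" "spc_code d G L x y B Vs"
  obtains vs es Ls Ps where "spc_encoded G L x y B vs es Ls Ps d" "Vs = map set Ps"
proof -
  obtain vs es Ls bs Ps where c: "distinct vs" "set vs = verts G" "distinct es" "set es = arcs G"
     "\<forall>l \<in> set Ls. distinct l" "set (map set Ls) = L" "map set Ps = Vs"
     and d: "d = enc_list id
       [enc_list enc_nat vs,
        enc_list (\<lambda>e. enc_list id
          [enc_nat e, enc_nat (tail G e), enc_nat (head G e), enc_real (x e)]) es,
        enc_list (\<lambda>l. Node (enc_list enc_nat l) (enc_real (y (set l)))) Ls,
        enc_list enc_nat bs,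
        enc_list (enc_list enc_nat) Ps]"
    using assms(2) unfolding spc_code_def by blast
  interpret atsp_instance G L x y using assms(1) by (simp add: spc_input_def)
  have "spc_encoded G L x y B vs es Ls Ps d"
  proof
    show "input_verts d = map enc_nat vs"
      "input_edges d = map (\<lambda>e. enc_list id
          [enc_nat e, enc_nat (tail G e), enc_nat (head G e), enc_real (x e)]) es"
      "input_family d = map (\<lambda>l. Node (enc_list enc_nat l) (enc_real (y (set l)))) Ls"
      "input_parts d = map (enc_list enc_nat) Ps"
      unfolding d by (simp_all add: to_list_enc_list)
    show "strongly_connected (G \<restriction> set P)" if "P \<in> set Ps" for P
      using assms(1) c(7) that by (auto simp: spc_input_def)
  qed (use assms(1) c in \<open>auto simp: spc_input_def\<close>)
  then show thesis using that c(7) by blast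
qed

definition spc_inputs :: "data set" where
  "spc_inputs = {d. \<exists>G L x y B Vs. spc_input G L x y B Vs \<and> spc_code d G L x y B Vs}"

lemma FP_solve_inputs: "FP spc_inputs solve"
proof -
  obtain p where p: "\<And>d. size (network d) \<le> poly p (size d)"
    using FP_size[OF FP_network[OF FP_id[of UNIV]]] by auto
  obtain q where q: "\<And>d. size (sources d) \<le> poly q (size d)"
    using FP_size[OF FP_sources[OF FP_id[of UNIV]]] by auto
  show ?thesis
  proof (rule FP_solve)
    fix d xs ys assume "d \<in> spc_inputs" and xs: "to_list (sources d) = xs @ ys"
    then obtain G L x y B Vs where "spc_input G L x y B Vs" "spc_code d G L x y B Vs"
      by (auto simp: spc_inputs_def)
    then obtain vs es Ls Ps where "spc_encoded G L x y B vs es Ls Ps d" by (rule spc_encodedE)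
    then have "size (fold (augment (network d) (sinks d)) xs Leaf) \<le>
        size (sources d) * size (network d) * size (network d)"
      by (rule spc_encoded.augment_size[OF _ xs])
    also have "\<dots> \<le> poly q (size d) * poly p (size d) * poly p (size d)"
      by (intro mult_le_mono p q)
    finally show "size (fold (augment (network d) (sinks d)) xs Leaf) \<le> poly (q * p * p) (size d)"
      by simp
  qed
qed

theorem mainTheorem5:
  "\<exists>A. spc_algorithm A \<and> spc_polynomial_time A \<and>
     (\<forall>G L x y. atsp_instance G L x y \<and> singleton_family L \<longrightarrow> spc_light A 2 0 G L x y {#})"
proof -
  obtain C p where C: "\<And>n s. s n \<in> spc_inputs \<Longrightarrow> runs (C n) n s (solve (s n)) (poly p (size (s n)))"
    using FP_solve_inputs unfolding FP_def by blast
  \<comment> \<open>Register 0 is where \<open>computes\<close> puts the input and reads the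
    output.\<close>
  let ?A = "C 0"
  have A: "\<exists>t. computes ?A d t (solve d) \<and> t \<le> poly p (size d)"
    if "spc_input G L x y B Vs" "spc_code d G L x y B Vs" for G L x y B Vs d
  proof -
    have "d \<in> spc_inputs" unfolding spc_inputs_def using that by blast
    then have "((\<lambda>_. Leaf)(0 := d)) 0 \<in> spc_inputs" by simp
    from C[of "(\<lambda>_. Leaf)(0 := d)" 0, OF this] show ?thesis
      unfolding runs_def computes_def by auto
  qed
  \<comment> \<open>Lightness is required of every output of the program; determinism identifies any
    such output with the one analysed.\<close>
  have computes_unique: "r = r'" if "computes ?A d t r" "computes ?A d t' r'" for d t t' r r'
    using that unfolding computes_def by (auto dest: exec_determ)
  have 1: "spc_algorithm ?A"
    unfolding spc_algorithm_def
  proof (intro allI impI, elim conjE)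
    fix G L x y B Vs d assume i: "spc_input G L x y B Vs" "spc_code d G L x y B Vs"
    then obtain vs es Ls Ps where e: "spc_encoded G L x y B vs es Ls Ps d" and Vs: "Vs = map set Ps"
      by (rule spc_encodedE)
    interpret spc_encoded G L x y B vs es Ls Ps d by (rule e)
    have "outputs ?A d (mset solution)"
      using A[OF i] unfolding outputs_def enc_solution by blast
    then show "\<exists>F. outputs ?A d F \<and> spc_solution G Vs F"
      using spc_solution_solution Vs by blast
  qed
  have 2: "spc_polynomial_time ?A"
    unfolding spc_polynomial_time_def
  proof (rule exI[of _ p], intro allI impI, elim conjE)
    fix G L x y B Vs d assume "spc_input G L x y B Vs" "spc_code d G L x y B Vs"
    from A[OF this] show "\<exists>t r. computes ?A d t r \<and> t \<le> poly p (size d)" by blast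
  qed
  have 3: "spc_light ?A 2 0 G L x y {#}" if "singleton_family L" for G L x y
    unfolding spc_light_def
  proof (intro allI impI, elim conjE)
    fix Vs d F assume i: "spc_input G L x y {#} Vs" "spc_code d G L x y {#} Vs" and o: "outputs ?A d F"
    obtain vs es Ls Ps where e: "spc_encoded G L x y {#} vs es Ls Ps d"
      using i by (rule spc_encodedE)
    interpret spc_encoded G L x y "{#}" vs es Ls Ps d by (rule e)
    obtain t fs where fs: "computes ?A d t (enc_list enc_nat fs)" "F = mset fs"
      using o unfolding outputs_def by blast
    obtain t' where "computes ?A d t' (solve d)" using A[OF i] by blast
    then have "enc_list enc_nat fs = enc_list enc_nat solution"
      using computes_unique[OF fs(1)] enc_solution by metis
    then have F: "F = mset solution" using fs(2) by simp
    have "total_weight G L y T \<le> 2 * lb G L y T" if "T \<in> subtours_in G F" for T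
    proof -
      have "T \<subseteq># mset solution" using that F unfolding subtours_in_def by auto
      then show ?thesis by (rule solution_light[OF \<open>singleton_family L\<close>])
    qed
    \<comment> \<open>The empty subtour has no vertices, so nothing intersects it; this gives
      \<beta> = 0.\<close>
    moreover have "subtours_meeting G F {#} = {#}"
      by (simp add: subtours_meeting_def intersects_def edge_verts_def)
    then have "total_weight G L y (subtours_meeting G F {#}) \<le> 0" by (simp add: total_weight_def)
    ultimately show "(\<forall>T\<in>subtours_in G F. edge_verts G T \<inter> edge_verts G {#} = {} \<longrightarrow>
          total_weight G L y T \<le> 2 * lb G L y T) \<and>
        total_weight G L y (subtours_meeting G F {#}) \<le> 0" by blast
  qed
  from 1 2 3 show ?thesis by blast
qed

end
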